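(* Let $\Gamma$, $H_0=\Delta+W$, $d$, $\mathcal C$, $V_c$, the guided potential $Q$, and the guided bands be as in the context, and let $H=H_0-Q$. Let $\mathcal C_{\mathfrak m}$ be the graph with vertex set $V_c$ obtained from $\mathcal C$ by deleting all bridges, let $\Delta_{\mathfrak m}$ be its Laplacian $(\Delta_{\mathfrak m}f)(v)=\sum_{(v,u)\text{ oriented edge of }\mathcal C_{\mathfrak m}}(f(v)-f(u))$ on $\ell^2(V_c)$, and let $h=\Delta_{\mathfrak m}+W-Q$ on $\ell^2(V_c)$ ($W,Q$ restricted to $V_c$). Let $\tilde\mu_1\le\tilde\mu_2\le\dots$ be the eigenvalues of $h$ below $\inf\sigma_{ess}(h)$ counted with multiplicity, and put $\mu_j=\min\{\tilde\mu_j,\inf\sigma_{ess}(h)\}$ for $j=1,\dots,p$ (with $\mu_j=\inf\sigma_{ess}(h)$ if there are fewer than $j$ such eigenvalues). Then for each $j=1,\dots,N_g$, $$\mathfrak s_j^o(H)\subset[\mu_j,\mu_j+2\beta_+],\qquad \beta_+=\max_{v\in V_c}\beta_v .$$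
   Context: Let $\tilde d\ge2$ and let $\Gamma=(V,\mathcal E)$ be a connected infinite graph (loops and multiple edges allowed) with all vertex degrees finite, embedded in $\mathbb R^{\tilde d}$, invariant under translations by linearly independent vectors $a_1,\dots,a_{\tilde d}$, with finite quotient $\Gamma/\mathbb Z^{\tilde d}$; coordinates are taken w.r.t. the basis $a_1,\dots,a_{\tilde d}$ and a fixed origin. $\mathcal A$ is the set of oriented edges (each unoriented edge, including each loop, gives two); $(u,v)$ is an oriented edge from $u$ to $v$. $(\Delta f)(v)=\sum_{(v,u)\in\mathcal A}(f(v)-f(u))$ on $\ell^2(V)$. $W:V\to\mathbb R$ with $W(v+a_s)=W(v)$ for all $s\le\tilde d$; $H_0=\Delta+W$, normalized (standing assumption) so that $\inf\sigma(H_0)=0$. Fix an integer $1\le d<\tilde d$. $V_c=V\cap([0,1)^d\times\mathbb R^{\tilde d-d})$; each $v\in V$ is uniquely $v=v_0+[v]$, $v_0\in V_c$, $[v]\in\mathbb Z^d$ meaning $v-v_0=\sum_{s=1}^d n_sa_s$, $[v]=(n_1,\dots,n_d)$. The index of $\mathbf e=(u,v)\in\mathcal A$ is $\tau(\mathbf e)=[v]-[u]$. The cylinder $\mathcal C=\Gamma/\mathbb Z^d$ ($\mathbb Z^d$ acting by translations by $a_1,\dots,a_d$) has vertex set $V_c$ and oriented edge set $\mathcal A_c=\mathcal A/\mathbb Z^d$, each edge carrying the (well-defined) index of its representatives. Bridges are edges with nonzero index; $\beta_v$ is the number of oriented bridges of $\mathcal C$ starting at $v\in V_c$. A guided potential is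 $Q:V\to[0,\infty)$ with $Q(v+a_s)=Q(v)$ for $s=1,\dots,d$ and $\{v\in V_c:Q(v)\ne0\}=\{v_1,\dots,v_p\}$ finite. For $\vartheta\in\mathbb T^d=\mathbb R^d/(2\pi\mathbb Z)^d$ the fiber operator on $\ell^2(V_c)$ is $H(\vartheta)=\Delta(\vartheta)+W-Q$, with $(\Delta(\vartheta)f)(v)=\sum_{\mathbf e=(v,u)\in\mathcal A_c}(f(v)-e^{i\langle\tau(\mathbf e),\vartheta\rangle}f(u))$. Let $\lambda_1(\vartheta)\le\dots\le\lambda_{N_\vartheta}(\vartheta)$ be the eigenvalues of finite multiplicity of $H(\vartheta)$ (one has $N_\vartheta\le p$), $N=\max_\vartheta N_\vartheta$, and the guided bands are $\mathfrak s_j(H)=\lambda_j(\mathbb T^d)=[\lambda_j^-,\lambda_j^+]$, $j=1,\dots,N$. The guided bands below $\inf\sigma(H_0)=0$ are $\mathfrak s_j^o(H)=\mathfrak s_j(H)\cap(-\infty,0]$, for those $j=1,\dots,N_g$ for which this set is nonempty. *)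

theory Defs
  imports "HOL-Analysis.Analysis"
begin

text \<open>Points of R^dt are functions nat => real, vanishing at coordinates >= dt.
  Coordinates are w.r.t. the lattice basis a_1..a_dt, so translation by a_(s+1)
  is adding 1 to coordinate s (coordinates are indexed from 0).\<close>

type_synonym pt = "nat \<Rightarrow> real"

definition unitshift :: "nat \<Rightarrow> pt \<Rightarrow> pt" where
  "unitshift s v = v(s := v s + 1)"

definition Vcyl :: "nat \<Rightarrow> pt set \<Rightarrow> pt set" where
  "Vcyl d V = {v \<in> V. \<forall>i<d. 0 \<le> v i \<and> v i < 1}"

definition cell :: "nat \<Rightarrow> pt \<Rightarrow> (nat \<Rightarrow> int)" where
  "cell d p = (\<lambda>i. if i < d then \<lfloor>p i\<rfloor> else 0)"

definition base :: "nat \<Rightarrow> pt \<Rightarrow> pt" where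
  "base d p = (\<lambda>i. if i < d then p i - of_int \<lfloor>p i\<rfloor> else p i)"

definition tau :: "nat \<Rightarrow> ('e \<Rightarrow> pt) \<Rightarrow> ('e \<Rightarrow> pt) \<Rightarrow> 'e \<Rightarrow> (nat \<Rightarrow> int)" where
  "tau d src tgt e = (\<lambda>i. cell d (tgt e) i - cell d (src e) i)"

definition ipd :: "nat \<Rightarrow> (nat \<Rightarrow> int) \<Rightarrow> (nat \<Rightarrow> real) \<Rightarrow> real" where
  "ipd d n \<theta> = (\<Sum>i<d. of_int (n i) * \<theta> i)"

definition torus :: "nat \<Rightarrow> (nat \<Rightarrow> real) set" where
  "torus d = {\<theta>. \<forall>i. (i < d \<longrightarrow> 0 \<le> \<theta> i \<and> \<theta> i < 2 * pi) \<and> (d \<le> i \<longrightarrow> \<theta> i = 0)}"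

text \<open>number of oriented bridges of the cylinder starting at v (v in V_c)\<close>
definition beta :: "nat \<Rightarrow> ('e \<Rightarrow> pt) \<Rightarrow> ('e \<Rightarrow> pt) \<Rightarrow> pt \<Rightarrow> nat" where
  "beta d src tgt v = card {e. src e = v \<and> tau d src tgt e \<noteq> (\<lambda>_. 0)}"

definition beta_plus :: "nat \<Rightarrow> pt set \<Rightarrow> ('e \<Rightarrow> pt) \<Rightarrow> ('e \<Rightarrow> pt) \<Rightarrow> nat" where
  "beta_plus d V src tgt = Max (beta d src tgt ` Vcyl d V)"

type_synonym op = "(pt \<Rightarrow> complex) \<Rightarrow> (pt \<Rightarrow> complex)"

definition opH0 :: "pt set \<Rightarrow> ('e \<Rightarrow> pt) \<Rightarrow> ('e \<Rightarrow> pt) \<Rightarrow> (pt \<Rightarrow> real) \<Rightarrow> op" where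
  "opH0 V src tgt W f = (\<lambda>v. if v \<in> V then
      (\<Sum>e | src e = v. f v - f (tgt e)) + complex_of_real (W v) * f v else 0)"

text \<open>Fiber operator H(theta) = Delta(theta) + W - Q on l2(V_c).  The oriented edges of
  the cylinder starting at v in V_c are in bijection with the oriented edges of Gamma
  starting at v (their unique representatives starting at v); the endpoint class is
  represented by base (tgt e) in V_c.\<close>
definition opHfib :: "nat \<Rightarrow> pt set \<Rightarrow> ('e \<Rightarrow> pt) \<Rightarrow> ('e \<Rightarrow> pt) \<Rightarrow> (pt \<Rightarrow> real) \<Rightarrow> (pt \<Rightarrow> real)
    \<Rightarrow> (nat \<Rightarrow> real) \<Rightarrow> op" where
  "opHfib d V src tgt W Q \<theta> f = (\<lambda>v. if v \<in> Vcyl d V then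
      (\<Sum>e | src e = v. f v - exp (\<i> * complex_of_real (ipd d (tau d src tgt e) \<theta>)) * f (base d (tgt e)))
      + complex_of_real (W v - Q v) * f v else 0)"

definition oph :: "nat \<Rightarrow> pt set \<Rightarrow> ('e \<Rightarrow> pt) \<Rightarrow> ('e \<Rightarrow> pt) \<Rightarrow> (pt \<Rightarrow> real) \<Rightarrow> (pt \<Rightarrow> real) \<Rightarrow> op" where
  "oph d V src tgt W Q f = (\<lambda>v. if v \<in> Vcyl d V then
      (\<Sum>e | src e = v \<and> tau d src tgt e = (\<lambda>_. 0). f v - f (tgt e))
      + complex_of_real (W v - Q v) * f v else 0)"

definition l2 :: "pt set \<Rightarrow> (pt \<Rightarrow> complex) set" where
  "l2 X = {f. (\<forall>x. x \<notin> X \<longrightarrow> f x = 0) \<and> (\<lambda>x. (cmod (f x))\<^sup>2) summable_on X}"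

definition l2norm :: "pt set \<Rightarrow> (pt \<Rightarrow> complex) \<Rightarrow> real" where
  "l2norm X f = sqrt (infsum (\<lambda>x. (cmod (f x))\<^sup>2) X)"

definition in_resolvent :: "pt set \<Rightarrow> op \<Rightarrow> complex \<Rightarrow> bool" where
  "in_resolvent X A z \<longleftrightarrow> (\<exists>B.
      (\<forall>f\<in>l2 X. (\<lambda>x. A f x - z * f x) \<in> l2 X \<and> B (\<lambda>x. A f x - z * f x) = f) \<and>
      (\<forall>g\<in>l2 X. B g \<in> l2 X \<and> (\<lambda>x. A (B g) x - z * B g x) = g) \<and>
      (\<exists>C. \<forall>g\<in>l2 X. l2norm X (B g) \<le> C * l2norm X g))"

definition spectrum :: "pt set \<Rightarrow> op \<Rightarrow> complex set" where
  "spectrum X A = {z. \<not> in_resolvent X A z}"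

definition lin_indep :: "(pt \<Rightarrow> complex) list \<Rightarrow> bool" where
  "lin_indep fs \<longleftrightarrow> (\<forall>c::nat \<Rightarrow> complex.
      (\<forall>x. (\<Sum>i<length fs. c i * (fs ! i) x) = 0) \<longrightarrow> (\<forall>i<length fs. c i = 0))"

definition mult :: "pt set \<Rightarrow> op \<Rightarrow> complex \<Rightarrow> enat" where
  "mult X A z = Sup {enat n | n. \<exists>fs. length fs = n \<and> lin_indep fs \<and>
      (\<forall>f\<in>set fs. f \<in> l2 X \<and> A f = (\<lambda>x. z * f x))}"

definition disc_spectrum :: "pt set \<Rightarrow> op \<Rightarrow> complex set" where
  "disc_spectrum X A = {z \<in> spectrum X A. (\<exists>\<epsilon>>0. ball z \<epsilon> \<inter> spectrum X A = {z})
      \<and> 0 < mult X A z \<and> mult X A z < \<infinity>}"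

definition ess_spectrum :: "pt set \<Rightarrow> op \<Rightarrow> complex set" where
  "ess_spectrum X A = spectrum X A - disc_spectrum X A"

definition inf_spec :: "pt set \<Rightarrow> op \<Rightarrow> real" where
  "inf_spec X A = Inf {x::real. complex_of_real x \<in> spectrum X A}"

definition inf_ess :: "pt set \<Rightarrow> op \<Rightarrow> real" where
  "inf_ess X A = Inf {x::real. complex_of_real x \<in> ess_spectrum X A}"

definition count_below :: "pt set \<Rightarrow> op \<Rightarrow> real \<Rightarrow> enat" where
  "count_below X A t = Sup {enat n | n. \<exists>fs ls. length fs = n \<and> length ls = n \<and> lin_indep fs \<and>
      (\<forall>i<n. fs ! i \<in> l2 X \<and> A (fs ! i) = (\<lambda>x. complex_of_real (ls ! i) * (fs ! i) x) \<and> ls ! i \<le> t)}"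

definition mu :: "pt set \<Rightarrow> op \<Rightarrow> nat \<Rightarrow> real" where
  "mu X A j = Inf ({t. t < inf_ess X A \<and> enat j \<le> count_below X A t} \<union> {inf_ess X A})"

definition count_fin :: "pt set \<Rightarrow> op \<Rightarrow> real \<Rightarrow> enat" where
  "count_fin X A t = Sup {enat n | n. \<exists>fs ls. length fs = n \<and> length ls = n \<and> lin_indep fs \<and>
      (\<forall>i<n. fs ! i \<in> l2 X \<and> A (fs ! i) = (\<lambda>x. complex_of_real (ls ! i) * (fs ! i) x)
         \<and> mult X A (complex_of_real (ls ! i)) < \<infinity> \<and> ls ! i \<le> t)}"

definition num_fin :: "pt set \<Rightarrow> op \<Rightarrow> enat" where
  "num_fin X A = Sup {enat n | n. \<exists>fs ls. length fs = n \<and> length ls = n \<and> lin_indep fs \<and>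
      (\<forall>i<n. fs ! i \<in> l2 X \<and> A (fs ! i) = (\<lambda>x. complex_of_real (ls ! i) * (fs ! i) x)
         \<and> mult X A (complex_of_real (ls ! i)) < \<infinity>)}"

definition lam :: "pt set \<Rightarrow> op \<Rightarrow> nat \<Rightarrow> real" where
  "lam X A j = Inf {t. enat j \<le> count_fin X A t}"

definition guided_band :: "nat \<Rightarrow> pt set \<Rightarrow> ('e \<Rightarrow> pt) \<Rightarrow> ('e \<Rightarrow> pt) \<Rightarrow> (pt \<Rightarrow> real) \<Rightarrow> (pt \<Rightarrow> real)
    \<Rightarrow> nat \<Rightarrow> real set" where
  "guided_band d V src tgt W Q j =
     {lam (Vcyl d V) (opHfib d V src tgt W Q \<theta>) j | \<theta>.
        \<theta> \<in> torus d \<and> enat j \<le> num_fin (Vcyl d V) (opHfib d V src tgt W Q \<theta>)}"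

definition guided_band_o :: "nat \<Rightarrow> pt set \<Rightarrow> ('e \<Rightarrow> pt) \<Rightarrow> ('e \<Rightarrow> pt) \<Rightarrow> (pt \<Rightarrow> real) \<Rightarrow> (pt \<Rightarrow> real)
    \<Rightarrow> nat \<Rightarrow> real set" where
  "guided_band_o d V src tgt W Q j = guided_band d V src tgt W Q j \<inter> {..0}"

definition N_g :: "nat \<Rightarrow> pt set \<Rightarrow> ('e \<Rightarrow> pt) \<Rightarrow> ('e \<Rightarrow> pt) \<Rightarrow> (pt \<Rightarrow> real) \<Rightarrow> (pt \<Rightarrow> real) \<Rightarrow> nat" where
  "N_g d V src tgt W Q = card {j. 1 \<le> j \<and> guided_band_o d V src tgt W Q j \<noteq> {}}"

end

theory Submission
  imports Defs
begin

text \<open>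
  Deleting the bridges changes \<open>H(\<theta>)\<close> by the Laplacian of the bridges, whose quadratic form lies
  between \<open>0\<close> and \<open>2\<beta>\<^sub>+\<close>, so that \<open>h \<le> H(\<theta>) \<le> h + 2\<beta>\<^sub>+\<close>, and the min-max values obey the same
  inequalities. The min-max principle rests on two facts: the infimum of a symmetric form on an
  invariant closed subspace belongs to the spectrum, and it is an eigenvalue if it is isolated
  there; and, by Weyl's criterion, a point of the essential spectrum has almost null vectors
  orthogonal to any finite set. The essential spectrum of \<open>H(\<theta>)\<close> is nonnegative because \<open>Q\<close> has
  finite rank on the cylinder and the form of \<open>H\<^sub>0(\<theta>)\<close> is a limit of averages of the nonnegative
  form of \<open>H\<^sub>0\<close> over truncated Bloch waves.
\<close>

section \<open>Projections onto finite-dimensional subspaces\<close>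

lemma sgn_in_subspace:
  fixes x :: "'a::real_normed_vector"
  shows "subspace S \<Longrightarrow> x \<in> S \<Longrightarrow> sgn x \<in> S"
  by (simp add: sgn_div_norm subspace_scale)

lemma subspace_closure:
  fixes S :: "'a::real_normed_vector set"
  assumes "subspace S"
  shows "subspace (closure S)"
  unfolding subspace_def
proof (intro conjI ballI allI)
  show "0 \<in> closure S" using assms closure_subset subspace_0 by blast
  show "x + y \<in> closure S" if xy: "x \<in> closure S" "y \<in> closure S" for x y
  proof -
    obtain f where "\<forall>n. f n \<in> S" "f \<longlonglongrightarrow> x"
      using xy(1) unfolding closure_sequential by blast
    moreover obtain g where "\<forall>n. g n \<in> S" "g \<longlonglongrightarrow> y"
      using xy(2) unfolding closure_sequential by blast
    ultimately show ?thesis unfolding closure_sequential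
      using assms by (intro exI[of _ "\<lambda>n. f n + g n"]) (auto intro: tendsto_add subspace_add)
  qed
  show "c *\<^sub>R x \<in> closure S" if x: "x \<in> closure S" for c x
  proof -
    obtain f where "\<forall>n. f n \<in> S" "f \<longlonglongrightarrow> x"
      using x unfolding closure_sequential by blast
    then show ?thesis unfolding closure_sequential
      using assms by (intro exI[of _ "\<lambda>n. c *\<^sub>R f n"]) (auto intro: tendsto_scaleR subspace_scale)
  qed
qed

lemma closed_orthogonal_comp: "closed (W\<^sup>\<bottom>)"
proof -
  have "W\<^sup>\<bottom> = (\<Inter>y\<in>W. {x. y \<bullet> x = 0})"
    by (auto simp: orthogonal_comp_def orthogonal_def)
  then show ?thesis by (simp add: closed_INT closed_Collect_eq continuous_intros)
qed

lemma orthogonal_comp_span: "(span W)\<^sup>\<bottom> = W\<^sup>\<bottom>"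
  by (auto simp: orthogonal_comp_def orthogonal_commute intro: span_base orthogonal_to_span)

definition orth_proj :: "'a::real_inner set \<Rightarrow> 'a \<Rightarrow> 'a" where
  "orth_proj C x = (\<Sum>c\<in>C. (x \<bullet> c / (c \<bullet> c)) *\<^sub>R c)"

lemma linear_orth_proj: "linear (orth_proj C)"
  by (rule linearI)
    (simp_all add: orth_proj_def inner_add_left add_divide_distrib scaleR_add_left sum.distrib
      scaleR_sum_right)

lemma orth_proj_in_span: "orth_proj C x \<in> span C"
  unfolding orth_proj_def by (intro span_sum span_scale span_base)

lemma diff_orth_proj_in_orthogonal_comp:
  assumes "finite C" "pairwise orthogonal C"
  shows "x - orth_proj C x \<in> C\<^sup>\<bottom>"
proof -
  have "orth_proj C x \<bullet> c = x \<bullet> c" if c: "c \<in> C" for c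
  proof -
    have "orth_proj C x \<bullet> c = (\<Sum>b\<in>C. x \<bullet> b / (b \<bullet> b) * (b \<bullet> c))"
      by (simp add: orth_proj_def inner_sum_left)
    also have "\<dots> = (\<Sum>b\<in>{c}. x \<bullet> b / (b \<bullet> b) * (b \<bullet> c))"
      using assms c by (intro sum.mono_neutral_right) (auto simp: pairwise_def orthogonal_def)
    finally show ?thesis by (cases "c = 0") auto
  qed
  then show ?thesis
    by (simp add: orthogonal_comp_def orthogonal_def inner_diff_right inner_commute)
qed

lemma exists_nonzero_in_span_orthogonal:
  fixes B F :: "'a::real_inner set"
  assumes "independent B" "finite B" "finite F" "card F < card B"
  obtains f where "f \<in> span B" "f \<noteq> 0" "f \<in> F\<^sup>\<bottom>"
proof -
  obtain C where C: "finite C" "card C \<le> card F" "span C = span F" "pairwise orthogonal C"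
    using basis_orthogonal[OF \<open>finite F\<close>] by blast
  have "\<not> inj_on (orth_proj C) (span B)"
  proof
    assume inj: "inj_on (orth_proj C) (span B)"
    then have "independent (orth_proj C ` B)"
      by (rule linear_independent_injective_image[OF linear_orth_proj \<open>independent B\<close>])
    then have "card (orth_proj C ` B) \<le> card C"
      using independent_span_bound[OF C(1)] orth_proj_in_span by blast
    moreover have "card (orth_proj C ` B) = card B"
      using inj by (intro card_image) (blast intro: inj_on_subset span_base)
    ultimately show False using C(2) assms(4) by simp
  qed
  then obtain f where f: "f \<in> span B" "f \<noteq> 0" "orth_proj C f = 0"
    using linear_injective_on_subspace_0[OF linear_orth_proj subspace_span] by blast
  have "f \<in> F\<^sup>\<bottom>"
    using diff_orth_proj_in_orthogonal_comp[OF C(1,4), of f] f(3) C(3) orthogonal_comp_span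
    by (metis diff_zero)
  with f that show ?thesis by blast
qed

lemma bounded_orth_proj_convergent_subsequence:
  fixes x :: "nat \<Rightarrow> 'a::real_inner"
  assumes "bounded (range x)" "finite C"
  obtains r where "strict_mono r" "convergent (\<lambda>n. orth_proj C (x (r n)))"
proof -
  define a where "a n c = x n \<bullet> c / (c \<bullet> c)" for n and c :: 'a
  have bounded_coeff: "bounded ((\<lambda>f. f c) ` range a)" for c
  proof -
    obtain K where K: "\<And>n. norm (x n) \<le> K" using assms(1) by (auto simp: bounded_iff)
    have "norm (a n c) \<le> K * norm c / (c \<bullet> c)" for n
    proof -
      have "\<bar>x n \<bullet> c\<bar> \<le> K * norm c"
        using Cauchy_Schwarz_ineq2[of "x n" c] mult_right_mono[OF K[of n], of "norm c"] by simp
      then show ?thesis by (simp add: a_def divide_right_mono)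
    qed
    then show ?thesis unfolding bounded_iff by blast
  qed
  have "\<forall>d\<subseteq>C. \<exists>l r. strict_mono r \<and>
      (\<forall>e>0. \<forall>\<^sub>F n in sequentially. \<forall>c\<in>d. dist (a (r n) c) (l c) < e)"
    by (rule compact_lemma_general[where proj = "\<lambda>f. f" and unproj = "\<lambda>f. f", OF assms(2)])
      (simp_all add: bounded_coeff)
  then obtain l r where r: "strict_mono r"
    and l: "\<And>e. e > 0 \<Longrightarrow> \<forall>\<^sub>F n in sequentially. \<forall>c\<in>C. dist (a (r n) c) (l c) < e" by blast
  have "(\<lambda>n. a (r n) c) \<longlonglongrightarrow> l c" if "c \<in> C" for c
    by (rule tendstoI, rule eventually_mono[OF l]) (use that in auto)
  then have "(\<lambda>n. orth_proj C (x (r n))) \<longlonglongrightarrow> (\<Sum>c\<in>C. l c *\<^sub>R c)"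
    unfolding orth_proj_def a_def[symmetric] by (intro tendsto_sum tendsto_scaleR tendsto_const)
  with r that show ?thesis by (auto simp: convergent_def)
qed

definition infinite_dimensional :: "'a::real_vector set \<Rightarrow> bool" where
  "infinite_dimensional M \<longleftrightarrow> (\<exists>B\<subseteq>M. independent B \<and> infinite B)"

lemma infinite_dimensionalE:
  assumes "infinite_dimensional M"
  obtains B where "finite B" "independent B" "card B = n" "B \<subseteq> M"
proof -
  obtain D where D: "D \<subseteq> M" "independent D" "infinite D"
    using assms unfolding infinite_dimensional_def by blast
  obtain B where B: "finite B" "card B = n" "B \<subseteq> D"
    using infinite_arbitrarily_large[OF D(3)] by blast
  show ?thesis using that[OF B(1) independent_mono[OF D(2) B(3)] B(2)] B(3) D(1) by blast
qed

section \<open>Operators bounded below\<close>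

definition bounded_below_on :: "'a::real_normed_vector set \<Rightarrow> ('a \<Rightarrow> 'b::real_normed_vector) \<Rightarrow> bool"
  where "bounded_below_on M T \<longleftrightarrow> (\<exists>\<delta>>0. \<forall>x\<in>M. \<delta> * norm x \<le> norm (T x))"

lemma bounded_below_onI:
  "0 < \<delta> \<Longrightarrow> (\<And>x. x \<in> M \<Longrightarrow> \<delta> * norm x \<le> norm (T x)) \<Longrightarrow> bounded_below_on M T"
  unfolding bounded_below_on_def by blast

lemma bounded_below_on_subset: "bounded_below_on M T \<Longrightarrow> N \<subseteq> M \<Longrightarrow> bounded_below_on N T"
  unfolding bounded_below_on_def by blast

lemma bounded_below_on_compose:
  assumes "bounded_below_on M S" "bounded_below_on N T" "S ` M \<subseteq> N"
  shows "bounded_below_on M (\<lambda>x. T (S x))"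
proof -
  obtain \<delta> where \<delta>: "0 < \<delta>" "\<And>x. x \<in> M \<Longrightarrow> \<delta> * norm x \<le> norm (S x)"
    using assms(1) unfolding bounded_below_on_def by blast
  obtain \<epsilon> where \<epsilon>: "0 < \<epsilon>" "\<And>y. y \<in> N \<Longrightarrow> \<epsilon> * norm y \<le> norm (T y)"
    using assms(2) unfolding bounded_below_on_def by blast
  have "\<epsilon> * \<delta> * norm x \<le> norm (T (S x))" if "x \<in> M" for x
  proof -
    have "\<epsilon> * (\<delta> * norm x) \<le> \<epsilon> * norm (S x)" using \<delta>(2)[OF that] \<epsilon>(1) by simp
    also have "\<dots> \<le> norm (T (S x))" using \<epsilon>(2) assms(3) that by blast
    finally show ?thesis by (simp add: mult.assoc)
  qed
  with \<delta>(1) \<epsilon>(1) show ?thesis by (intro bounded_below_onI[of "\<epsilon> * \<delta>"]) auto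
qed

lemma bounded_below_on_perturb:
  assumes "bounded_below_on M T"
  obtains \<epsilon> where "0 < \<epsilon>"
    "\<And>S. (\<And>x. x \<in> M \<Longrightarrow> norm (S x - T x) \<le> \<epsilon> * norm x) \<Longrightarrow> bounded_below_on M S"
proof -
  obtain \<delta> where \<delta>: "0 < \<delta>" "\<And>x. x \<in> M \<Longrightarrow> \<delta> * norm x \<le> norm (T x)"
    using assms unfolding bounded_below_on_def by blast
  show ?thesis
  proof (rule that[of "\<delta> / 2"])
    fix S assume S: "\<And>x. x \<in> M \<Longrightarrow> norm (S x - T x) \<le> \<delta> / 2 * norm x"
    have "\<delta> / 2 * norm x \<le> norm (S x)" if "x \<in> M" for x
      using \<delta>(2)[OF that] S[OF that] norm_triangle_ineq2[of "T x" "S x"]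
      by (simp add: norm_minus_commute)
    with \<delta>(1) show "bounded_below_on M S" by (intro bounded_below_onI[of "\<delta> / 2"]) auto
  qed (use \<delta>(1) in simp)
qed

lemma not_bounded_below_onE:
  fixes T :: "'a::real_normed_vector \<Rightarrow> 'b::real_normed_vector"
  assumes "\<not> bounded_below_on M T" "linear T" "subspace M" "0 < \<delta>"
  obtains x where "x \<in> M" "norm x = 1" "norm (T x) < \<delta>"
proof -
  interpret T: linear T by fact
  obtain x where x: "x \<in> M" "norm (T x) < \<delta> * norm x"
    using assms(1,4) unfolding bounded_below_on_def by (auto simp: not_le)
  then have nx: "norm x > 0" using T.zero by (cases "x = 0") auto
  show ?thesis
  proof (rule that)
    show "sgn x \<in> M" using assms(3) x(1) by (rule sgn_in_subspace)
    show "norm (sgn x) = 1" using nx by (simp add: norm_sgn)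
    show "norm (T (sgn x)) < \<delta>" using nx x(2) by (simp add: sgn_div_norm T.scale field_simps)
  qed
qed

lemma Cauchy_if_bounded_below_on:
  assumes bounded_below: "bounded_below_on M T" and "linear T" "subspace M"
    and q: "\<And>n. q n \<in> M" and Tq: "Cauchy (\<lambda>n. T (q n))"
  shows "Cauchy q"
  unfolding Cauchy_iff
proof (intro allI impI)
  fix e :: real assume "0 < e"
  obtain \<delta> where \<delta>: "0 < \<delta>" "\<And>x. x \<in> M \<Longrightarrow> \<delta> * norm x \<le> norm (T x)"
    using bounded_below unfolding bounded_below_on_def by blast
  then have "0 < \<delta> * e" using \<open>0 < e\<close> by simp
  then obtain N where N: "\<And>m n. N \<le> m \<Longrightarrow> N \<le> n \<Longrightarrow> norm (T (q m) - T (q n)) < \<delta> * e"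
    using Tq unfolding Cauchy_iff by blast
  have "norm (q m - q n) < e" if "N \<le> m" "N \<le> n" for m n
  proof -
    have "\<delta> * norm (q m - q n) \<le> norm (T (q m - q n))"
      using q \<open>subspace M\<close> by (intro \<delta>(2) subspace_diff)
    also have "\<dots> < \<delta> * e" using N[OF that] by (simp add: linear_diff[OF \<open>linear T\<close>])
    finally show ?thesis using \<delta>(1) by simp
  qed
  then show "\<exists>N. \<forall>m\<ge>N. \<forall>n\<ge>N. norm (q m - q n) < e" by blast
qed

section \<open>Symmetric operators on real Hilbert spaces\<close>

locale symmetric_operator = bounded_linear T for T :: "'a::real_inner \<Rightarrow> 'a" +
  fixes H :: "'a set"
  assumes symmetric: "T x \<bullet> y = x \<bullet> T y"
    and subspace_H: "subspace H"
    and T_in_H: "x \<in> H \<Longrightarrow> T x \<in> H"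
begin

lemma linear_diff_scaleR: "linear (\<lambda>x. T x - c *\<^sub>R x)"
  by (intro linear_compose_sub linear_axioms linear_scale_self)

lemma symmetric_operator_diff_scaleR: "symmetric_operator (\<lambda>x. T x - c *\<^sub>R x) H"
proof (intro symmetric_operator.intro symmetric_operator_axioms.intro)
  show "bounded_linear (\<lambda>x. T x - c *\<^sub>R x)"
    by (intro bounded_linear_sub bounded_linear_axioms bounded_linear_scaleR_right)
  show "T x - c *\<^sub>R x \<in> H" if "x \<in> H" for x
    using that by (intro subspace_diff subspace_scale subspace_H T_in_H)
qed (simp_all add: inner_diff_left inner_diff_right symmetric subspace_H)

lemma symmetric_operator_square: "symmetric_operator (\<lambda>x. T (T x)) H"
  by (intro symmetric_operator.intro symmetric_operator_axioms.intro T_in_H subspace_H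
      bounded_linear_compose[OF bounded_linear_axioms bounded_linear_axioms]) (simp add: symmetric)

lemma symmetric_operator_subspace:
  assumes "subspace M" "\<And>x. x \<in> M \<Longrightarrow> T x \<in> M"
  shows "symmetric_operator T M"
  using assms by unfold_locales (simp_all add: symmetric)

lemma norm_le_onorm: "norm (T x) \<le> onorm T * norm x"
  by (rule onorm[OF bounded_linear_axioms])

lemma onorm_nonneg: "0 \<le> onorm T"
  by (rule onorm_pos_le[OF bounded_linear_axioms])

lemma abs_form_le: "\<bar>T x \<bullet> x\<bar> \<le> onorm T * (x \<bullet> x)"
proof -
  have "\<bar>T x \<bullet> x\<bar> \<le> norm (T x) * norm x" by (rule Cauchy_Schwarz_ineq2)
  also have "\<dots> \<le> onorm T * norm x * norm x" by (intro mult_right_mono norm_le_onorm) auto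
  finally show ?thesis by (simp add: dot_square_norm power2_eq_square mult.assoc)
qed

lemma norm_sq_le_form:
  assumes nonneg: "\<And>x. x \<in> H \<Longrightarrow> 0 \<le> T x \<bullet> x" and x: "x \<in> H"
  shows "(norm (T x))\<^sup>2 \<le> onorm T * (T x \<bullet> x)"
proof (cases "onorm T = 0")
  case True
  then show ?thesis using norm_le_onorm[of x] by simp
next
  case False
  define K where "K = onorm T"
  have K: "K > 0" using False onorm_nonneg by (simp add: K_def)
  have T2: "T (T x) \<bullet> T x \<le> K * (T x \<bullet> T x)" using abs_form_le[of "T x"] by (simp add: K_def)
  have "K *\<^sub>R x - T x \<in> H" using x by (intro subspace_diff subspace_scale subspace_H T_in_H)
  then have "0 \<le> T (K *\<^sub>R x - T x) \<bullet> (K *\<^sub>R x - T x)" by (rule nonneg)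
  also have "\<dots> = K\<^sup>2 * (T x \<bullet> x) - 2 * K * (T x \<bullet> T x) + T (T x) \<bullet> T x"
    by (simp add: diff scaleR inner_diff_left inner_diff_right symmetric[of "T x" x] power2_eq_square
        algebra_simps)
  also have "\<dots> \<le> K * (K * (T x \<bullet> x) - T x \<bullet> T x)"
    using T2 by (simp add: power2_eq_square algebra_simps)
  finally show ?thesis using K by (simp add: zero_le_mult_iff dot_square_norm K_def)
qed

definition rayleigh_inf :: real where
  "rayleigh_inf = (INF x\<in>{x \<in> H. norm x = 1}. T x \<bullet> x)"

lemma rayleigh_inf_le:
  assumes "x \<in> H"
  shows "rayleigh_inf * (x \<bullet> x) \<le> T x \<bullet> x"
proof (cases "x = 0")
  case False
  have "- onorm T \<le> T y \<bullet> y" if "norm y = 1" for y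
    using abs_form_le[of y] that by (simp add: dot_square_norm)
  then have "bdd_below ((\<lambda>x. T x \<bullet> x) ` {x \<in> H. norm x = 1})"
    by (intro bdd_belowI[of _ "- onorm T"]) auto
  then have "rayleigh_inf \<le> T (sgn x) \<bullet> sgn x"
    unfolding rayleigh_inf_def using assms False subspace_H
    by (intro cINF_lower) (auto simp: norm_sgn sgn_in_subspace)
  then show ?thesis using False
    by (simp add: sgn_div_norm scaleR dot_square_norm power2_eq_square field_simps)
qed (simp add: zero)

lemma rayleigh_inf_less:
  assumes "x \<in> H" "x \<noteq> 0" "rayleigh_inf < c"
  obtains y where "y \<in> H" "norm y = 1" "T y \<bullet> y < c"
proof -
  have "sgn x \<in> {x \<in> H. norm x = 1}"
    using assms(1,2) subspace_H by (simp add: norm_sgn sgn_in_subspace)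
  then have "\<exists>v\<in>(\<lambda>x. T x \<bullet> x) ` {x \<in> H. norm x = 1}. v < c"
    using assms(3) unfolding rayleigh_inf_def by (intro cInf_lessD) auto
  with that show ?thesis by blast
qed

text \<open>For self-adjoint operators the approximate point spectrum is the whole spectrum.\<close>

definition ap_spectrum :: "real set" where
  "ap_spectrum = {c. \<not> bounded_below_on H (\<lambda>x. T x - c *\<^sub>R x)}"

lemma ap_spectrumE:
  assumes "c \<in> ap_spectrum" "0 < \<delta>"
  obtains x where "x \<in> H" "norm x = 1" "norm (T x - c *\<^sub>R x) < \<delta>"
  using assms not_bounded_below_onE[OF _ linear_diff_scaleR subspace_H]
  unfolding ap_spectrum_def by blast

lemma approx_eigenvectors_of_ap_spectrum:
  assumes "\<And>n. w n \<in> ap_spectrum" "\<And>n. 0 < d n"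
  obtains x where "\<And>n. x n \<in> H" "\<And>n. norm (x n) = 1" "\<And>n. norm (T (x n) - w n *\<^sub>R x n) < d n"
proof -
  have "\<exists>x. x \<in> H \<and> norm x = 1 \<and> norm (T x - w n *\<^sub>R x) < d n" for n
    by (rule ap_spectrumE[OF assms]) blast
  then show ?thesis using that by metis
qed

lemma eigenvalue_in_ap_spectrum:
  assumes "T x = c *\<^sub>R x" "x \<in> H" "x \<noteq> 0"
  shows "c \<in> ap_spectrum"
proof -
  have "\<not> \<delta> * norm x \<le> norm (T x - c *\<^sub>R x)" if "\<delta> > 0" for \<delta>
    using assms(1,3) that by (simp add: not_le)
  then show ?thesis using assms(2) unfolding ap_spectrum_def bounded_below_on_def by blast
qed

lemma abs_ap_spectrum_le_onorm:
  assumes "c \<in> ap_spectrum"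
  shows "\<bar>c\<bar> \<le> onorm T"
proof (rule ccontr)
  assume "\<not> \<bar>c\<bar> \<le> onorm T"
  moreover have "(\<bar>c\<bar> - onorm T) * norm x \<le> norm (T x - c *\<^sub>R x)" for x
    using norm_triangle_ineq2[of "c *\<^sub>R x" "T x"] norm_le_onorm[of x]
    by (simp add: norm_minus_commute algebra_simps)
  ultimately have "bounded_below_on H (\<lambda>x. T x - c *\<^sub>R x)"
    by (intro bounded_below_onI[of "\<bar>c\<bar> - onorm T"]) auto
  with assms show False by (simp add: ap_spectrum_def)
qed

lemma closed_ap_spectrum: "closed ap_spectrum"
  unfolding closed_def open_dist
proof safe
  fix c assume "c \<notin> ap_spectrum"
  then have "bounded_below_on H (\<lambda>x. T x - c *\<^sub>R x)" by (simp add: ap_spectrum_def)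
  then obtain \<epsilon> where \<epsilon>: "0 < \<epsilon>"
    "\<And>S. (\<And>x. x \<in> H \<Longrightarrow> norm (S x - (T x - c *\<^sub>R x)) \<le> \<epsilon> * norm x) \<Longrightarrow> bounded_below_on H S"
    by (rule bounded_below_on_perturb) blast
  have "c' \<in> - ap_spectrum" if "dist c' c < \<epsilon>" for c'
  proof -
    have "norm (T x - c' *\<^sub>R x - (T x - c *\<^sub>R x)) = \<bar>c' - c\<bar> * norm x" for x
      by (simp flip: scaleR_left_diff_distrib) (simp add: abs_minus_commute)
    then show ?thesis
      using that by (simp add: ap_spectrum_def dist_real_def \<epsilon>(2) mult_right_mono)
  qed
  then show "\<exists>\<epsilon>>0. \<forall>c'. dist c' c < \<epsilon> \<longrightarrow> c' \<in> - ap_spectrum" using \<epsilon>(1) by blast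
qed

lemma rayleigh_inf_in_ap_spectrum:
  assumes "x0 \<in> H" "x0 \<noteq> 0"
  shows "rayleigh_inf \<in> ap_spectrum"
proof (rule ccontr)
  define m where "m = rayleigh_inf"
  interpret S: symmetric_operator "\<lambda>x. T x - m *\<^sub>R x" H by (rule symmetric_operator_diff_scaleR)
  let ?K = "onorm (\<lambda>x. T x - m *\<^sub>R x)"
  assume "rayleigh_inf \<notin> ap_spectrum"
  then obtain \<delta> where \<delta>: "0 < \<delta>" "\<And>x. x \<in> H \<Longrightarrow> \<delta> * norm x \<le> norm (T x - m *\<^sub>R x)"
    unfolding ap_spectrum_def m_def bounded_below_on_def by blast
  have nonneg: "0 \<le> (T x - m *\<^sub>R x) \<bullet> x" if "x \<in> H" for x
    using rayleigh_inf_le[OF that] by (simp add: inner_diff_left m_def)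
  have bound: "\<delta>\<^sup>2 \<le> ?K * (T x \<bullet> x - m)" if "x \<in> H" "norm x = 1" for x
  proof -
    have "\<delta>\<^sup>2 \<le> (norm (T x - m *\<^sub>R x))\<^sup>2"
      using \<delta>(1) \<delta>(2)[OF that(1)] that(2) by (intro power_mono) auto
    also have "\<dots> \<le> ?K * ((T x - m *\<^sub>R x) \<bullet> x)" by (rule S.norm_sq_le_form[OF nonneg that(1)])
    finally show ?thesis using that(2) by (simp add: inner_diff_left dot_square_norm)
  qed
  have "?K \<noteq> 0"
  proof
    assume "?K = 0"
    with S.norm_le_onorm[of x0] \<delta>(2)[OF assms(1)] \<delta>(1) assms(2) show False
      by (simp add: mult_le_0_iff)
  qed
  then have K: "?K > 0" using S.onorm_nonneg by simp
  have "rayleigh_inf < m + \<delta>\<^sup>2 / ?K" using K \<delta>(1) by (simp add: m_def)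
  then obtain x where "x \<in> H" "norm x = 1" "T x \<bullet> x < m + \<delta>\<^sup>2 / ?K"
    by (rule rayleigh_inf_less[OF assms])
  with bound[of x] K show False by (simp add: field_simps)
qed

lemma norm_ge_of_gap_around_0:
  assumes c: "c > 0" and gap: "\<And>w. \<bar>w\<bar> < c \<Longrightarrow> w \<notin> ap_spectrum" and x: "x \<in> H"
  shows "c * norm x \<le> norm (T x)"
proof (rule ccontr)
  assume small: "\<not> c * norm x \<le> norm (T x)"
  interpret S: symmetric_operator "\<lambda>x. T (T x)" H by (rule symmetric_operator_square)
  define m where "m = S.rayleigh_inf"
  have form_square: "T (T x) \<bullet> x = (norm (T x))\<^sup>2" for x
    by (simp add: symmetric[of "T x" x] dot_square_norm)
  have x0: "x \<noteq> 0" using small zero by auto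
  have "0 \<le> m"
  proof (rule ccontr)
    assume "\<not> 0 \<le> m"
    then obtain y where "T (T y) \<bullet> y < 0"
      using S.rayleigh_inf_less[OF x x0, of 0] by (auto simp: m_def)
    then show False by (simp add: form_square)
  qed
  have "m * (norm x)\<^sup>2 \<le> (norm (T x))\<^sup>2"
    using S.rayleigh_inf_le[OF x] by (simp add: form_square m_def dot_square_norm)
  also have "\<dots> < (c * norm x)\<^sup>2" using small by (intro power_strict_mono) auto
  finally have "m < c\<^sup>2" using x0 by (simp add: power_mult_distrib)
  define r where "r = sqrt m"
  have r: "\<bar>r\<bar> < c" "\<bar>- r\<bar> < c" "r * r = m"
    using \<open>0 \<le> m\<close> \<open>m < c\<^sup>2\<close> c unfolding r_def by (auto intro: real_less_lsqrt)
  have bounded_below: "bounded_below_on H (\<lambda>x. T x - w *\<^sub>R x)" if "\<bar>w\<bar> < c" for w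
    using gap[OF that] by (simp add: ap_spectrum_def)
  have "bounded_below_on H (\<lambda>x. T (T x - r *\<^sub>R x) - (- r) *\<^sub>R (T x - r *\<^sub>R x))"
    using bounded_below[OF r(1)] bounded_below[OF r(2)]
    by (rule bounded_below_on_compose) (auto intro: subspace_diff subspace_scale subspace_H T_in_H)
  moreover have "T (T x - r *\<^sub>R x) - (- r) *\<^sub>R (T x - r *\<^sub>R x) = T (T x) - m *\<^sub>R x" for x
    by (simp add: diff scaleR algebra_simps flip: r(3))
  ultimately show False
    using S.rayleigh_inf_in_ap_spectrum[OF x x0] by (simp add: S.ap_spectrum_def m_def)
qed

lemma coercive_on_range_of_gap_above_0:
  assumes nonneg: "\<And>x. x \<in> H \<Longrightarrow> 0 \<le> T x \<bullet> x"
    and \<epsilon>: "0 < \<epsilon>" and gap: "\<And>w. 0 < w \<Longrightarrow> w < \<epsilon> \<Longrightarrow> w \<notin> ap_spectrum" and x: "x \<in> H"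
  shows "\<epsilon> * (T x \<bullet> T x) \<le> T (T x) \<bullet> T x"
proof -
  define c where "c = \<epsilon> / 2"
  have c: "c > 0" "\<epsilon> = 2 * c" using \<epsilon> by (simp_all add: c_def)
  interpret S: symmetric_operator "\<lambda>x. T x - c *\<^sub>R x" H by (rule symmetric_operator_diff_scaleR)
  have "w \<notin> S.ap_spectrum" if "\<bar>w\<bar> < c" for w
    using gap[of "c + w"] that c(2) by (simp add: S.ap_spectrum_def ap_spectrum_def algebra_simps)
  then have "(c * norm x)\<^sup>2 \<le> (norm (T x - c *\<^sub>R x))\<^sup>2"
    using S.norm_ge_of_gap_around_0[OF c(1) _ x] c(1) by (intro power_mono) auto
  then have form: "2 * c * (T x \<bullet> x) \<le> T x \<bullet> T x"
    by (simp add: power_mult_distrib power2_norm_eq_inner inner_diff_left inner_diff_right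
        inner_commute) (simp add: power2_eq_square algebra_simps)
  have "(2 * c) *\<^sub>R x - T x \<in> H" using x by (intro subspace_diff subspace_scale subspace_H T_in_H)
  then have "0 \<le> T ((2 * c) *\<^sub>R x - T x) \<bullet> ((2 * c) *\<^sub>R x - T x)" by (rule nonneg)
  also have "\<dots> = 2 * c * (2 * c * (T x \<bullet> x)) - 4 * c * (T x \<bullet> T x) + T (T x) \<bullet> T x"
    by (simp add: diff scaleR inner_diff_left inner_diff_right symmetric[of "T x" x] algebra_simps)
  also have "\<dots> \<le> 2 * c * (T x \<bullet> T x) - 4 * c * (T x \<bullet> T x) + T (T x) \<bullet> T x"
    using form c by (intro add_right_mono diff_right_mono mult_left_mono) auto
  finally show ?thesis by (simp add: c(2))
qed

end

locale self_adjoint_operator = symmetric_operator T H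
  for T :: "'a::{real_inner,complete_space} \<Rightarrow> 'a" and H +
  assumes closed_H: "closed H"
begin

lemma self_adjoint_operator_diff_scaleR: "self_adjoint_operator (\<lambda>x. T x - c *\<^sub>R x) H"
  by (intro self_adjoint_operator.intro self_adjoint_operator_axioms.intro
      symmetric_operator_diff_scaleR closed_H)

lemma self_adjoint_operator_subspace:
  assumes "subspace M" "closed M" "\<And>x. x \<in> M \<Longrightarrow> T x \<in> M"
  shows "self_adjoint_operator T M"
  using assms
  by (intro self_adjoint_operator.intro self_adjoint_operator_axioms.intro symmetric_operator_subspace)

lemma norm_diff_le_of_coercive:
  assumes a: "0 < a" and coercive: "\<And>x. x \<in> H \<Longrightarrow> a * (x \<bullet> x) \<le> T x \<bullet> x"
    and K: "0 < K" "onorm T \<le> K" and x: "x \<in> H"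
  shows "(norm (x - (1/K) *\<^sub>R T x))\<^sup>2 \<le> (1 - a / K) * (norm x)\<^sup>2"
proof -
  have nonneg: "0 \<le> T x \<bullet> x" if "x \<in> H" for x
    using coercive[OF that] a by (meson inner_ge_zero less_imp_le mult_nonneg_nonneg order_trans)
  have "(norm (T x))\<^sup>2 \<le> onorm T * (T x \<bullet> x)" by (rule norm_sq_le_form[OF nonneg x])
  also have "\<dots> \<le> K * (T x \<bullet> x)" using K nonneg[OF x] by (intro mult_right_mono)
  finally have T_sq: "(norm (T x))\<^sup>2 \<le> K * (T x \<bullet> x)" .
  have "(norm (x - (1/K) *\<^sub>R T x))\<^sup>2 = x \<bullet> x - 2/K * (T x \<bullet> x) + 1/K\<^sup>2 * (norm (T x))\<^sup>2"
    by (simp add: power2_norm_eq_inner inner_diff_left inner_diff_right inner_commute)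
      (simp add: power2_eq_square field_simps)
  also have "\<dots> \<le> x \<bullet> x - 2/K * (T x \<bullet> x) + 1/K\<^sup>2 * (K * (T x \<bullet> x))"
    using T_sq by (intro add_left_mono mult_left_mono) auto
  also have "\<dots> = x \<bullet> x - 1/K * (T x \<bullet> x)" using K by (simp add: power2_eq_square field_simps)
  also have "\<dots> \<le> x \<bullet> x - 1/K * (a * (x \<bullet> x))"
    using coercive[OF x] K by (intro diff_left_mono mult_left_mono) auto
  finally show ?thesis by (simp add: power2_norm_eq_inner algebra_simps)
qed

text \<open>Richardson iteration: \<open>x \<mapsto> x + (y - T x) / K\<close> is a contraction with fixed point \<open>T x = y\<close>.\<close>

lemma surj_of_coercive:
  assumes a: "0 < a" and coercive: "\<And>x. x \<in> H \<Longrightarrow> a * (x \<bullet> x) \<le> T x \<bullet> x" and y: "y \<in> H"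
  obtains x where "x \<in> H" "T x = y"
proof -
  define K where "K = max (onorm T) a"
  have K: "0 < K" "onorm T \<le> K" "a \<le> K" using a by (auto simp: K_def)
  define q where "q = sqrt (1 - a / K)"
  have q: "0 \<le> q" "q < 1" using K a by (auto simp: q_def field_simps)
  have contraction: "norm (x - (1/K) *\<^sub>R T x) \<le> q * norm x" if "x \<in> H" for x
  proof (rule power2_le_imp_le)
    show "(norm (x - (1/K) *\<^sub>R T x))\<^sup>2 \<le> (q * norm x)\<^sup>2"
      using norm_diff_le_of_coercive[OF a coercive K(1,2) that] K
      by (simp add: q_def power_mult_distrib field_simps)
  qed (use q in simp)
  have "\<exists>!x. x \<in> H \<and> x + (1/K) *\<^sub>R (y - T x) = x"
  proof (rule Banach_fix[of H q])
    show "complete H" using closed_H by (simp add: complete_eq_closed)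
    show "(\<lambda>x. x + (1/K) *\<^sub>R (y - T x)) ` H \<subseteq> H"
      using y by (auto intro!: subspace_add subspace_diff subspace_scale subspace_H T_in_H)
    show "dist (x + (1/K) *\<^sub>R (y - T x)) (z + (1/K) *\<^sub>R (y - T z)) \<le> q * dist x z"
      if "x \<in> H" "z \<in> H" for x z
      using contraction[of "x - z"] that subspace_H
      by (simp add: dist_norm subspace_diff diff algebra_simps)
  qed (use q y in auto)
  then show ?thesis using that K by auto
qed

lemma closure_range_subset: "closure (T ` H) \<subseteq> H"
  using T_in_H closed_H by (intro closure_minimal) auto

lemma coercive_on_closure_range_of_gap_above_0:
  assumes "\<And>x. x \<in> H \<Longrightarrow> 0 \<le> T x \<bullet> x" "0 < \<epsilon>" "\<And>w. 0 < w \<Longrightarrow> w < \<epsilon> \<Longrightarrow> w \<notin> ap_spectrum"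
    and x: "x \<in> closure (T ` H)"
  shows "\<epsilon> * (x \<bullet> x) \<le> T x \<bullet> x"
proof -
  have "0 \<le> T x \<bullet> x - \<epsilon> * (x \<bullet> x)"
  proof (rule continuous_ge_on_closure[OF _ x])
    show "continuous_on (closure (T ` H)) (\<lambda>x. T x \<bullet> x - \<epsilon> * (x \<bullet> x))"
      by (intro continuous_intros linear_continuous_on bounded_linear_axioms)
    show "0 \<le> T y \<bullet> y - \<epsilon> * (y \<bullet> y)" if "y \<in> T ` H" for y
      using coercive_on_range_of_gap_above_0[OF assms(1-3)] that by auto
  qed
  then show ?thesis by simp
qed

text \<open>The gap makes \<open>T\<close> coercive on the closure of its range, so an almost null vector \<open>x\<close> can be
  corrected by the small solution \<open>r\<close> of \<open>T r = T x\<close> in that closure.\<close>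

lemma kernel_nontrivial_of_gap_above_0:
  assumes nonneg: "\<And>x. x \<in> H \<Longrightarrow> 0 \<le> T x \<bullet> x"
    and \<epsilon>: "0 < \<epsilon>" and gap: "\<And>w. 0 < w \<Longrightarrow> w < \<epsilon> \<Longrightarrow> w \<notin> ap_spectrum"
    and 0: "0 \<in> ap_spectrum"
  obtains x where "x \<in> H" "x \<noteq> 0" "T x = 0"
proof -
  let ?R = "closure (T ` H)"
  have coercive: "\<epsilon> * (x \<bullet> x) \<le> T x \<bullet> x" if "x \<in> ?R" for x
    using nonneg \<epsilon> gap that by (rule coercive_on_closure_range_of_gap_above_0)
  have "T ` ?R \<subseteq> closure (T ` (T ` H))"
    by (rule image_closure_subset[OF linear_continuous_on[OF bounded_linear_axioms]])
      (auto intro: closure_subset[THEN subsetD])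
  also have "\<dots> \<subseteq> ?R" using T_in_H by (intro closure_mono) auto
  finally interpret R: self_adjoint_operator T ?R
    using linear_subspace_image[OF linear_axioms subspace_H]
    by (intro self_adjoint_operator_subspace subspace_closure) auto
  obtain x where x: "x \<in> H" "norm x = 1" "norm (T x - 0 *\<^sub>R x) < \<epsilon>" by (rule ap_spectrumE[OF 0 \<epsilon>])
  have "T x \<in> ?R" using x(1) by (auto intro: closure_subset[THEN subsetD])
  then obtain r where r: "r \<in> ?R" "T r = T x" using R.surj_of_coercive[OF \<epsilon> coercive] by blast
  have "\<epsilon> * (norm r)\<^sup>2 \<le> norm (T r) * norm r"
    using coercive[OF r(1)] norm_cauchy_schwarz[of "T r" r] by (simp add: dot_square_norm)
  then have "norm r \<noteq> 1" using x(3) r(2) by auto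
  then have "x - r \<noteq> 0" using x(2) by auto
  moreover have "T (x - r) = 0" using r(2) by (simp add: diff)
  moreover have "x - r \<in> H" using closure_range_subset r x subspace_H by (auto intro: subspace_diff)
  ultimately show ?thesis using that by blast
qed

lemma isolated_rayleigh_inf_eigenvalue:
  assumes "x0 \<in> H" "x0 \<noteq> 0" and isolated: "rayleigh_inf isolated_in ap_spectrum"
  obtains x where "x \<in> H" "x \<noteq> 0" "T x = rayleigh_inf *\<^sub>R x"
proof -
  let ?m = rayleigh_inf
  interpret P: self_adjoint_operator "\<lambda>x. T x - ?m *\<^sub>R x" H
    by (rule self_adjoint_operator_diff_scaleR)
  have P_spectrum: "w \<in> P.ap_spectrum \<longleftrightarrow> ?m + w \<in> ap_spectrum" for w
    by (simp add: P.ap_spectrum_def ap_spectrum_def algebra_simps)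
  obtain \<epsilon> where \<epsilon>: "0 < \<epsilon>" "\<And>w. w \<in> ap_spectrum \<Longrightarrow> dist ?m w < \<epsilon> \<Longrightarrow> w = ?m"
    using isolated unfolding isolated_in_dist_Ex_iff by blast
  obtain x where "x \<in> H" "x \<noteq> 0" "T x - ?m *\<^sub>R x = 0"
  proof (rule P.kernel_nontrivial_of_gap_above_0[OF _ \<epsilon>(1)])
    show "0 \<le> (T x - ?m *\<^sub>R x) \<bullet> x" if "x \<in> H" for x
      using rayleigh_inf_le[OF that] by (simp add: inner_diff_left)
    show "w \<notin> P.ap_spectrum" if "0 < w" "w < \<epsilon>" for w
      using \<epsilon>(2)[of "?m + w"] that by (auto simp: P_spectrum dist_real_def)
    show "0 \<in> P.ap_spectrum"
      using rayleigh_inf_in_ap_spectrum[OF assms(1,2)] by (simp add: P_spectrum)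
  qed
  then show ?thesis using that by simp
qed

subsection \<open>Discrete and essential spectrum\<close>

definition eigen_dim_ge :: "(real \<Rightarrow> bool) \<Rightarrow> nat \<Rightarrow> bool" where
  "eigen_dim_ge R n \<longleftrightarrow> (\<exists>B. finite B \<and> independent B \<and> card B = n \<and> B \<subseteq> H \<and>
     (\<forall>b\<in>B. \<exists>l. T b = l *\<^sub>R b \<and> R l))"

lemma eigen_dim_geI:
  assumes "finite B" "independent B" "B \<subseteq> H" "\<And>b. b \<in> B \<Longrightarrow> \<exists>l. T b = l *\<^sub>R b \<and> R l"
  shows "eigen_dim_ge R (card B)"
  unfolding eigen_dim_ge_def using assms by blast

lemma eigen_dim_geE:
  assumes "eigen_dim_ge R n"
  obtains B where "finite B" "independent B" "card B = n" "B \<subseteq> H"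
    "\<forall>b\<in>B. \<exists>l. T b = l *\<^sub>R b \<and> R l"
  using assms unfolding eigen_dim_ge_def by blast

lemma eigen_dim_ge_0: "eigen_dim_ge R 0"
  using eigen_dim_geI[of "{}" R] by (simp add: independent_empty)

lemma eigen_dim_ge_antimono:
  assumes "eigen_dim_ge R m" "n \<le> m"
  shows "eigen_dim_ge R n"
proof -
  obtain B where B: "finite B" "independent B" "card B = m" "B \<subseteq> H"
    "\<forall>b\<in>B. \<exists>l. T b = l *\<^sub>R b \<and> R l"
    using assms(1) by (rule eigen_dim_geE)
  obtain C where C: "C \<subseteq> B" "card C = n"
    using obtain_subset_with_card_n[of n B] assms(2) B(3) by blast
  have "eigen_dim_ge R (card C)"
    using C(1) B(4,5)
    by (intro eigen_dim_geI finite_subset[OF C(1) B(1)] independent_mono[OF B(2) C(1)]) auto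
  then show ?thesis by (simp only: C(2))
qed

lemma eigen_dim_ge_mono:
  assumes "eigen_dim_ge R n" "\<And>l. R l \<Longrightarrow> R' l"
  shows "eigen_dim_ge R' n"
proof -
  obtain B where B: "finite B" "independent B" "card B = n" "B \<subseteq> H"
    "\<forall>b\<in>B. \<exists>l. T b = l *\<^sub>R b \<and> R l"
    using assms(1) by (rule eigen_dim_geE)
  then have "eigen_dim_ge R' (card B)" using assms(2) by (intro eigen_dim_geI) blast+
  with B(3) show ?thesis by simp
qed

lemma eigenvalue_of_eigen_dim_ge:
  assumes "eigen_dim_ge R n" "1 \<le> n"
  obtains l where "l \<in> ap_spectrum" "R l"
proof -
  obtain B where B: "finite B" "independent B" "card B = n" "B \<subseteq> H"
    "\<forall>b\<in>B. \<exists>l. T b = l *\<^sub>R b \<and> R l"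
    using assms(1) by (rule eigen_dim_geE)
  then obtain b where b: "b \<in> B" using assms(2) by fastforce
  moreover have "b \<noteq> 0" using b B(2) dependent_zero by blast
  ultimately show ?thesis using that B(4,5) eigenvalue_in_ap_spectrum by blast
qed

lemma orthogonal_eigenvectors:
  assumes "T x = a *\<^sub>R x" "T y = b *\<^sub>R y" "a \<noteq> b"
  shows "orthogonal x y"
proof -
  have "a * (x \<bullet> y) = b * (x \<bullet> y)" using symmetric[of x y] assms(1,2) by simp
  then show ?thesis using assms(3) by (simp add: orthogonal_def)
qed

definition discrete_spectrum :: "real set" where
  "discrete_spectrum = {z. z isolated_in ap_spectrum \<and> eigen_dim_ge (\<lambda>l. l = z) 1 \<and>
     (\<exists>n. \<not> eigen_dim_ge (\<lambda>l. l = z) n)}"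

definition essential_spectrum :: "real set" where
  "essential_spectrum = ap_spectrum - discrete_spectrum"

lemma approx_eigenvectors_convergent_subsequence:
  assumes F: "finite F" "F \<subseteq> H" and bounded_below: "bounded_below_on (H \<inter> F\<^sup>\<bottom>) (\<lambda>x. T x - z *\<^sub>R x)"
    and x: "\<And>n. x n \<in> H" "\<And>n. norm (x n) = 1" and lim: "(\<lambda>n. T (x n) - z *\<^sub>R x n) \<longlonglongrightarrow> 0"
  obtains r l where "strict_mono r" "(\<lambda>n. x (r n)) \<longlonglongrightarrow> l" "l \<in> H" "norm l = 1" "T l = z *\<^sub>R l"
proof -
  let ?S = "\<lambda>x. T x - z *\<^sub>R x"
  interpret S: symmetric_operator ?S H by (rule symmetric_operator_diff_scaleR)
  obtain C where C: "finite C" "span C = span F" "pairwise orthogonal C"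
    using basis_orthogonal[OF F(1)] by blast
  let ?p = "orth_proj C"
  have "bounded (range x)" using x(2) by (auto simp: bounded_iff)
  then obtain r where r: "strict_mono r" and "convergent (\<lambda>n. ?p (x (r n)))"
    using C(1) by (rule bounded_orth_proj_convergent_subsequence)
  then obtain p where p: "(\<lambda>n. ?p (x (r n))) \<longlonglongrightarrow> p" by (auto simp: convergent_def)
  have Sx: "(\<lambda>n. ?S (x (r n))) \<longlonglongrightarrow> 0" using LIMSEQ_subseq_LIMSEQ[OF lim r] by (simp add: o_def)
  define q where "q n = x (r n) - ?p (x (r n))" for n
  have "?p y \<in> H" for y
    using orth_proj_in_span[of C y] C(2) F(2) span_minimal[OF _ subspace_H] by blast
  then have q_mem: "q n \<in> H \<inter> F\<^sup>\<bottom>" for n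
    using diff_orth_proj_in_orthogonal_comp[OF C(1,3)] C(2) orthogonal_comp_span x(1) subspace_H
    unfolding q_def by (metis IntI subspace_diff)
  have "Cauchy q"
  proof (rule Cauchy_if_bounded_below_on[OF bounded_below S.linear_axioms _ q_mem])
    show "subspace (H \<inter> F\<^sup>\<bottom>)" by (intro subspace_inter subspace_H subspace_orthogonal_comp)
    have "(\<lambda>n. ?S (q n)) \<longlonglongrightarrow> 0 - ?S p"
      unfolding q_def S.diff by (intro tendsto_diff Sx S.tendsto p)
    then show "Cauchy (\<lambda>n. ?S (q n))" by (rule LIMSEQ_imp_Cauchy)
  qed
  then obtain q' where "q \<longlonglongrightarrow> q'" by (auto simp: Cauchy_convergent_iff convergent_def)
  then have l: "(\<lambda>n. x (r n)) \<longlonglongrightarrow> q' + p" using tendsto_add[OF _ p, of q q'] by (simp add: q_def)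
  show ?thesis
  proof (rule that[OF r l])
    show "q' + p \<in> H" using closed_sequentially[OF closed_H _ l] x(1) by simp
    show "norm (q' + p) = 1" using tendsto_norm[OF l] x(2) by (simp add: LIMSEQ_const_iff)
    have "?S (q' + p) = 0" by (rule LIMSEQ_unique[OF S.tendsto[OF l] Sx])
    then show "T (q' + p) = z *\<^sub>R (q' + p)" by (simp only: right_minus_eq)
  qed
qed

lemma eigenvalue_if_bounded_below_on_orthogonal_comp:
  assumes z: "z \<in> ap_spectrum" and F: "finite F" "F \<subseteq> H"
    and bounded_below: "bounded_below_on (H \<inter> F\<^sup>\<bottom>) (\<lambda>x. T x - z *\<^sub>R x)"
  shows "eigen_dim_ge (\<lambda>l. l = z) 1"
proof -
  obtain x where x: "\<And>n. x n \<in> H" "\<And>n. norm (x n) = 1"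
    and small: "\<And>n. norm (T (x n) - z *\<^sub>R x n) < inverse (real (Suc n))"
    by (rule approx_eigenvectors_of_ap_spectrum[of "\<lambda>_. z" "\<lambda>n. inverse (real (Suc n))"])
      (use z in auto)
  have "(\<lambda>n. T (x n) - z *\<^sub>R x n) \<longlonglongrightarrow> 0"
    by (rule Lim_null_comparison[OF _ LIMSEQ_inverse_real_of_nat])
      (auto intro!: always_eventually less_imp_le small simp del: of_nat_Suc)
  then obtain l where l: "l \<in> H" "norm l = 1" "T l = z *\<^sub>R l"
    by (rule approx_eigenvectors_convergent_subsequence[OF F bounded_below x])
  then have "l \<noteq> 0" by auto
  with l show ?thesis using eigen_dim_geI[of "{l}" "\<lambda>l. l = z"] by (simp add: independent_insert)
qed

lemma finite_multiplicity_if_bounded_below_on_orthogonal_comp: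
  assumes F: "finite F" and bounded_below: "bounded_below_on (H \<inter> F\<^sup>\<bottom>) (\<lambda>x. T x - z *\<^sub>R x)"
  shows "\<not> eigen_dim_ge (\<lambda>l. l = z) (Suc (card F))"
proof
  assume "eigen_dim_ge (\<lambda>l. l = z) (Suc (card F))"
  then obtain B where B: "finite B" "independent B" "card B = Suc (card F)" "B \<subseteq> H"
    "\<And>b. b \<in> B \<Longrightarrow> T b = z *\<^sub>R b"
    unfolding eigen_dim_ge_def by auto
  obtain f where f: "f \<in> span B" "f \<noteq> 0" "f \<in> F\<^sup>\<bottom>"
    by (rule exists_nonzero_in_span_orthogonal[OF B(2,1) F]) (use B(3) in simp)
  have "f \<in> H" using f(1) B(4) span_minimal[OF _ subspace_H] by blast
  obtain \<delta> where "0 < \<delta>" "\<delta> * norm f \<le> norm (T f - z *\<^sub>R f)"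
    using bounded_below \<open>f \<in> H\<close> f(3) unfolding bounded_below_on_def by blast
  moreover have "T f - z *\<^sub>R f = 0"
    by (rule linear_eq_0_on_span[OF linear_diff_scaleR _ f(1)]) (simp add: B(5))
  ultimately show False using f(2) by (simp add: mult_le_0_iff)
qed

lemma norm_diff_scaleR_le: "norm (T x - z *\<^sub>R x) \<le> norm (T x - w *\<^sub>R x) + \<bar>w - z\<bar> * norm x"
proof -
  have "norm (T x - z *\<^sub>R x) = norm ((T x - w *\<^sub>R x) + (w - z) *\<^sub>R x)"
    by (simp add: scaleR_left_diff_distrib)
  also have "\<dots> \<le> norm (T x - w *\<^sub>R x) + norm ((w - z) *\<^sub>R x)" by (rule norm_triangle_ineq)
  finally show ?thesis by simp
qed

text \<open>An approximate eigenvector for \<open>w\<close> is almost orthogonal to the eigenvectors for \<open>z \<noteq> w\<close>.\<close>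

lemma abs_inner_eigenvector_le:
  assumes "T l = z *\<^sub>R l"
  shows "\<bar>w - z\<bar> * \<bar>x \<bullet> l\<bar> \<le> norm (T x - w *\<^sub>R x) * norm l"
proof -
  have "(T x - w *\<^sub>R x) \<bullet> l = (z - w) * (x \<bullet> l)"
    by (simp add: inner_diff_left symmetric assms algebra_simps)
  then have "\<bar>w - z\<bar> * \<bar>x \<bullet> l\<bar> = \<bar>(T x - w *\<^sub>R x) \<bullet> l\<bar>" by (simp add: abs_mult abs_minus_commute)
  also have "\<dots> \<le> norm (T x - w *\<^sub>R x) * norm l" by (rule Cauchy_Schwarz_ineq2)
  finally show ?thesis .
qed

lemma isolated_if_bounded_below_on_orthogonal_comp:
  assumes z: "z \<in> ap_spectrum" and F: "finite F" "F \<subseteq> H"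
    and bounded_below: "bounded_below_on (H \<inter> F\<^sup>\<bottom>) (\<lambda>x. T x - z *\<^sub>R x)"
  shows "z isolated_in ap_spectrum"
proof (rule ccontr)
  assume "\<not> z isolated_in ap_spectrum"
  then have "z islimpt ap_spectrum" using z by (simp add: isolated_in_islimpt_iff)
  then obtain w where w: "\<And>n. w n \<in> ap_spectrum - {z}" "w \<longlonglongrightarrow> z"
    unfolding islimpt_sequential by blast
  define d where "d n = \<bar>w n - z\<bar>" for n
  have d: "0 < d n" for n using w(1)[of n] by (auto simp: d_def)
  have d_lim: "d \<longlonglongrightarrow> 0" unfolding d_def using w(2) by (simp add: LIM_zero tendsto_rabs_zero)
  obtain x where x: "\<And>n. x n \<in> H" "\<And>n. norm (x n) = 1"
    and small: "\<And>n. norm (T (x n) - w n *\<^sub>R x n) < (d n)\<^sup>2"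
    by (rule approx_eigenvectors_of_ap_spectrum[of w "\<lambda>n. (d n)\<^sup>2"])
      (use w(1) d zero_less_power in blast)+
  have "(\<lambda>n. T (x n) - z *\<^sub>R x n) \<longlonglongrightarrow> 0"
  proof (rule Lim_null_comparison)
    have "norm (T (x n) - z *\<^sub>R x n) \<le> (d n)\<^sup>2 + d n" for n
      using norm_diff_scaleR_le[of "x n" z "w n"] small[of n] x(2)[of n] by (simp add: d_def)
    then show "\<forall>\<^sub>F n in sequentially. norm (T (x n) - z *\<^sub>R x n) \<le> (d n)\<^sup>2 + d n" by simp
    show "(\<lambda>n. (d n)\<^sup>2 + d n) \<longlonglongrightarrow> 0" using tendsto_add[OF tendsto_power[OF d_lim, of 2] d_lim] by simp
  qed
  then obtain r l where r: "strict_mono r" "(\<lambda>n. x (r n)) \<longlonglongrightarrow> l" and l: "norm l = 1" "T l = z *\<^sub>R l"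
    by (rule approx_eigenvectors_convergent_subsequence[OF F bounded_below x])
  have inner_le: "\<bar>x n \<bullet> l\<bar> \<le> d n" for n
  proof -
    have "d n * \<bar>x n \<bullet> l\<bar> \<le> (d n)\<^sup>2"
      using abs_inner_eigenvector_le[OF l(2), of "w n" "x n"] small[of n] l(1) by (simp add: d_def)
    then show ?thesis using d[of n] by (simp add: power2_eq_square)
  qed
  have "(\<lambda>n. x (r n) \<bullet> l) \<longlonglongrightarrow> 0"
    by (rule Lim_null_comparison[OF _ LIMSEQ_subseq_LIMSEQ[OF d_lim r(1)]]) (simp add: inner_le)
  moreover have "(\<lambda>n. x (r n) \<bullet> l) \<longlonglongrightarrow> l \<bullet> l" by (intro tendsto_inner r(2) tendsto_const)
  ultimately have "l \<bullet> l = 0" using LIMSEQ_unique by blast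
  with l(1) show False by auto
qed

lemma not_bounded_below_on_orthogonal_comp_if_essential:
  assumes "z \<in> essential_spectrum" "finite F" "F \<subseteq> H"
  shows "\<not> bounded_below_on (H \<inter> F\<^sup>\<bottom>) (\<lambda>x. T x - z *\<^sub>R x)"
  using assms eigenvalue_if_bounded_below_on_orthogonal_comp[of z F]
    finite_multiplicity_if_bounded_below_on_orthogonal_comp[of F z]
    isolated_if_bounded_below_on_orthogonal_comp[of z F]
  unfolding essential_spectrum_def discrete_spectrum_def by blast

subsection \<open>The min-max principle\<close>

definition negative_index_ge :: "real \<Rightarrow> nat \<Rightarrow> bool" where
  "negative_index_ge s n \<longleftrightarrow> (\<exists>B. finite B \<and> independent B \<and> card B = n \<and> B \<subseteq> H \<and>
     (\<forall>f\<in>span B. f \<noteq> 0 \<longrightarrow> T f \<bullet> f < s * (f \<bullet> f)))"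

lemma negative_index_geI:
  assumes "finite B" "independent B" "B \<subseteq> H"
    "\<And>f. f \<in> span B \<Longrightarrow> f \<noteq> 0 \<Longrightarrow> T f \<bullet> f < s * (f \<bullet> f)"
  shows "negative_index_ge s (card B)"
  unfolding negative_index_ge_def using assms by blast

lemma negative_index_geE:
  assumes "negative_index_ge s n"
  obtains B where "finite B" "independent B" "card B = n" "B \<subseteq> H" "span B \<subseteq> H"
    "\<forall>f\<in>span B. f \<noteq> 0 \<longrightarrow> T f \<bullet> f < s * (f \<bullet> f)"
proof -
  obtain B where B: "finite B" "independent B" "card B = n" "B \<subseteq> H"
    "\<forall>f\<in>span B. f \<noteq> 0 \<longrightarrow> T f \<bullet> f < s * (f \<bullet> f)"
    using assms unfolding negative_index_ge_def by auto
  have "span B \<subseteq> H" using B(4) subspace_H by (rule span_minimal)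
  then show ?thesis by (rule that[OF B(1-4) _ B(5)])
qed

lemma negative_index_ge_mono:
  assumes "negative_index_ge s n" "s \<le> t"
  shows "negative_index_ge t n"
proof -
  obtain B where B: "finite B" "independent B" "card B = n" "B \<subseteq> H" "span B \<subseteq> H"
    "\<forall>f\<in>span B. f \<noteq> 0 \<longrightarrow> T f \<bullet> f < s * (f \<bullet> f)"
    using assms(1) by (rule negative_index_geE)
  have "s * (f \<bullet> f) \<le> t * (f \<bullet> f)" for f :: 'a using assms(2) by (simp add: mult_right_mono)
  then have "negative_index_ge t (card B)"
    using B by (intro negative_index_geI) (auto intro: less_le_trans)
  with B(3) show ?thesis by simp
qed

lemma neg_onorm_le_if_negative_index_ge:
  assumes "negative_index_ge s n" "1 \<le> n"
  shows "- onorm T \<le> s"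
proof -
  obtain B where B: "finite B" "independent B" "card B = n" "B \<subseteq> H" "span B \<subseteq> H"
    "\<forall>f\<in>span B. f \<noteq> 0 \<longrightarrow> T f \<bullet> f < s * (f \<bullet> f)"
    using assms(1) by (rule negative_index_geE)
  then obtain b where b: "b \<in> B" using assms(2) by fastforce
  then have b0: "b \<noteq> 0" using B(2) dependent_zero by blast
  then have "- onorm T * (b \<bullet> b) < s * (b \<bullet> b)"
    using B(6) span_base[OF b] abs_form_le[of b] by force
  then have "- onorm T < s" by (rule mult_right_less_imp_less) simp
  then show ?thesis by simp
qed

lemma form_less_if_orthogonal:
  assumes B: "finite B" "pairwise orthogonal B" "pairwise (\<lambda>b c. orthogonal (T b) c) B"
    and less: "\<And>b. b \<in> B \<Longrightarrow> T b \<bullet> b < s * (b \<bullet> b)" and f: "f \<in> span B" "f \<noteq> 0"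
  shows "T f \<bullet> f < s * (f \<bullet> f)"
proof -
  obtain u where u: "f = (\<Sum>b\<in>B. u b *\<^sub>R b)" using f(1) span_finite[OF B(1)] by auto
  have diagonal: "(\<Sum>b\<in>B. \<Sum>c\<in>B. u b * (u c * (g c \<bullet> b))) = (\<Sum>b\<in>B. (u b)\<^sup>2 * (g b \<bullet> b))"
    if "pairwise (\<lambda>b c. orthogonal (g b) c) B" for g :: "'a \<Rightarrow> 'a"
  proof (rule sum.cong)
    fix b assume b: "b \<in> B"
    have "(\<Sum>c\<in>B. u b * (u c * (g c \<bullet> b))) = (\<Sum>c\<in>{b}. u b * (u c * (g c \<bullet> b)))"
      using that b B(1) by (intro sum.mono_neutral_right) (auto simp: pairwise_def orthogonal_def)
    then show "(\<Sum>c\<in>B. u b * (u c * (g c \<bullet> b))) = (u b)\<^sup>2 * (g b \<bullet> b)"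
      by (simp add: power2_eq_square)
  qed simp
  have "T f \<bullet> f = (\<Sum>b\<in>B. \<Sum>c\<in>B. u b * (u c * (T c \<bullet> b)))"
    by (simp add: u sum scaleR inner_sum_left inner_sum_right sum_distrib_left)
  also have "\<dots> = (\<Sum>b\<in>B. (u b)\<^sup>2 * (T b \<bullet> b))" by (rule diagonal[OF B(3)])
  also have "\<dots> < (\<Sum>b\<in>B. (u b)\<^sup>2 * (s * (b \<bullet> b)))"
  proof (rule sum_strict_mono_ex1)
    show "\<forall>b\<in>B. (u b)\<^sup>2 * (T b \<bullet> b) \<le> (u b)\<^sup>2 * (s * (b \<bullet> b))"
      by (intro ballI mult_left_mono less_imp_le[OF less]) auto
    have "\<exists>b\<in>B. u b \<noteq> 0"
    proof (rule ccontr)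
      assume "\<not> (\<exists>b\<in>B. u b \<noteq> 0)"
      then show False using f(2) by (simp add: u)
    qed
    then obtain b where "b \<in> B" "u b \<noteq> 0" by blast
    then show "\<exists>b\<in>B. (u b)\<^sup>2 * (T b \<bullet> b) < (u b)\<^sup>2 * (s * (b \<bullet> b))"
      using less by (intro bexI[of _ b] mult_strict_left_mono) auto
  qed (rule B(1))
  also have "\<dots> = s * (\<Sum>b\<in>B. (u b)\<^sup>2 * (b \<bullet> b))" by (simp add: sum_distrib_left ac_simps)
  also have "(\<Sum>b\<in>B. (u b)\<^sup>2 * (b \<bullet> b)) = (\<Sum>b\<in>B. \<Sum>c\<in>B. u b * (u c * (c \<bullet> b)))"
    using diagonal[of "\<lambda>b. b"] B(2) by simp
  also have "\<dots> = f \<bullet> f"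
    by (simp add: u inner_sum_left inner_sum_right sum_distrib_left)
  finally show ?thesis .
qed

lemma negative_index_ge_if_orthogonal:
  assumes "finite B" "B \<subseteq> H" "0 \<notin> B" "pairwise orthogonal B" "pairwise (\<lambda>b c. orthogonal (T b) c) B"
    and "\<And>b. b \<in> B \<Longrightarrow> T b \<bullet> b < s * (b \<bullet> b)"
  shows "negative_index_ge s (card B)"
  by (rule negative_index_geI[OF assms(1) pairwise_orthogonal_independent[OF assms(4,3)] assms(2)],
      rule form_less_if_orthogonal[OF assms(1,4,5,6)])

lemma negative_index_ge_above_onorm:
  assumes "infinite_dimensional H" "onorm T < s"
  shows "negative_index_ge s n"
proof -
  obtain B where B: "finite B" "independent B" "card B = n" "B \<subseteq> H"
    using assms(1) by (rule infinite_dimensionalE)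
  have "T f \<bullet> f < s * (f \<bullet> f)" if "f \<noteq> 0" for f
  proof -
    have "onorm T * (f \<bullet> f) < s * (f \<bullet> f)" using assms(2) that by simp
    then show ?thesis using abs_form_le[of f] by linarith
  qed
  then have "negative_index_ge s (card B)" by (intro negative_index_geI B)
  with B(3) show ?thesis by simp
qed

lemma form_less_if_span_eigenvectors:
  assumes B: "finite B" "\<And>b. b \<in> B \<Longrightarrow> \<exists>l. T b = l *\<^sub>R b \<and> l < s" and f: "f \<in> span B" "f \<noteq> 0"
  shows "T f \<bullet> f < s * (f \<bullet> f)"
proof -
  obtain l where l: "\<And>b. b \<in> B \<Longrightarrow> T b = l b *\<^sub>R b" "\<And>b. b \<in> B \<Longrightarrow> l b < s"
    using B(2) by metis
  obtain u where u: "f = (\<Sum>b\<in>B. u b *\<^sub>R b)" using f(1) span_finite[OF B(1)] by auto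
  define v where "v a = (\<Sum>b\<in>{b \<in> B. l b = a}. u b *\<^sub>R b)" for a
  have Tv: "T (v a) = a *\<^sub>R v a" for a
    unfolding v_def sum scaleR_sum_right by (intro sum.cong) (auto simp: scaleR l)
  have "v a \<bullet> v a > 0" if "v a \<noteq> 0" for a using that by simp
  then have less: "T (v a) \<bullet> v a < s * (v a \<bullet> v a)" if "a \<in> l ` B" "v a \<noteq> 0" for a
    using that l(2) by (auto simp: Tv)
  let ?V = "v ` l ` B - {0}"
  have distinct: "a \<noteq> b" if "v a \<noteq> v b" for a b using that by auto
  have orth: "orthogonal (v a) (v b)" if "a \<noteq> b" for a b
    by (rule orthogonal_eigenvectors[OF Tv Tv that])
  have "v a \<in> span ?V" if "a \<in> l ` B" for a
    using that by (cases "v a = 0") (simp_all add: span_zero span_base)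
  moreover have "f = (\<Sum>a\<in>l ` B. v a)" unfolding u v_def by (rule sum.image_gen) (rule B(1))
  ultimately have f_V: "f \<in> span ?V" by (simp add: span_sum)
  have pairwise: "pairwise orthogonal ?V" "pairwise (\<lambda>b c. orthogonal (T b) c) ?V"
    using orth distinct unfolding pairwise_def by (auto simp: Tv orthogonal_clauses)
  show ?thesis
    by (rule form_less_if_orthogonal[OF _ pairwise _ f_V f(2)]) (use B(1) less in auto)
qed

lemma negative_index_ge_if_eigen_dim_ge:
  assumes "eigen_dim_ge (\<lambda>l. l < s) n"
  shows "negative_index_ge s n"
proof -
  obtain B where B: "finite B" "independent B" "card B = n" "B \<subseteq> H"
    "\<forall>b\<in>B. \<exists>l. T b = l *\<^sub>R b \<and> l < s"
    using assms by (rule eigen_dim_geE)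
  have "negative_index_ge s (card B)"
    using B(1,5)
    by (intro negative_index_geI[OF B(1,2,4)] form_less_if_span_eigenvectors[of B]) auto
  with B(3) show ?thesis by simp
qed

text \<open>Almost null vectors of \<open>T - z\<close> exist in the orthogonal complement of any finite set, so they
  can be chosen orthogonal to all previous ones and to their images.\<close>

lemma orthogonal_family_if_essential:
  assumes z: "z \<in> essential_spectrum" and s: "z < s"
  obtains B where "finite B" "card B = n" "B \<subseteq> H" "pairwise orthogonal B"
    "pairwise (\<lambda>b c. orthogonal (T b) c) B" "\<And>b. b \<in> B \<Longrightarrow> b \<noteq> 0 \<and> T b \<bullet> b < s * (b \<bullet> b)"
proof -
  have "\<exists>B. finite B \<and> card B = n \<and> B \<subseteq> H \<and> pairwise orthogonal B \<and>
      pairwise (\<lambda>b c. orthogonal (T b) c) B \<and> (\<forall>b\<in>B. b \<noteq> 0 \<and> T b \<bullet> b < s * (b \<bullet> b))"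
  proof (induction n)
    case 0
    show ?case by (intro exI[of _ "{}"]) simp
  next
    case (Suc n)
    then obtain B where B: "finite B" "card B = n" "B \<subseteq> H" "pairwise orthogonal B"
      "pairwise (\<lambda>b c. orthogonal (T b) c) B" "\<And>b. b \<in> B \<Longrightarrow> b \<noteq> 0 \<and> T b \<bullet> b < s * (b \<bullet> b)"
      by blast
    let ?F = "B \<union> T ` B"
    have "finite ?F" "?F \<subseteq> H" using B(1,3) T_in_H by auto
    then have "\<not> bounded_below_on (H \<inter> ?F\<^sup>\<bottom>) (\<lambda>x. T x - z *\<^sub>R x)"
      by (rule not_bounded_below_on_orthogonal_comp_if_essential[OF z])
    moreover have "subspace (H \<inter> ?F\<^sup>\<bottom>)"
      by (intro subspace_inter subspace_H subspace_orthogonal_comp)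
    ultimately obtain x where x: "x \<in> H \<inter> ?F\<^sup>\<bottom>" "norm x = 1" "norm (T x - z *\<^sub>R x) < s - z"
      using s by (elim not_bounded_below_onE[OF _ linear_diff_scaleR, where \<delta> = "s - z"]) auto
    have x_B: "orthogonal x b" "orthogonal (T x) b" "orthogonal (T b) x" if "b \<in> B" for b
      using x(1) that symmetric[of x b]
      by (auto simp: orthogonal_comp_def orthogonal_def inner_commute)
    have "(T x - z *\<^sub>R x) \<bullet> x < s - z"
      using norm_cauchy_schwarz[of "T x - z *\<^sub>R x" x] x(2,3) by simp
    then have x_less: "T x \<bullet> x < s * (x \<bullet> x)"
      using x(2) by (simp add: inner_diff_left dot_square_norm)
    have "x \<noteq> 0" using x(2) by auto
    then have "x \<notin> B" using x_B(1) orthogonal_self by blast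
    have "pairwise orthogonal (insert x B)" "pairwise (\<lambda>b c. orthogonal (T b) c) (insert x B)"
      using B(4,5) x_B by (auto simp: pairwise_insert orthogonal_commute)
    then show ?case
      using B x(1) x_less \<open>x \<noteq> 0\<close> \<open>x \<notin> B\<close> by (intro exI[of _ "insert x B"]) auto
  qed
  then show thesis using that by blast
qed

lemma negative_index_ge_if_essential:
  assumes "z \<in> essential_spectrum" "z < s"
  shows "negative_index_ge s n"
proof -
  obtain B where B: "finite B" "card B = n" "B \<subseteq> H" "pairwise orthogonal B"
    "pairwise (\<lambda>b c. orthogonal (T b) c) B" "\<And>b. b \<in> B \<Longrightarrow> b \<noteq> 0 \<and> T b \<bullet> b < s * (b \<bullet> b)"
    using orthogonal_family_if_essential[OF assms, of n] by blast
  then have "negative_index_ge s (card B)" by (intro negative_index_ge_if_orthogonal) auto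
  with B(2) show ?thesis by simp
qed

lemma self_adjoint_operator_orthogonal_comp_eigenvectors:
  assumes "\<And>b. b \<in> B \<Longrightarrow> \<exists>l. T b = l *\<^sub>R b"
  shows "self_adjoint_operator T (H \<inter> B\<^sup>\<bottom>)"
proof (rule self_adjoint_operator_subspace)
  show "subspace (H \<inter> B\<^sup>\<bottom>)" by (intro subspace_inter subspace_H subspace_orthogonal_comp)
  show "closed (H \<inter> B\<^sup>\<bottom>)" by (intro closed_Int closed_H closed_orthogonal_comp)
  fix x assume x: "x \<in> H \<inter> B\<^sup>\<bottom>"
  have "b \<bullet> T x = 0" if "b \<in> B" for b
    using assms[OF that] x that symmetric[of b x] by (auto simp: orthogonal_comp_def orthogonal_def)
  then show "T x \<in> H \<inter> B\<^sup>\<bottom>" using x T_in_H by (simp add: orthogonal_comp_def orthogonal_def)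
qed

lemma eigenvector_below_essential_spectrum:
  assumes B: "\<And>b. b \<in> B \<Longrightarrow> \<exists>l. T b = l *\<^sub>R b"
    and f: "f \<in> H \<inter> B\<^sup>\<bottom>" "T f \<bullet> f < s * (f \<bullet> f)"
    and above: "\<And>z. z \<in> essential_spectrum \<Longrightarrow> s \<le> z"
  obtains x l where "x \<in> H \<inter> B\<^sup>\<bottom>" "x \<noteq> 0" "T x = l *\<^sub>R x" "l < s"
proof -
  interpret M: self_adjoint_operator T "H \<inter> B\<^sup>\<bottom>"
    by (rule self_adjoint_operator_orthogonal_comp_eigenvectors[OF B])
  have "f \<noteq> 0" using f(2) by auto
  have "M.rayleigh_inf * (f \<bullet> f) < s * (f \<bullet> f)" using M.rayleigh_inf_le[OF f(1)] f(2) by linarith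
  then have less: "M.rayleigh_inf < s" by (rule mult_right_less_imp_less) simp
  have subset: "M.ap_spectrum \<subseteq> ap_spectrum"
    unfolding M.ap_spectrum_def ap_spectrum_def using bounded_below_on_subset[of H _ "H \<inter> B\<^sup>\<bottom>"] by blast
  have "M.rayleigh_inf \<in> M.ap_spectrum" using M.rayleigh_inf_in_ap_spectrum[OF f(1) \<open>f \<noteq> 0\<close>] .
  moreover from this have "M.rayleigh_inf \<in> discrete_spectrum"
    using above less subset unfolding essential_spectrum_def by force
  ultimately have "M.rayleigh_inf isolated_in M.ap_spectrum"
    using isolated_in_subset[OF _ subset] by (auto simp: discrete_spectrum_def)
  then obtain x where "x \<in> H \<inter> B\<^sup>\<bottom>" "x \<noteq> 0" "T x = M.rayleigh_inf *\<^sub>R x"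
    by (rule M.isolated_rayleigh_inf_eigenvalue[OF f(1) \<open>f \<noteq> 0\<close>])
  then show ?thesis using that less by blast
qed

lemma eigen_dim_ge_if_negative_index_ge:
  assumes index: "negative_index_ge s n" and above: "\<And>z. z \<in> essential_spectrum \<Longrightarrow> s \<le> z"
  shows "eigen_dim_ge (\<lambda>l. l < s) n"
proof -
  obtain N where N: "finite N" "independent N" "card N = n" "N \<subseteq> H" "span N \<subseteq> H"
    "\<forall>f\<in>span N. f \<noteq> 0 \<longrightarrow> T f \<bullet> f < s * (f \<bullet> f)"
    using index by (rule negative_index_geE)
  have "\<exists>B. finite B \<and> card B = k \<and> B \<subseteq> H \<and> pairwise orthogonal B \<and> 0 \<notin> B \<and>
      (\<forall>b\<in>B. \<exists>l. T b = l *\<^sub>R b \<and> l < s)" if "k \<le> n" for k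
    using that
  proof (induction k)
    case 0
    show ?case by (intro exI[of _ "{}"]) simp
  next
    case (Suc k)
    then obtain B where B: "finite B" "card B = k" "B \<subseteq> H" "pairwise orthogonal B" "0 \<notin> B"
      "\<And>b. b \<in> B \<Longrightarrow> \<exists>l. T b = l *\<^sub>R b \<and> l < s" by auto
    obtain f where f: "f \<in> span N" "f \<noteq> 0" "f \<in> B\<^sup>\<bottom>"
      by (rule exists_nonzero_in_span_orthogonal[OF N(2,1) B(1)]) (use B(2) N(3) Suc.prems in simp)
    have eigen: "\<exists>l. T b = l *\<^sub>R b" if "b \<in> B" for b using B(6)[OF that] by blast
    have f_perp: "f \<in> H \<inter> B\<^sup>\<bottom>" and f_less: "T f \<bullet> f < s * (f \<bullet> f)" using f N(5,6) by auto
    obtain x l where x: "x \<in> H \<inter> B\<^sup>\<bottom>" "x \<noteq> 0" "T x = l *\<^sub>R x" "l < s"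
      by (rule eigenvector_below_essential_spectrum[OF eigen f_perp f_less above])
    have x_B: "orthogonal b x" if "b \<in> B" for b using x(1) that by (simp add: orthogonal_comp_def)
    then have "x \<notin> B" using x(2) orthogonal_self by blast
    moreover have "pairwise orthogonal (insert x B)"
      using B(4) x_B by (auto simp: pairwise_insert orthogonal_commute)
    ultimately show ?case using B x by (intro exI[of _ "insert x B"]) auto
  qed
  from this[of n] obtain B where B: "finite B" "card B = n" "B \<subseteq> H" "pairwise orthogonal B" "0 \<notin> B"
    "\<forall>b\<in>B. \<exists>l. T b = l *\<^sub>R b \<and> l < s" by blast
  have "eigen_dim_ge (\<lambda>l. l < s) (card B)"
    by (rule eigen_dim_geI[OF B(1) pairwise_orthogonal_independent[OF B(4,5)] B(3)])
      (use B(6) in blast)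
  with B(2) show ?thesis by simp
qed

lemma finite_ap_spectrum_if_no_essential:
  assumes "essential_spectrum = {}"
  shows "finite ap_spectrum"
proof (rule ccontr)
  assume "infinite ap_spectrum"
  moreover have "ap_spectrum \<subseteq> {- onorm T..onorm T}"
    using abs_ap_spectrum_le_onorm by (force simp: abs_le_iff)
  ultimately obtain z where z: "z islimpt ap_spectrum"
    using Heine_Borel_imp_Bolzano_Weierstrass[OF compact_Icc] by blast
  then have "z \<in> ap_spectrum" using closed_ap_spectrum by (simp add: closed_limpt)
  then have "z \<in> discrete_spectrum" using assms unfolding essential_spectrum_def by blast
  then show False using z by (simp add: discrete_spectrum_def isolated_in_islimpt_iff)
qed

lemma essential_spectrum_nonempty:
  assumes "infinite_dimensional H"
  shows "essential_spectrum \<noteq> {}"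
proof
  assume none: "essential_spectrum = {}"
  then have fin: "finite ap_spectrum" by (rule finite_ap_spectrum_if_no_essential)
  have "\<forall>z\<in>ap_spectrum. \<exists>k. \<not> eigen_dim_ge (\<lambda>l. l = z) k"
    using none unfolding essential_spectrum_def discrete_spectrum_def by blast
  then obtain k where k: "\<And>z. z \<in> ap_spectrum \<Longrightarrow> \<not> eigen_dim_ge (\<lambda>l. l = z) (k z)" by metis
  define n where "n = Suc (\<Sum>z\<in>ap_spectrum. k z)"
  have "negative_index_ge (onorm T + 1) n" using assms by (rule negative_index_ge_above_onorm) simp
  then have "eigen_dim_ge (\<lambda>l. l < onorm T + 1) n"
    by (rule eigen_dim_ge_if_negative_index_ge) (simp add: none)
  then obtain B where B: "finite B" "independent B" "card B = n" "B \<subseteq> H"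
    "\<forall>b\<in>B. \<exists>l. T b = l *\<^sub>R b \<and> l < onorm T + 1"
    by (rule eigen_dim_geE)
  define E where "E z = {b \<in> B. T b = z *\<^sub>R b}" for z
  have E_le: "card (E z) \<le> k z" if "z \<in> ap_spectrum" for z
  proof (rule ccontr)
    have "eigen_dim_ge (\<lambda>l. l = z) (card (E z))"
      using B(1,4) independent_mono[OF B(2)] by (intro eigen_dim_geI) (auto simp: E_def)
    moreover assume "\<not> card (E z) \<le> k z"
    ultimately show False using k[OF that] eigen_dim_ge_antimono by simp
  qed
  have "B \<subseteq> (\<Union>z\<in>ap_spectrum. E z)"
  proof
    fix b assume b: "b \<in> B"
    then obtain l where l: "T b = l *\<^sub>R b" using B(5) by blast
    have "b \<noteq> 0" using b B(2) dependent_zero by blast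
    then show "b \<in> (\<Union>z\<in>ap_spectrum. E z)"
      using b l B(4) eigenvalue_in_ap_spectrum by (auto simp: E_def)
  qed
  then have "card B \<le> card (\<Union>z\<in>ap_spectrum. E z)"
    using fin B(1) by (intro card_mono finite_UN_I) (auto simp: E_def)
  also have "\<dots> \<le> (\<Sum>z\<in>ap_spectrum. card (E z))" using fin by (rule card_UN_le)
  also have "\<dots> \<le> (\<Sum>z\<in>ap_spectrum. k z)" using E_le by (rule sum_mono)
  finally show False using B(3) by (simp add: n_def)
qed

definition minmax :: "nat \<Rightarrow> real" where
  "minmax n = Inf {s. negative_index_ge s n}"

lemma minmax_le:
  assumes "negative_index_ge s n" "1 \<le> n"
  shows "minmax n \<le> s"
  unfolding minmax_def using assms neg_onorm_le_if_negative_index_ge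
  by (intro cInf_lower bdd_belowI[of _ "- onorm T"]) auto

lemma negative_index_ge_if_minmax_less:
  assumes "infinite_dimensional H" "minmax n < s"
  shows "negative_index_ge s n"
proof -
  have "negative_index_ge (onorm T + 1) n"
    using assms(1) by (rule negative_index_ge_above_onorm) simp
  then have "{s. negative_index_ge s n} \<noteq> {}" by blast
  then obtain t where "negative_index_ge t n" "t < s"
    using cInf_lessD[of "{s. negative_index_ge s n}" s] assms(2) unfolding minmax_def by auto
  then show ?thesis using negative_index_ge_mono by simp
qed

end

lemma minmax_perturb_le:
  assumes "self_adjoint_operator T H" "self_adjoint_operator T' H"
    and form_le: "\<And>f. f \<in> H \<Longrightarrow> T' f \<bullet> f \<le> T f \<bullet> f + c * (f \<bullet> f)"
    and dim: "infinite_dimensional H" and n: "1 \<le> n"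
  shows "self_adjoint_operator.minmax T' H n \<le> self_adjoint_operator.minmax T H n + c"
proof -
  interpret T: self_adjoint_operator T H by fact
  interpret T': self_adjoint_operator T' H by fact
  have le: "T'.minmax n \<le> s + c" if less: "T.minmax n < s" for s
  proof -
    obtain B where B: "finite B" "independent B" "card B = n" "B \<subseteq> H" "span B \<subseteq> H"
      "\<forall>f\<in>span B. f \<noteq> 0 \<longrightarrow> T f \<bullet> f < s * (f \<bullet> f)"
      using T.negative_index_ge_if_minmax_less[OF dim less] by (rule T.negative_index_geE)
    have "T'.negative_index_ge (s + c) (card B)"
    proof (rule T'.negative_index_geI[OF B(1,2,4)])
      fix f assume "f \<in> span B" "f \<noteq> 0"
      then show "T' f \<bullet> f < (s + c) * (f \<bullet> f)"
        using form_le[of f] B(5,6) by (force simp: distrib_right)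
    qed
    then show ?thesis using n B(3) by (intro T'.minmax_le) auto
  qed
  have "T'.minmax n - c \<le> T.minmax n"
    by (rule dense_ge) (simp add: le diff_le_eq)
  then show ?thesis by simp
qed

section \<open>The space of square summable functions\<close>

typedef 'a ell2 = "{f :: 'a \<Rightarrow> complex. (\<lambda>x. (cmod (f x))\<^sup>2) summable_on UNIV}"
  morphisms fun_of ell2_of
  by (rule exI[of _ "\<lambda>_. 0"]) simp

setup_lifting type_definition_ell2

lemma square_summable_add:
  fixes f g :: "'a \<Rightarrow> complex"
  assumes "(\<lambda>x. (cmod (f x))\<^sup>2) summable_on A" "(\<lambda>x. (cmod (g x))\<^sup>2) summable_on A"
  shows "(\<lambda>x. (cmod (f x + g x))\<^sup>2) summable_on A"
proof (rule summable_on_comparison_test)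
  show "(\<lambda>x. 2 * (cmod (f x))\<^sup>2 + 2 * (cmod (g x))\<^sup>2) summable_on A"
    using assms by (intro summable_on_add summable_on_cmult_right)
  show "(cmod (f x + g x))\<^sup>2 \<le> 2 * (cmod (f x))\<^sup>2 + 2 * (cmod (g x))\<^sup>2" for x
  proof -
    have "(cmod (f x + g x))\<^sup>2 \<le> (cmod (f x) + cmod (g x))\<^sup>2"
      by (intro power_mono norm_triangle_ineq) auto
    also have "\<dots> \<le> 2 * (cmod (f x))\<^sup>2 + 2 * (cmod (g x))\<^sup>2"
      using sum_squares_bound[of "cmod (f x)" "cmod (g x)"] by (simp add: power2_sum)
    finally show ?thesis .
  qed
qed auto

lemma square_summable_mult:
  fixes f :: "'a \<Rightarrow> complex"
  assumes "(\<lambda>x. (cmod (f x))\<^sup>2) summable_on A"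
  shows "(\<lambda>x. (cmod (c * f x))\<^sup>2) summable_on A"
  using assms by (simp add: norm_mult power_mult_distrib summable_on_cmult_right)

lemma fun_of_square_summable: "(\<lambda>x. (cmod (fun_of f x))\<^sup>2) summable_on UNIV"
  using fun_of[of f] by (simp only: mem_Collect_eq)

lemma fun_of_inner_summable: "(\<lambda>x. fun_of f x \<bullet> fun_of g x) summable_on UNIV"
proof -
  have "(\<lambda>x. norm (fun_of f x \<bullet> fun_of g x)) summable_on UNIV"
  proof (rule summable_on_comparison_test)
    show "(\<lambda>x. (cmod (fun_of f x))\<^sup>2 + (cmod (fun_of g x))\<^sup>2) summable_on UNIV"
      by (intro summable_on_add fun_of_square_summable)
    show "norm (fun_of f x \<bullet> fun_of g x) \<le> (cmod (fun_of f x))\<^sup>2 + (cmod (fun_of g x))\<^sup>2" for x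
      using Cauchy_Schwarz_ineq2[of "fun_of f x" "fun_of g x"]
        sum_squares_bound[of "cmod (fun_of f x)" "cmod (fun_of g x)"]
        zero_le_power2[of "cmod (fun_of f x)"] zero_le_power2[of "cmod (fun_of g x)"]
      unfolding real_norm_def by linarith
  qed auto
  then show ?thesis by (rule abs_summable_summable)
qed

instantiation ell2 :: (type) real_inner
begin

lift_definition zero_ell2 :: "'a ell2" is "\<lambda>_. 0" by simp
lift_definition plus_ell2 :: "'a ell2 \<Rightarrow> 'a ell2 \<Rightarrow> 'a ell2" is "\<lambda>f g x. f x + g x"
  by (rule square_summable_add)
lift_definition uminus_ell2 :: "'a ell2 \<Rightarrow> 'a ell2" is "\<lambda>f x. - f x" by simp
lift_definition scaleR_ell2 :: "real \<Rightarrow> 'a ell2 \<Rightarrow> 'a ell2" is "\<lambda>r f x. complex_of_real r * f x"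
  by (rule square_summable_mult)
definition "f - g = f + (- g)" for f g :: "'a ell2"
definition "inner f g = (\<Sum>\<^sub>\<infinity>x. fun_of f x \<bullet> fun_of g x)" for f g :: "'a ell2"
definition "norm f = sqrt (inner f f)" for f :: "'a ell2"
definition "dist f g = norm (f - g)" for f g :: "'a ell2"
definition "sgn f = inverse (norm f) *\<^sub>R f" for f :: "'a ell2"
definition "uniformity = (INF e\<in>{0<..}. principal {(f, g :: 'a ell2). dist f g < e})"
definition "open U = (\<forall>f\<in>U. \<forall>\<^sub>F (f', g) in uniformity. f' = f \<longrightarrow> g \<in> U)" for U :: "'a ell2 set"

instance
proof
  fix f g h :: "'a ell2" and a b :: real and U :: "'a ell2 set"
  show "f + g + h = f + (g + h)" by transfer (simp add: add.assoc)
  show "f + g = g + f" by transfer (simp add: add.commute)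
  show "0 + f = f" by transfer simp
  show "- f + f = 0" by transfer simp
  show "f - g = f + - g" by (simp add: minus_ell2_def)
  show "a *\<^sub>R (f + g) = a *\<^sub>R f + a *\<^sub>R g" by transfer (simp add: algebra_simps)
  show "(a + b) *\<^sub>R f = a *\<^sub>R f + b *\<^sub>R f" by transfer (simp add: algebra_simps)
  show "a *\<^sub>R b *\<^sub>R f = (a * b) *\<^sub>R f" by transfer (simp add: algebra_simps)
  show "1 *\<^sub>R f = f" by transfer simp
  show "inner f g = inner g f" by (simp add: inner_ell2_def inner_commute)
  show "inner (f + g) h = inner f h + inner g h"
    by (simp add: inner_ell2_def plus_ell2.rep_eq inner_add_left infsum_add fun_of_inner_summable)
  show "inner (a *\<^sub>R f) g = a * inner f g"
    by (simp add: inner_ell2_def scaleR_ell2.rep_eq infsum_cmult_right'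
        flip: scaleR_conv_of_real)
  show "0 \<le> inner f f" unfolding inner_ell2_def by (rule infsum_nonneg) simp
  show "inner f f = 0 \<longleftrightarrow> f = 0"
  proof
    assume "inner f f = 0"
    then have "fun_of f x \<bullet> fun_of f x = 0" for x
      unfolding inner_ell2_def
      by (intro nonneg_infsum_le_0D[where A=UNIV and f="\<lambda>x. fun_of f x \<bullet> fun_of f x"]
          fun_of_inner_summable) auto
    then show "f = 0" by (simp add: zero_ell2.rep_eq fun_of_inject[symmetric] fun_eq_iff)
  qed (simp add: inner_ell2_def zero_ell2.rep_eq)
qed (simp_all add: norm_ell2_def dist_ell2_def sgn_ell2_def uniformity_ell2_def open_ell2_def)

end

lemmas fun_of_simps [simp] = zero_ell2.rep_eq plus_ell2.rep_eq uminus_ell2.rep_eq scaleR_ell2.rep_eq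

lemma fun_of_minus [simp]: "fun_of (f - g) x = fun_of f x - fun_of g x"
  by (subst minus_ell2_def) (simp del: add_uminus_conv_diff)

lemma fun_of_sum [simp]: "fun_of (sum f A) x = (\<Sum>i\<in>A. fun_of (f i) x)"
  by (induction A rule: infinite_finite_induct) auto

lemma ell2_eqI: "(\<And>x. fun_of f x = fun_of g x) \<Longrightarrow> f = g"
  by (metis ext fun_of_inject)

lemma norm_ell2_sq: "(norm f)\<^sup>2 = (\<Sum>\<^sub>\<infinity>x. (cmod (fun_of f x))\<^sup>2)"
  by (simp add: power2_norm_eq_inner inner_ell2_def)

lemma finite_sum_le_norm_ell2_sq: "finite A \<Longrightarrow> (\<Sum>x\<in>A. (cmod (fun_of f x))\<^sup>2) \<le> (norm f)\<^sup>2"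
  unfolding norm_ell2_sq by (rule finite_sum_le_infsum[OF fun_of_square_summable]) auto

lemma fun_of_ell2_of_bounded:
  assumes bound: "\<And>A. finite A \<Longrightarrow> (\<Sum>x\<in>A. (cmod (h x))\<^sup>2) \<le> C\<^sup>2" and "0 \<le> C"
  shows "fun_of (ell2_of h) = h" "norm (ell2_of h) \<le> C"
proof -
  have summable: "(\<lambda>x. (cmod (h x))\<^sup>2) summable_on UNIV"
    using bound by (intro nonneg_bdd_above_summable_on bdd_aboveI2[where M = "C\<^sup>2"]) auto
  then show fun_of: "fun_of (ell2_of h) = h" by (simp add: ell2_of_inverse)
  have "(norm (ell2_of h))\<^sup>2 \<le> C\<^sup>2"
    unfolding norm_ell2_sq fun_of using summable by (rule infsum_le_finite_sums) (simp add: bound)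
  then show "norm (ell2_of h) \<le> C" using \<open>0 \<le> C\<close> by (rule power2_le_imp_le)
qed

lemma cmod_fun_of_le_norm: "cmod (fun_of f x) \<le> norm f"
  by (rule power2_le_imp_le) (use finite_sum_le_norm_ell2_sq[of "{x}" f] in simp_all)

lemma bounded_linear_fun_of: "bounded_linear (\<lambda>f. fun_of f x)"
  by (rule bounded_linear_intro[where K=1]) (simp_all add: cmod_fun_of_le_norm scaleR_conv_of_real)

lemma Cauchy_ell2_pointwise_limit:
  assumes C: "Cauchy F" and g: "\<And>x. (\<lambda>n. fun_of (F n) x) \<longlonglongrightarrow> g x" and \<epsilon>: "0 < \<epsilon>"
  obtains N where "\<And>n A. N \<le> n \<Longrightarrow> finite A \<Longrightarrow> (\<Sum>x\<in>A. (cmod (fun_of (F n) x - g x))\<^sup>2) \<le> \<epsilon>\<^sup>2"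
proof -
  obtain N where N: "\<And>n m. N \<le> n \<Longrightarrow> N \<le> m \<Longrightarrow> norm (F n - F m) < \<epsilon>"
    using C \<epsilon> unfolding Cauchy_iff by blast
  have "(\<Sum>x\<in>A. (cmod (fun_of (F n) x - g x))\<^sup>2) \<le> \<epsilon>\<^sup>2" if n: "N \<le> n" and A: "finite A" for n A
  proof (rule tendsto_upperbound)
    show "(\<lambda>m. \<Sum>x\<in>A. (cmod (fun_of (F n) x - fun_of (F m) x))\<^sup>2)
        \<longlonglongrightarrow> (\<Sum>x\<in>A. (cmod (fun_of (F n) x - g x))\<^sup>2)"
      by (intro tendsto_intros g)
    show "\<forall>\<^sub>F m in sequentially. (\<Sum>x\<in>A. (cmod (fun_of (F n) x - fun_of (F m) x))\<^sup>2) \<le> \<epsilon>\<^sup>2"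
    proof (rule eventually_sequentiallyI[of N])
      fix m assume "N \<le> m"
      have "(\<Sum>x\<in>A. (cmod (fun_of (F n) x - fun_of (F m) x))\<^sup>2) \<le> (norm (F n - F m))\<^sup>2"
        using finite_sum_le_norm_ell2_sq[OF A, of "F n - F m"] by simp
      also have "\<dots> \<le> \<epsilon>\<^sup>2" using N[OF n \<open>N \<le> m\<close>] by (intro power_mono) auto
      finally show "(\<Sum>x\<in>A. (cmod (fun_of (F n) x - fun_of (F m) x))\<^sup>2) \<le> \<epsilon>\<^sup>2" .
    qed
  qed simp
  then show ?thesis by (rule that)
qed

instance ell2 :: (type) complete_space
proof
  fix F :: "nat \<Rightarrow> 'a ell2"
  assume C: "Cauchy F"
  have "Cauchy (\<lambda>n. fun_of (F n) x)" for x
    by (rule bounded_linear.Cauchy[OF bounded_linear_fun_of C])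
  then have "\<exists>g. \<forall>x. (\<lambda>n. fun_of (F n) x) \<longlonglongrightarrow> g x"
    by (intro choice allI) (simp add: Cauchy_convergent_iff convergent_def)
  then obtain g where g: "\<And>x. (\<lambda>n. fun_of (F n) x) \<longlonglongrightarrow> g x" by blast
  note close = Cauchy_ell2_pointwise_limit[OF C g]
  define G where "G N = ell2_of (\<lambda>x. fun_of (F N) x - g x)" for N
  obtain N where N: "\<And>n A. N \<le> n \<Longrightarrow> finite A \<Longrightarrow> (\<Sum>x\<in>A. (cmod (fun_of (F n) x - g x))\<^sup>2) \<le> 1\<^sup>2"
    by (rule close[of 1]) auto
  have fun_of_G: "fun_of (G n) = (\<lambda>x. fun_of (F n) x - g x)" if "N \<le> n" for n
    unfolding G_def using fun_of_ell2_of_bounded(1)[OF N[OF that]] by simp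
  define l where "l = F N - G N"
  have diff: "F n - l = G n" if "N \<le> n" for n
    by (rule ell2_eqI) (simp add: l_def fun_of_G that)
  have "F \<longlonglongrightarrow> l"
  proof (rule LIMSEQ_I)
    fix r :: real assume "0 < r"
    obtain M where M: "\<And>n A. M \<le> n \<Longrightarrow> finite A \<Longrightarrow> (\<Sum>x\<in>A. (cmod (fun_of (F n) x - g x))\<^sup>2) \<le> (r/2)\<^sup>2"
      by (rule close[of "r/2"]) (use \<open>0 < r\<close> in auto)
    have "norm (F n - l) < r" if "max N M \<le> n" for n
      using fun_of_ell2_of_bounded(2)[of "\<lambda>x. fun_of (F n) x - g x" "r/2"] M[of n] that \<open>0 < r\<close>
      by (simp add: diff G_def)
    then show "\<exists>no. \<forall>n\<ge>no. norm (F n - l) < r" by blast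
  qed
  then show "convergent F" by (auto simp: convergent_def)
qed

subsection \<open>Complex scalars\<close>

lift_definition csc :: "complex \<Rightarrow> 'a ell2 \<Rightarrow> 'a ell2" is "\<lambda>c f x. c * f x"
  by (rule square_summable_mult)

declare csc.rep_eq [simp]

interpretation csc: vector_space csc
  by unfold_locales (rule ell2_eqI, simp add: algebra_simps)+

lemma csc_of_real [simp]: "csc (complex_of_real r) f = r *\<^sub>R f"
  by (rule ell2_eqI) simp

lemma csc_scaleR: "csc c (r *\<^sub>R f) = r *\<^sub>R csc c f"
  by (rule ell2_eqI) simp

lemma csc_Re_Im: "csc c f = Re c *\<^sub>R f + Im c *\<^sub>R csc \<i> f"
  by (rule ell2_eqI) (simp add: complex_eq_iff)

lemma norm_csc: "norm (csc c f) = cmod c * norm f"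
proof -
  have "(norm (csc c f))\<^sup>2 = (cmod c * norm f)\<^sup>2"
    by (simp add: power_mult_distrib norm_ell2_sq norm_mult infsum_cmult_right')
  then show ?thesis by simp
qed

lemma bounded_linear_csc: "bounded_linear (csc c)"
  by (rule bounded_linear_intro[where K="cmod c"])
    (auto simp: csc.scale_right_distrib csc_scaleR norm_csc)

lemma inner_csc_left: "csc c f \<bullet> g = f \<bullet> csc (cnj c) g"
  by (simp add: inner_ell2_def inner_complex_def algebra_simps)

lemma inner_csc_i_left: "csc \<i> f \<bullet> g = - (f \<bullet> csc \<i> g)"
  using inner_csc_left[of \<i> f g] csc_Re_Im[of "-\<i>" g] by (simp add: inner_minus_right)

lemma real_span_le_complex_span: "csc.span C \<subseteq> span (C \<union> csc \<i> ` C)"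
proof
  fix f assume "f \<in> csc.span C"
  then show "f \<in> span (C \<union> csc \<i> ` C)"
  proof (induction rule: csc.span_induct_alt)
    case (step c x y)
    have "csc c x \<in> span (C \<union> csc \<i> ` C)"
      unfolding csc_Re_Im[of c x] using step(1) by (intro span_add span_scale span_base) auto
    with step show ?case by (intro span_add)
  qed (rule span_zero)
qed

lemma complex_independent_subset:
  assumes "finite B" "independent B"
  obtains C where "C \<subseteq> B" "csc.independent C" "card B \<le> 2 * card C"
proof -
  obtain C where C: "C \<subseteq> B" "csc.independent C" "B \<subseteq> csc.span C"
    using csc.maximal_independent_subset[of B] by blast
  have fin: "finite C" using C(1) assms(1) by (rule finite_subset)
  have "card B \<le> card (C \<union> csc \<i> ` C)"
    using independent_span_bound[OF _ assms(2)] C(3) real_span_le_complex_span[of C] fin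
    by (meson finite_UnI finite_imageI order_trans)
  also have "\<dots> \<le> 2 * card C"
    using card_Un_le[of C "csc \<i> ` C"] card_image_le[OF fin, of "csc \<i>"] by linarith
  finally show ?thesis using C that by blast
qed

lemma complex_independent_Un_csc_i:
  assumes "finite C" "csc.independent C"
  shows "independent (C \<union> csc \<i> ` C)" "card (C \<union> csc \<i> ` C) = 2 * card C"
proof -
  have nonzero: "0 \<notin> C" using assms(2) csc.dependent_zero by blast
  have disjoint: "C \<inter> csc \<i> ` C = {}"
  proof (rule ccontr)
    assume "C \<inter> csc \<i> ` C \<noteq> {}"
    then obtain c where c: "c \<in> C" "csc \<i> c \<in> C" by blast
    have "csc \<i> c \<in> csc.span {c}" by (intro csc.span_scale csc.span_base) simp
    moreover have "csc \<i> c \<noteq> c"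
    proof
      assume "csc \<i> c = c"
      then have "csc (\<i> - 1) c = 0" by (simp add: csc.scale_left_diff_distrib)
      then show False using c(1) nonzero by (auto simp: complex_eq_iff)
    qed
    ultimately have "csc.dependent C"
      using c csc.span_mono[of "{c}" "C - {csc \<i> c}"] unfolding csc.dependent_def by blast
    with assms(2) show False by blast
  qed
  have inj: "inj_on (csc \<i>) A" for A :: "'a ell2 set" by (auto simp: inj_on_def)
  show "card (C \<union> csc \<i> ` C) = 2 * card C"
    using assms(1) disjoint by (simp add: card_Un_disjoint card_image inj)
  show "independent (C \<union> csc \<i> ` C)"
  proof (rule independent_if_scalars_zero)
    fix u x
    assume zero: "(\<Sum>x\<in>C \<union> csc \<i> ` C. u x *\<^sub>R x) = 0" and x: "x \<in> C \<union> csc \<i> ` C"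
    let ?v = "\<lambda>c. Complex (u c) (u (csc \<i> c))"
    have "(\<Sum>x\<in>C \<union> csc \<i> ` C. u x *\<^sub>R x) = (\<Sum>c\<in>C. u c *\<^sub>R c) + (\<Sum>c\<in>C. u (csc \<i> c) *\<^sub>R csc \<i> c)"
      using assms(1) disjoint by (simp add: sum.union_disjoint sum.reindex inj)
    also have "\<dots> = (\<Sum>c\<in>C. csc (?v c) c)"
      unfolding sum.distrib[symmetric] by (simp add: csc_Re_Im[of "?v _"])
    finally have "(\<Sum>c\<in>C. csc (?v c) c) = 0" using zero by simp
    then have "?v c = 0" if "c \<in> C" for c
      using csc.independentD[OF assms(2,1) order_refl, of ?v] that by simp
    then show "u x = 0" using x by (auto simp: complex_eq_iff)
  qed (use assms(1) in simp)
qed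

subsection \<open>Functions supported on a set\<close>

definition supported :: "'a set \<Rightarrow> 'a ell2 set" where
  "supported X = {f. \<forall>x. x \<notin> X \<longrightarrow> fun_of f x = 0}"

lemma subspace_supported: "subspace (supported X)"
  by (auto simp: subspace_def supported_def)

lemma csc_supported: "f \<in> supported X \<Longrightarrow> csc c f \<in> supported X"
  by (auto simp: supported_def)

lemma closed_supported: "closed (supported X)"
proof -
  have "supported X = (\<Inter>x\<in>-X. (\<lambda>f. fun_of f x) -` {0})" by (auto simp: supported_def)
  also have "closed \<dots>"
    by (intro closed_INT ballI continuous_closed_vimage closed_singleton
        linear_continuous_at[OF bounded_linear_fun_of])
  finally show ?thesis .
qed

lemma inner_supported: "f \<in> supported X \<Longrightarrow> g \<bullet> f = (\<Sum>\<^sub>\<infinity>x\<in>X. fun_of g x \<bullet> fun_of f x)"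
  unfolding inner_ell2_def by (intro infsum_cong_neutral) (auto simp: supported_def)

lemma l2_eq_image_supported: "l2 X = fun_of ` supported X"
proof -
  have summable_iff: "(\<lambda>x. (cmod (f x))\<^sup>2) summable_on X \<longleftrightarrow> (\<lambda>x. (cmod (f x))\<^sup>2) summable_on UNIV"
    if "\<And>x. x \<notin> X \<Longrightarrow> f x = 0" for f :: "pt \<Rightarrow> complex"
    using that by (intro summable_on_cong_neutral) auto
  show ?thesis
  proof safe
    fix f assume f: "f \<in> l2 X"
    then have "fun_of (ell2_of f) = f"
      using summable_iff[of f] by (auto simp: l2_def ell2_of_inverse)
    then show "f \<in> fun_of ` supported X"
      using f by (intro image_eqI[of _ _ "ell2_of f"]) (auto simp: supported_def l2_def)
  next
    fix f assume "f \<in> supported X"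
    then show "fun_of f \<in> l2 X"
      using summable_iff[of "fun_of f"] fun_of_square_summable by (auto simp: l2_def supported_def)
  qed
qed

lemma l2norm_fun_of:
  assumes "f \<in> supported X"
  shows "l2norm X (fun_of f) = norm f"
proof -
  have "(\<Sum>\<^sub>\<infinity>x\<in>X. (cmod (fun_of f x))\<^sup>2) = (norm f)\<^sup>2"
    unfolding norm_ell2_sq using assms by (intro infsum_cong_neutral) (auto simp: supported_def)
  then show ?thesis by (simp add: l2norm_def)
qed

lift_definition delta :: "'a \<Rightarrow> 'a ell2" is "\<lambda>x y. if y = x then 1 else 0"
proof -
  fix x :: 'a
  have "(\<lambda>y. (cmod (if y = x then 1 else 0))\<^sup>2) summable_on {x}" by simp
  then show "(\<lambda>y. (cmod (if y = x then 1 else 0))\<^sup>2) summable_on UNIV"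
    by (rule summable_on_cong_neutral[THEN iffD1, rotated -1]) auto
qed

lemma delta_supported: "x \<in> X \<Longrightarrow> delta x \<in> supported X"
  by (auto simp: supported_def delta.rep_eq)

lemma inner_delta: "f \<bullet> csc c (delta x) = fun_of f x \<bullet> c"
proof -
  have "csc c (delta x) \<in> supported {x}" by (intro csc_supported delta_supported) simp
  then show ?thesis by (simp add: inner_supported delta.rep_eq)
qed

lemma independent_delta: "independent (delta ` X)"
proof (rule pairwise_orthogonal_independent)
  have inner: "delta x \<bullet> delta y = (if x = y then 1 else 0)" for x y :: 'a
    using inner_delta[of "delta x" 1 y] by (simp add: delta.rep_eq inner_complex_def)
  then show "pairwise orthogonal (delta ` X)" by (auto simp: pairwise_def orthogonal_def)
  show "0 \<notin> delta ` X" using inner by (metis imageE inner_zero_left zero_neq_one)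
qed

lemma infinite_dimensional_supported:
  assumes "infinite X"
  shows "infinite_dimensional (supported X)"
proof -
  have "x = y" if "delta x = delta y" for x y :: 'a
  proof -
    have "fun_of (delta x) x = fun_of (delta y) x" using that by simp
    then show ?thesis by (simp add: delta.rep_eq split: if_splits)
  qed
  then have "inj_on delta X" by (simp add: inj_on_def)
  with assms have "infinite (delta ` X)" by (simp add: finite_image_iff)
  moreover have "delta ` X \<subseteq> supported X" by (intro image_subsetI delta_supported)
  ultimately show ?thesis
    unfolding infinite_dimensional_def using independent_delta by (intro exI[of _ "delta ` X"]) simp
qed

subsection \<open>Weighted composition operators\<close>

definition weighted_comp :: "'b set \<Rightarrow> ('b \<Rightarrow> complex) \<Rightarrow> ('b \<Rightarrow> 'a) \<Rightarrow> 'a ell2 \<Rightarrow> 'b ell2" where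
  "weighted_comp E \<kappa> \<phi> f = ell2_of (\<lambda>e. if e \<in> E then \<kappa> e * fun_of f (\<phi> e) else 0)"

locale weighted_composition =
  fixes E :: "'b set" and \<kappa> :: "'b \<Rightarrow> complex" and \<phi> :: "'b \<Rightarrow> 'a" and K :: real and D :: nat
  assumes weight_le: "e \<in> E \<Longrightarrow> cmod (\<kappa> e) \<le> K" and K_nonneg: "0 \<le> K"
    and finite_fiber: "finite {e \<in> E. \<phi> e = x}" and card_fiber_le: "card {e \<in> E. \<phi> e = x} \<le> D"
begin

lemma weighted_sum_le:
  assumes "finite A"
  shows "(\<Sum>e\<in>A. (cmod (if e \<in> E then \<kappa> e * fun_of f (\<phi> e) else 0))\<^sup>2) \<le> (K * sqrt D * norm f)\<^sup>2"
proof -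
  let ?A = "A \<inter> E"
  have "(\<Sum>e\<in>A. (cmod (if e \<in> E then \<kappa> e * fun_of f (\<phi> e) else 0))\<^sup>2)
      = (\<Sum>e\<in>?A. (cmod (\<kappa> e * fun_of f (\<phi> e)))\<^sup>2)"
    using assms by (intro sum.mono_neutral_cong_right) auto
  also have "\<dots> \<le> (\<Sum>e\<in>?A. K\<^sup>2 * (cmod (fun_of f (\<phi> e)))\<^sup>2)"
    using weight_le
    by (intro sum_mono) (auto simp: norm_mult power_mult_distrib intro!: mult_right_mono power_mono)
  also have "\<dots> = (\<Sum>x\<in>\<phi> ` ?A. \<Sum>e\<in>{e\<in>?A. \<phi> e = x}. K\<^sup>2 * (cmod (fun_of f (\<phi> e)))\<^sup>2)"
    using assms by (intro sum.image_gen) simp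
  also have "\<dots> \<le> (\<Sum>x\<in>\<phi> ` ?A. D * (K\<^sup>2 * (cmod (fun_of f x))\<^sup>2))"
  proof (rule sum_mono)
    fix x
    have "card {e\<in>?A. \<phi> e = x} \<le> card {e\<in>E. \<phi> e = x}" by (intro card_mono finite_fiber) auto
    also have "\<dots> \<le> D" by (rule card_fiber_le)
    finally show "(\<Sum>e\<in>{e\<in>?A. \<phi> e = x}. K\<^sup>2 * (cmod (fun_of f (\<phi> e)))\<^sup>2) \<le> D * (K\<^sup>2 * (cmod (fun_of f x))\<^sup>2)"
      by (simp add: mult_right_mono)
  qed
  also have "\<dots> = K\<^sup>2 * D * (\<Sum>x\<in>\<phi> ` ?A. (cmod (fun_of f x))\<^sup>2)"
    by (simp add: sum_distrib_left ac_simps)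
  also have "\<dots> \<le> K\<^sup>2 * D * (norm f)\<^sup>2"
    using assms by (intro mult_left_mono finite_sum_le_norm_ell2_sq) auto
  finally show ?thesis by (simp add: power_mult_distrib)
qed

lemma fun_of_weighted_comp:
  "fun_of (weighted_comp E \<kappa> \<phi> f) e = (if e \<in> E then \<kappa> e * fun_of f (\<phi> e) else 0)"
  unfolding weighted_comp_def
  by (subst fun_of_ell2_of_bounded(1)[OF weighted_sum_le])
    (simp_all add: K_nonneg mult_nonneg_nonneg)

lemma norm_weighted_comp_le: "norm (weighted_comp E \<kappa> \<phi> f) \<le> K * sqrt D * norm f"
  unfolding weighted_comp_def
  by (rule fun_of_ell2_of_bounded(2)[OF weighted_sum_le])
    (simp_all add: K_nonneg mult_nonneg_nonneg)

lemma bounded_linear_weighted_comp: "bounded_linear (weighted_comp E \<kappa> \<phi>)"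
proof (rule bounded_linear_intro)
  show "norm (weighted_comp E \<kappa> \<phi> f) \<le> norm f * (K * sqrt D)" for f
    using norm_weighted_comp_le[of f] by (simp only: mult.commute)
qed (rule ell2_eqI, simp add: fun_of_weighted_comp algebra_simps)+

lemma weighted_comp_csc: "weighted_comp E \<kappa> \<phi> (csc c f) = csc c (weighted_comp E \<kappa> \<phi> f)"
  by (rule ell2_eqI) (simp add: fun_of_weighted_comp)

lemma weighted_composition_subset:
  assumes "E' \<subseteq> E"
  shows "weighted_composition E' \<kappa> \<phi> K D"
proof
  fix x
  have "{e \<in> E'. \<phi> e = x} \<subseteq> {e \<in> E. \<phi> e = x}" using assms by auto
  then show "finite {e \<in> E'. \<phi> e = x}" "card {e \<in> E'. \<phi> e = x} \<le> D"
    using finite_fiber[of x] card_fiber_le[of x]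
    by (auto intro: finite_subset order_trans[OF card_mono])
qed (use assms weight_le K_nonneg in auto)

lemma weighted_comp_supported: "weighted_comp E \<kappa> \<phi> f \<in> supported E"
  by (simp add: supported_def fun_of_weighted_comp)

end

section \<open>Spectra of operators on square summable functions\<close>

lemma lin_indep_map_fun_of:
  "lin_indep (map fun_of gs) \<longleftrightarrow>
    (\<forall>c. (\<Sum>i<length gs. csc (c i) (gs ! i)) = 0 \<longrightarrow> (\<forall>i<length gs. c i = 0))"
proof -
  have "(\<forall>x. (\<Sum>i<length gs. c i * fun_of (gs ! i) x) = 0) \<longleftrightarrow> (\<Sum>i<length gs. csc (c i) (gs ! i)) = 0"
    for c
  proof
    assume "\<forall>x. (\<Sum>i<length gs. c i * fun_of (gs ! i) x) = 0"
    then show "(\<Sum>i<length gs. csc (c i) (gs ! i)) = 0" by (intro ell2_eqI) simp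
  next
    assume zero: "(\<Sum>i<length gs. csc (c i) (gs ! i)) = 0"
    have "(\<Sum>i<length gs. c i * fun_of (gs ! i) x) = fun_of (\<Sum>i<length gs. csc (c i) (gs ! i)) x" for x
      by simp
    then show "\<forall>x. (\<Sum>i<length gs. c i * fun_of (gs ! i) x) = 0" unfolding zero by simp
  qed
  then show ?thesis by (simp add: lin_indep_def)
qed

lemma lin_indep_if_csc_independent:
  assumes "distinct gs" "csc.independent (set gs)"
  shows "lin_indep (map fun_of gs)"
  unfolding lin_indep_map_fun_of
proof (intro allI impI)
  fix c :: "nat \<Rightarrow> complex" and i
  assume zero: "(\<Sum>i<length gs. csc (c i) (gs ! i)) = 0" and i: "i < length gs"
  have bij: "bij_betw ((!) gs) {..<length gs} (set gs)" using assms(1) by (rule bij_betw_nth) auto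
  define u where "u g = c (inv_into {..<length gs} ((!) gs) g)" for g
  have u: "u (gs ! i) = c i" if "i < length gs" for i
    using bij_betw_inv_into_left[OF bij, of i] that by (simp add: u_def)
  have "(\<Sum>g\<in>set gs. csc (u g) g) = (\<Sum>i<length gs. csc (u (gs ! i)) (gs ! i))"
    by (rule sum.reindex_bij_betw[OF bij, symmetric])
  also have "\<dots> = 0" using zero by (simp add: u)
  finally have "u (gs ! i) = 0"
    using csc.independentD[OF assms(2) finite_set order_refl, of u "gs ! i"] i by simp
  then show "c i = 0" using u[OF i] by simp
qed

lemma distinct_if_lin_indep:
  assumes "lin_indep (map fun_of gs)"
  shows "distinct gs"
  unfolding distinct_conv_nth
proof (intro allI impI notI)
  fix i j assume ij: "i < length gs" "j < length gs" "i \<noteq> j" "gs ! i = gs ! j"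
  define c where "c k = (if k = i then 1 else if k = j then - 1 else 0 :: complex)" for k
  have "(\<Sum>k<length gs. csc (c k) (gs ! k)) = (\<Sum>k\<in>{i, j}. csc (c k) (gs ! k))"
    using ij by (intro sum.mono_neutral_right) (auto simp: c_def)
  also have "\<dots> = 0" using ij by (simp add: c_def)
  finally have "c i = 0" using assms ij(1) unfolding lin_indep_map_fun_of by blast
  then show False by (simp add: c_def)
qed

lemma csc_independent_if_lin_indep:
  assumes "lin_indep (map fun_of gs)"
  shows "csc.independent (set gs)"
proof (rule csc.independent_if_scalars_zero)
  fix u g
  assume zero: "(\<Sum>g\<in>set gs. csc (u g) g) = 0" and "g \<in> set gs"
  then obtain i where i: "i < length gs" "g = gs ! i" by (auto simp: in_set_conv_nth)
  have bij: "bij_betw ((!) gs) {..<length gs} (set gs)"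
    using distinct_if_lin_indep[OF assms] by (rule bij_betw_nth) auto
  have "(\<Sum>i<length gs. csc (u (gs ! i)) (gs ! i)) = 0"
    unfolding sum.reindex_bij_betw[OF bij, of "\<lambda>g. csc (u g) g"] by (rule zero)
  then have "u (gs ! i) = 0"
    using assms[unfolded lin_indep_map_fun_of, THEN spec[of _ "\<lambda>i. u (gs ! i)"]] i(1) by blast
  then show "u g = 0" by (simp add: i(2))
qed simp

lemma isolated_in_iff_ball:
  fixes x :: "'a::metric_space"
  assumes "x \<in> S"
  shows "x isolated_in S \<longleftrightarrow> (\<exists>\<epsilon>>0. ball x \<epsilon> \<inter> S = {x})"
proof
  assume "x isolated_in S"
  then obtain \<epsilon> where \<epsilon>: "0 < \<epsilon>" "\<forall>y\<in>S. dist x y < \<epsilon> \<longrightarrow> y = x"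
    unfolding isolated_in_dist_Ex_iff by blast
  have "ball x \<epsilon> \<inter> S \<subseteq> {x}" using \<epsilon>(2) by auto
  moreover have "x \<in> ball x \<epsilon> \<inter> S" using \<epsilon>(1) assms by simp
  ultimately show "\<exists>\<epsilon>>0. ball x \<epsilon> \<inter> S = {x}" using \<epsilon>(1) by blast
next
  assume "\<exists>\<epsilon>>0. ball x \<epsilon> \<inter> S = {x}"
  then show "x isolated_in S" unfolding isolated_in_def using assms open_ball by blast
qed

lemma enat_le_Sup_iff:
  assumes down: "\<And>m n. P m \<Longrightarrow> n \<le> m \<Longrightarrow> P n" and "P 0"
  shows "enat n \<le> Sup {enat m | m. P m} \<longleftrightarrow> P n"
proof
  assume le: "enat n \<le> Sup {enat m | m. P m}"
  show "P n"
  proof (rule ccontr)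
    assume "\<not> P n"
    then have n: "n > 0" using \<open>P 0\<close> by (cases n) auto
    have "m \<le> n - 1" if "P m" for m
      using down[OF that, of n] \<open>\<not> P n\<close> by (cases "n \<le> m") auto
    then have "Sup {enat m | m. P m} \<le> enat (n - 1)" by (intro Sup_least) auto
    with le have "enat n \<le> enat (n - 1)" by (rule order_trans)
    then show False using n by simp
  qed
qed (auto intro: Sup_upper)

locale l2_operator = self_adjoint_operator T "supported X"
  for T :: "pt ell2 \<Rightarrow> pt ell2" and X +
  fixes A :: op
  assumes T_csc: "T (csc c f) = csc c (T f)"
    and A_fun_of: "f \<in> supported X \<Longrightarrow> A (fun_of f) = fun_of (T f)"
begin

subsection \<open>The spectrum\<close>

definition T_minus :: "complex \<Rightarrow> pt ell2 \<Rightarrow> pt ell2" where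
  "T_minus z f = T f - csc z f"

lemma T_minus_supported: "f \<in> supported X \<Longrightarrow> T_minus z f \<in> supported X"
  unfolding T_minus_def by (intro subspace_diff subspace_H T_in_H csc_supported)

lemma fun_of_T_minus: "f \<in> supported X \<Longrightarrow> fun_of (T_minus z f) = (\<lambda>x. A (fun_of f) x - z * fun_of f x)"
  by (simp add: T_minus_def A_fun_of fun_eq_iff)

lemma bounded_linear_T_minus: "bounded_linear (T_minus z)"
  unfolding T_minus_def[abs_def]
  by (intro bounded_linear_sub bounded_linear_axioms bounded_linear_csc)

lemma T_minus_adjoint: "T_minus (cnj z) f \<bullet> g = f \<bullet> T_minus z g"
  by (simp add: T_minus_def inner_diff_left inner_diff_right symmetric inner_csc_left)

lemma T_minus_commute: "T_minus w (T_minus z f) = T_minus z (T_minus w f)"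
  by (simp add: T_minus_def diff T_csc csc.scale_right_diff_distrib mult.commute)

lemma T_minus_surj:
  assumes bounded_below: "bounded_below_on (supported X) (T_minus z)" and g: "g \<in> supported X"
  obtains f where "f \<in> supported X" "T_minus z f = g"
proof -
  let ?P = "\<lambda>f. T_minus (cnj z) (T_minus z f)"
  interpret P: self_adjoint_operator ?P "supported X"
  proof (intro self_adjoint_operator.intro symmetric_operator.intro symmetric_operator_axioms.intro
      self_adjoint_operator_axioms.intro)
    show "bounded_linear ?P"
      by (intro bounded_linear_compose[OF bounded_linear_T_minus bounded_linear_T_minus])
    show "?P f \<bullet> g = f \<bullet> ?P g" for f g
      using T_minus_adjoint[of z] T_minus_adjoint[of "cnj z"] by simp
  qed (simp_all add: subspace_H closed_H T_minus_supported)
  obtain \<delta> where \<delta>: "0 < \<delta>" "\<And>f. f \<in> supported X \<Longrightarrow> \<delta> * norm f \<le> norm (T_minus z f)"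
    using bounded_below unfolding bounded_below_on_def by blast
  have coercive: "\<delta>\<^sup>2 * (f \<bullet> f) \<le> ?P f \<bullet> f" if "f \<in> supported X" for f
  proof -
    have "(\<delta> * norm f)\<^sup>2 \<le> (norm (T_minus z f))\<^sup>2"
      using \<delta>(1) \<delta>(2)[OF that] by (intro power_mono) auto
    then show ?thesis by (simp add: T_minus_adjoint power_mult_distrib power2_norm_eq_inner)
  qed
  obtain u where "u \<in> supported X" "?P u = g"
    by (rule P.surj_of_coercive[OF _ coercive g]) (use \<delta>(1) in auto)
  then show ?thesis
    using that[of "T_minus (cnj z) u"] T_minus_supported T_minus_commute by simp
qed

lemma T_minus_inj:
  assumes "bounded_below_on (supported X) (T_minus z)"
  shows "inj_on (T_minus z) (supported X)"
proof -
  interpret L: bounded_linear "T_minus z" by (rule bounded_linear_T_minus)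
  have "f = 0" if "f \<in> supported X" "T_minus z f = 0" for f
    using assms that unfolding bounded_below_on_def by (auto simp: mult_le_0_iff)
  then show ?thesis by (simp add: linear_injective_on_subspace_0[OF L.linear_axioms subspace_H])
qed

lemma bounded_below_on_if_in_resolvent:
  assumes "in_resolvent X A z"
  shows "bounded_below_on (supported X) (T_minus z)"
proof -
  obtain B C where B: "\<And>f. f \<in> l2 X \<Longrightarrow> B (\<lambda>x. A f x - z * f x) = f"
    "\<And>g. g \<in> l2 X \<Longrightarrow> l2norm X (B g) \<le> C * l2norm X g"
    using assms unfolding in_resolvent_def by blast
  show "bounded_below_on (supported X) (T_minus z)"
  proof (rule bounded_below_onI[of "inverse (max C 1)"])
    fix f assume f: "f \<in> supported X"
    let ?g = "T_minus z f"
    have g: "?g \<in> supported X" using f by (rule T_minus_supported)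
    have "norm f = l2norm X (B (fun_of ?g))"
      using B(1)[of "fun_of f"] f by (simp add: fun_of_T_minus l2_eq_image_supported l2norm_fun_of)
    also have "\<dots> \<le> C * norm ?g"
      using B(2)[of "fun_of ?g"] g by (simp add: l2_eq_image_supported l2norm_fun_of)
    also have "\<dots> \<le> max C 1 * norm ?g" by (intro mult_right_mono) auto
    finally show "inverse (max C 1) * norm f \<le> norm ?g" by (simp add: field_simps)
  qed simp
qed

lemma in_resolvent_if_bounded_below_on:
  assumes bounded_below: "bounded_below_on (supported X) (T_minus z)"
  shows "in_resolvent X A z"
proof -
  obtain \<delta> where \<delta>: "0 < \<delta>" "\<And>f. f \<in> supported X \<Longrightarrow> \<delta> * norm f \<le> norm (T_minus z f)"
    using bounded_below unfolding bounded_below_on_def by blast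
  define R where "R = inv_into (supported X) (T_minus z)"
  have image: "T_minus z ` supported X = supported X"
    using T_minus_surj[OF bounded_below] T_minus_supported by blast
  have R: "R g \<in> supported X" "T_minus z (R g) = g" if "g \<in> supported X" for g
    using that image unfolding R_def by (auto intro: inv_into_into f_inv_into_f)
  have R_T: "R (T_minus z f) = f" if "f \<in> supported X" for f
    unfolding R_def using T_minus_inj[OF bounded_below] that by (rule inv_into_f_f)
  show "in_resolvent X A z"
    unfolding in_resolvent_def l2_eq_image_supported
  proof (intro exI[of _ "\<lambda>g. fun_of (R (ell2_of g))"] conjI ballI exI[of _ "inverse \<delta>"])
    fix f assume "f \<in> fun_of ` supported X"
    then obtain f' where f': "f = fun_of f'" "f' \<in> supported X" by blast
    have g: "(\<lambda>x. A f x - z * f x) = fun_of (T_minus z f')" by (simp add: f' fun_of_T_minus)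
    show "(\<lambda>x. A f x - z * f x) \<in> fun_of ` supported X"
      unfolding g using T_minus_supported f'(2) by blast
    show "fun_of (R (ell2_of (\<lambda>x. A f x - z * f x))) = f"
      unfolding g by (simp add: fun_of_inverse R_T f')
  next
    fix g assume "g \<in> fun_of ` supported X"
    then obtain g' where g': "g = fun_of g'" "g' \<in> supported X" by blast
    show "fun_of (R (ell2_of g)) \<in> fun_of ` supported X" by (simp add: g' fun_of_inverse R)
    show "(\<lambda>x. A (fun_of (R (ell2_of g))) x - z * fun_of (R (ell2_of g)) x) = g"
      using R[OF g'(2)] by (simp add: g'(1) fun_of_inverse flip: fun_of_T_minus)
    have "\<delta> * norm (R g') \<le> norm g'" using \<delta>(2)[OF R(1)[OF g'(2)]] R(2)[OF g'(2)] by simp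
    then show "l2norm X (fun_of (R (ell2_of g))) \<le> inverse \<delta> * l2norm X g"
      using R(1)[OF g'(2)] g'(2) \<delta>(1) by (simp add: g'(1) fun_of_inverse l2norm_fun_of field_simps)
  qed
qed

lemma in_resolvent_iff_bounded_below_on:
  "in_resolvent X A z \<longleftrightarrow> bounded_below_on (supported X) (T_minus z)"
  using bounded_below_on_if_in_resolvent in_resolvent_if_bounded_below_on by blast

lemma abs_Im_le_T_minus: "\<bar>Im z\<bar> * norm f \<le> norm (T_minus z f)"
proof (rule power2_le_imp_le)
  interpret S: symmetric_operator "\<lambda>f. T f - Re z *\<^sub>R f" "supported X"
    by (rule symmetric_operator_diff_scaleR)
  let ?a = "T f - Re z *\<^sub>R f" and ?b = "Im z *\<^sub>R csc \<i> f"
  have "?a \<bullet> csc \<i> f = f \<bullet> csc \<i> ?a"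
    by (simp add: S.symmetric T_csc csc_scaleR csc.scale_right_diff_distrib)
  also have "\<dots> = - (?a \<bullet> csc \<i> f)" using inner_csc_i_left[of f ?a] by (simp add: inner_commute)
  finally have orth: "?a \<bullet> csc \<i> f = 0" by simp
  have "T_minus z f = ?a - ?b" unfolding T_minus_def by (subst csc_Re_Im) simp
  then have "(norm (T_minus z f))\<^sup>2 = (norm ?a)\<^sup>2 + (norm ?b)\<^sup>2"
    using orth by (simp only: power2_norm_eq_inner inner_diff_left[of ?a] inner_diff_right[of _ ?a]
        inner_commute[of ?b ?a]) simp
  then show "(\<bar>Im z\<bar> * norm f)\<^sup>2 \<le> (norm (T_minus z f))\<^sup>2"
    by (simp add: norm_csc power_mult_distrib)
qed simp

lemma spectrum_eq: "spectrum X A = complex_of_real ` ap_spectrum"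
proof -
  have "T_minus (complex_of_real x) = (\<lambda>f. T f - x *\<^sub>R f)" for x
    by (simp add: T_minus_def fun_eq_iff)
  then have real: "complex_of_real x \<in> spectrum X A \<longleftrightarrow> x \<in> ap_spectrum" for x
    by (simp add: spectrum_def in_resolvent_iff_bounded_below_on ap_spectrum_def)
  have "z = complex_of_real (Re z)" if z: "z \<in> spectrum X A" for z
  proof (rule ccontr)
    assume "z \<noteq> complex_of_real (Re z)"
    then have "bounded_below_on (supported X) (T_minus z)"
      by (intro bounded_below_onI[of "\<bar>Im z\<bar>"] abs_Im_le_T_minus) (auto simp: complex_eq_iff)
    with z show False by (simp add: spectrum_def in_resolvent_iff_bounded_below_on)
  qed
  then have "z \<in> complex_of_real ` ap_spectrum" if "z \<in> spectrum X A" for z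
    using that real by (intro image_eqI[of z _ "Re z"]) force+
  with real show ?thesis by auto
qed

lemma inf_spec_le_form:
  assumes "f \<in> supported X"
  shows "inf_spec X A * (f \<bullet> f) \<le> T f \<bullet> f"
proof (cases "f = 0")
  case False
  have "inf_spec X A = Inf ap_spectrum"
    unfolding inf_spec_def spectrum_eq by (auto intro: arg_cong[where f = Inf])
  also have "\<dots> \<le> rayleigh_inf"
    using rayleigh_inf_in_ap_spectrum[OF assms False] abs_ap_spectrum_le_onorm
    by (intro cInf_lower bdd_belowI[of _ "- onorm T"]) (auto simp: abs_le_iff minus_le_iff)
  finally have "inf_spec X A * (f \<bullet> f) \<le> rayleigh_inf * (f \<bullet> f)" by (intro mult_right_mono) auto
  then show ?thesis using rayleigh_inf_le[OF assms] by linarith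
qed (simp add: zero)

subsection \<open>Counting eigenvalues\<close>

text \<open>The eigenspaces are complex, so a complex dimension \<open>n\<close> is a real dimension \<open>2 n\<close>.\<close>

lemma eigen_dim_ge_if_eigenlists:
  assumes fs: "lin_indep fs" "length fs = n"
    and eigen: "\<And>i. i < n \<Longrightarrow> fs ! i \<in> l2 X"
      "\<And>i. i < n \<Longrightarrow> A (fs ! i) = (\<lambda>x. complex_of_real (l i) * (fs ! i) x)" "\<And>i. i < n \<Longrightarrow> R (l i)"
  shows "eigen_dim_ge R (2 * n)"
proof -
  define gs where "gs = map ell2_of fs"
  have gs: "gs ! i \<in> supported X" "fun_of (gs ! i) = fs ! i" if "i < n" for i
    using eigen(1)[OF that] that fs(2) by (auto simp: gs_def l2_eq_image_supported fun_of_inverse)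
  have fs_gs: "fs = map fun_of gs" using gs(2) fs(2) by (intro nth_equalityI) (auto simp: gs_def)
  have T_gs: "T (gs ! i) = l i *\<^sub>R gs ! i" if "i < n" for i
    using A_fun_of[OF gs(1)[OF that]] eigen(2)[OF that] gs(2)[OF that]
    by (intro ell2_eqI) (simp add: fun_eq_iff)
  define B where "B = set gs \<union> csc \<i> ` set gs"
  have "csc.independent (set gs)" using fs(1) unfolding fs_gs by (rule csc_independent_if_lin_indep)
  then have "independent B" "card B = 2 * card (set gs)"
    unfolding B_def by (intro complex_independent_Un_csc_i; simp)+
  moreover have "card (set gs) = n"
    using distinct_if_lin_indep fs distinct_card[of gs] unfolding fs_gs by (simp add: gs_def)
  moreover have "\<exists>l. T b = l *\<^sub>R b \<and> R l" "b \<in> supported X" if "b \<in> B" for b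
  proof -
    obtain i where i: "i < n" "b = gs ! i \<or> b = csc \<i> (gs ! i)"
      using \<open>b \<in> B\<close> fs(2) by (auto simp: B_def in_set_conv_nth gs_def)
    then have "T b = l i *\<^sub>R b" using T_gs by (auto simp: T_csc csc_scaleR)
    then show "\<exists>l. T b = l *\<^sub>R b \<and> R l" using eigen(3) i(1) by blast
    show "b \<in> supported X" using i gs(1) csc_supported by auto
  qed
  ultimately show ?thesis using eigen_dim_geI[of B R] by (simp add: B_def subset_iff)
qed

lemma eigenlists_if_eigen_dim_ge:
  assumes "eigen_dim_ge R (2 * n)"
  obtains fs l where "lin_indep fs" "length fs = n"
    "\<And>i. i < n \<Longrightarrow> fs ! i \<in> l2 X \<and> A (fs ! i) = (\<lambda>x. complex_of_real (l i) * (fs ! i) x) \<and> R (l i)"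
proof -
  obtain B where B: "finite B" "independent B" "card B = 2 * n" "B \<subseteq> supported X"
    "\<forall>b\<in>B. \<exists>l. T b = l *\<^sub>R b \<and> R l"
    using assms by (rule eigen_dim_geE)
  obtain l where l: "\<And>b. b \<in> B \<Longrightarrow> T b = l b *\<^sub>R b \<and> R (l b)" using B(5) by metis
  obtain C where C: "C \<subseteq> B" "csc.independent C" "card B \<le> 2 * card C"
    using B(1,2) by (rule complex_independent_subset)
  then obtain C' where C': "C' \<subseteq> C" "card C' = n"
    using B(3) obtain_subset_with_card_n[of n C] by auto
  have "finite C'" using C(1) C'(1) B(1) by (meson finite_subset)
  then obtain gs where gs: "set gs = C'" "distinct gs" using finite_distinct_list by blast
  show ?thesis
  proof (rule that[of "map fun_of gs" "\<lambda>i. l (gs ! i)"])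
    show "length (map fun_of gs) = n" using distinct_card[OF gs(2)] gs(1) C'(2) by simp
    show "lin_indep (map fun_of gs)"
      using gs C(2) C'(1) csc.independent_mono by (intro lin_indep_if_csc_independent) auto
    fix i assume "i < n"
    then have i: "i < length gs" using distinct_card[OF gs(2)] gs(1) C'(2) by simp
    then have "gs ! i \<in> B" using gs(1) C(1) C'(1) nth_mem by blast
    moreover from this have "gs ! i \<in> supported X" using B(4) by blast
    ultimately show "map fun_of gs ! i \<in> l2 X \<and> A (map fun_of gs ! i) =
        (\<lambda>x. complex_of_real (l (gs ! i)) * (map fun_of gs ! i) x) \<and> R (l (gs ! i))"
      using i l[of "gs ! i"] by (auto simp: l2_eq_image_supported A_fun_of)
  qed
qed

lemma ex_eigenlists_iff:
  "(\<exists>fs ls. length fs = n \<and> length ls = n \<and> lin_indep fs \<and>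
      (\<forall>i<n. fs ! i \<in> l2 X \<and> A (fs ! i) = (\<lambda>x. complex_of_real (ls ! i) * (fs ! i) x) \<and> R (ls ! i)))
    \<longleftrightarrow> eigen_dim_ge R (2 * n)" (is "?lists \<longleftrightarrow> _")
proof
  assume ?lists
  then show "eigen_dim_ge R (2 * n)" by (elim exE conjE) (rule eigen_dim_ge_if_eigenlists, auto)
next
  assume "eigen_dim_ge R (2 * n)"
  then show ?lists
  proof (rule eigenlists_if_eigen_dim_ge)
    fix fs l
    assume "lin_indep fs" "length fs = n"
      "\<And>i. i < n \<Longrightarrow> fs ! i \<in> l2 X \<and> A (fs ! i) = (\<lambda>x. complex_of_real (l i) * (fs ! i) x) \<and> R (l i)"
    then show ?lists by (intro exI[of _ fs] exI[of _ "map l [0..<n]"]) auto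
  qed
qed

lemma enat_le_Sup_eigen_dim_iff:
  "enat j \<le> Sup {enat n | n. eigen_dim_ge R (2 * n)} \<longleftrightarrow> eigen_dim_ge R (2 * j)"
  by (rule enat_le_Sup_iff) (auto intro: eigen_dim_ge_antimono simp: eigen_dim_ge_0)

lemma count_below_iff: "enat j \<le> count_below X A t \<longleftrightarrow> eigen_dim_ge (\<lambda>l. l \<le> t) (2 * j)"
  unfolding count_below_def ex_eigenlists_iff[where R="\<lambda>l. l \<le> t"]
  by (rule enat_le_Sup_eigen_dim_iff)

lemma count_fin_iff:
  "enat j \<le> count_fin X A t \<longleftrightarrow> eigen_dim_ge (\<lambda>l. mult X A (complex_of_real l) < \<infinity> \<and> l \<le> t) (2 * j)"
  unfolding count_fin_def ex_eigenlists_iff[where R="\<lambda>l. mult X A (complex_of_real l) < \<infinity> \<and> l \<le> t"]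
  by (rule enat_le_Sup_eigen_dim_iff)

lemma num_fin_iff:
  "enat j \<le> num_fin X A \<longleftrightarrow> eigen_dim_ge (\<lambda>l. mult X A (complex_of_real l) < \<infinity>) (2 * j)"
  unfolding num_fin_def ex_eigenlists_iff[where R="\<lambda>l. mult X A (complex_of_real l) < \<infinity>"]
  by (rule enat_le_Sup_eigen_dim_iff)

lemma mult_iff: "enat j \<le> mult X A (complex_of_real z) \<longleftrightarrow> eigen_dim_ge (\<lambda>l. l = z) (2 * j)"
proof -
  have "(\<exists>fs. length fs = n \<and> lin_indep fs \<and>
      (\<forall>f\<in>set fs. f \<in> l2 X \<and> A f = (\<lambda>x. complex_of_real z * f x)))
    \<longleftrightarrow> eigen_dim_ge (\<lambda>l. l = z) (2 * n)" (is "?list \<longleftrightarrow> _") for n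
  proof
    assume ?list
    then obtain fs where "lin_indep fs" "length fs = n"
      "\<forall>f\<in>set fs. f \<in> l2 X \<and> A f = (\<lambda>x. complex_of_real z * f x)" by blast
    then show "eigen_dim_ge (\<lambda>l. l = z) (2 * n)"
      by (intro eigen_dim_ge_if_eigenlists[of fs n "\<lambda>_. z"]) auto
  next
    assume "eigen_dim_ge (\<lambda>l. l = z) (2 * n)"
    then show ?list
    proof (rule eigenlists_if_eigen_dim_ge)
      fix fs l
      assume "lin_indep fs" "length fs = n"
        "\<And>i. i < n \<Longrightarrow> fs ! i \<in> l2 X \<and> A (fs ! i) = (\<lambda>x. complex_of_real (l i) * (fs ! i) x) \<and> l i = z"
      then show ?list by (intro exI[of _ fs]) (auto simp: in_set_conv_nth)
    qed
  qed
  then show ?thesis unfolding mult_def by (simp only: enat_le_Sup_eigen_dim_iff)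
qed

lemma eigen_dim_ge_double:
  assumes "eigen_dim_ge (\<lambda>l. l = z) 1"
  shows "eigen_dim_ge (\<lambda>l. l = z) 2"
proof -
  obtain B where B: "finite B" "independent B" "card B = 1" "B \<subseteq> supported X"
    "\<forall>b\<in>B. \<exists>l. T b = l *\<^sub>R b \<and> l = z"
    using assms by (rule eigen_dim_geE)
  obtain b where b: "B = {b}" using B(3) card_1_singletonE by blast
  have "b \<noteq> 0" using b B(2) dependent_zero by blast
  then have "csc.independent {b}" by simp
  define C where "C = {b} \<union> csc \<i> ` {b}"
  have C: "finite C" "independent C" "card C = 2"
    using complex_independent_Un_csc_i[of "{b}"] \<open>csc.independent {b}\<close> by (simp_all add: C_def)
  have C_eigen: "T c = z *\<^sub>R c" "c \<in> supported X" if "c \<in> C" for c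
    using that b B(4,5) by (auto simp: C_def T_csc csc_scaleR csc_supported)
  have "eigen_dim_ge (\<lambda>l. l = z) (card C)"
    by (rule eigen_dim_geI[OF C(1,2)]) (use C_eigen in auto)
  then show ?thesis by (simp only: C(3))
qed

lemma mult_pos_iff: "0 < mult X A (complex_of_real z) \<longleftrightarrow> eigen_dim_ge (\<lambda>l. l = z) 1"
proof -
  have "0 < mult X A (complex_of_real z) \<longleftrightarrow> enat 1 \<le> mult X A (complex_of_real z)"
    by (simp add: Suc_ile_eq zero_enat_def)
  also have "\<dots> \<longleftrightarrow> eigen_dim_ge (\<lambda>l. l = z) 2" by (simp add: mult_iff del: One_nat_def)
  also have "\<dots> \<longleftrightarrow> eigen_dim_ge (\<lambda>l. l = z) 1" using eigen_dim_ge_double eigen_dim_ge_antimono by auto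
  finally show ?thesis .
qed

lemma mult_finite_iff:
  "mult X A (complex_of_real z) < \<infinity> \<longleftrightarrow> (\<exists>n. \<not> eigen_dim_ge (\<lambda>l. l = z) n)"
proof
  assume "mult X A (complex_of_real z) < \<infinity>"
  then obtain n where "mult X A (complex_of_real z) = enat n" by auto
  then have "\<not> enat (Suc n) \<le> mult X A (complex_of_real z)" by simp
  then show "\<exists>n. \<not> eigen_dim_ge (\<lambda>l. l = z) n" unfolding mult_iff by blast
next
  assume "\<exists>n. \<not> eigen_dim_ge (\<lambda>l. l = z) n"
  then obtain n where "\<not> eigen_dim_ge (\<lambda>l. l = z) n" by blast
  then have "\<not> eigen_dim_ge (\<lambda>l. l = z) (2 * n)" using eigen_dim_ge_antimono[of _ "2 * n" n] by auto
  then have "\<not> enat n \<le> mult X A (complex_of_real z)" by (simp only: mult_iff not_False_eq_True)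
  then show "mult X A (complex_of_real z) < \<infinity>" by (auto simp: not_le dest: enat_iless)
qed

lemma ess_spectrum_eq: "ess_spectrum X A = complex_of_real ` essential_spectrum"
proof -
  have isolated: "(\<exists>\<epsilon>>0. ball (complex_of_real x) \<epsilon> \<inter> spectrum X A = {complex_of_real x}) \<longleftrightarrow>
      x isolated_in ap_spectrum" if "x \<in> ap_spectrum" for x
  proof -
    have "ball (complex_of_real x) \<epsilon> \<inter> spectrum X A = complex_of_real ` (ball x \<epsilon> \<inter> ap_spectrum)" for \<epsilon>
      by (auto simp: spectrum_eq dist_of_real)
    then have "ball (complex_of_real x) \<epsilon> \<inter> spectrum X A = {complex_of_real x} \<longleftrightarrow>
        ball x \<epsilon> \<inter> ap_spectrum = {x}" for \<epsilon>
      using inj_image_eq_iff[OF inj_of_real, of "ball x \<epsilon> \<inter> ap_spectrum" "{x}"] by simp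
    then show ?thesis using isolated_in_iff_ball[OF that] by simp
  qed
  have "complex_of_real x \<in> disc_spectrum X A \<longleftrightarrow> x \<in> discrete_spectrum" for x
    using isolated[of x] mult_pos_iff[of x] mult_finite_iff[of x]
    by (auto simp: disc_spectrum_def discrete_spectrum_def spectrum_eq isolated_in_islimpt_iff)
  then show ?thesis by (auto simp: ess_spectrum_def essential_spectrum_def spectrum_eq)
qed

subsection \<open>The min-max principle for the counting functions\<close>

lemma inf_ess_eq: "inf_ess X A = Inf essential_spectrum"
  unfolding inf_ess_def ess_spectrum_eq by (auto intro: arg_cong[where f = Inf])

lemma inf_ess_le: "z \<in> essential_spectrum \<Longrightarrow> inf_ess X A \<le> z"
  unfolding inf_ess_eq using abs_ap_spectrum_le_onorm
  by (intro cInf_lower bdd_belowI[of _ "- onorm T"])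
    (auto simp: essential_spectrum_def abs_le_iff minus_le_iff)

lemma neg_onorm_le_if_eigen_dim_ge:
  assumes "eigen_dim_ge R n" "1 \<le> n" "\<And>l. R l \<Longrightarrow> l \<le> t"
  shows "- onorm T \<le> t"
proof -
  obtain l where "l \<in> ap_spectrum" "R l" using assms(1,2) by (rule eigenvalue_of_eigen_dim_ge)
  then show ?thesis using abs_ap_spectrum_le_onorm[of l] assms(3)[of l] by linarith
qed

lemma mu_le_if_negative_index_ge:
  assumes index: "negative_index_ge s (2 * j)" and j: "1 \<le> j"
  shows "mu X A j \<le> s"
proof -
  let ?M = "{t. t < inf_ess X A \<and> enat j \<le> count_below X A t} \<union> {inf_ess X A}"
  have "- onorm T \<le> t" if "enat j \<le> count_below X A t" for t
    using neg_onorm_le_if_eigen_dim_ge[of "\<lambda>l. l \<le> t" "2 * j" t] that j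
    by (simp add: count_below_iff)
  then have bdd: "bdd_below ?M"
    by (intro bdd_belowI[of _ "min (- onorm T) (inf_ess X A)"]) (auto simp: min_le_iff_disj)
  show ?thesis
  proof (cases "inf_ess X A \<le> s")
    case True
    have "mu X A j \<le> inf_ess X A" unfolding mu_def using bdd by (intro cInf_lower) auto
    with True show ?thesis by simp
  next
    case False
    then have above: "s \<le> z" if "z \<in> essential_spectrum" for z using inf_ess_le[OF that] by linarith
    have "eigen_dim_ge (\<lambda>l. l \<le> s) (2 * j)"
      by (rule eigen_dim_ge_mono[OF eigen_dim_ge_if_negative_index_ge[OF index above]]) auto
    then show ?thesis
      unfolding mu_def using False bdd by (intro cInf_lower) (auto simp: count_below_iff)
  qed
qed

lemma mu_eq_minmax:
  assumes X: "infinite X" and j: "1 \<le> j"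
  shows "mu X A j = minmax (2 * j)"
proof (rule antisym)
  have dim: "infinite_dimensional (supported X)" using X by (rule infinite_dimensional_supported)
  show "mu X A j \<le> minmax (2 * j)"
  proof (rule dense_ge)
    fix s assume "minmax (2 * j) < s"
    then have "negative_index_ge s (2 * j)" by (rule negative_index_ge_if_minmax_less[OF dim])
    then show "mu X A j \<le> s" using j by (rule mu_le_if_negative_index_ge)
  qed
  show "minmax (2 * j) \<le> mu X A j"
    unfolding mu_def
  proof (rule cInf_greatest)
    fix t assume "t \<in> {t. t < inf_ess X A \<and> enat j \<le> count_below X A t} \<union> {inf_ess X A}"
    then consider "eigen_dim_ge (\<lambda>l. l \<le> t) (2 * j)" | "t = inf_ess X A"
      by (auto simp: count_below_iff)
    then have "negative_index_ge s (2 * j)" if less: "t < s" for s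
    proof cases
      case 1
      then have "eigen_dim_ge (\<lambda>l. l < s) (2 * j)" by (rule eigen_dim_ge_mono) (use less in simp)
      then show ?thesis by (rule negative_index_ge_if_eigen_dim_ge)
    next
      case 2
      then obtain z where "z \<in> essential_spectrum" "z < s"
        using cInf_lessD[OF essential_spectrum_nonempty[OF dim], of s] less
        by (auto simp: inf_ess_eq)
      then show ?thesis by (rule negative_index_ge_if_essential)
    qed
    then show "minmax (2 * j) \<le> t" using j by (simp add: dense_ge minmax_le)
  qed simp
qed

lemma minmax_le_lam:
  assumes j: "1 \<le> j" "enat j \<le> num_fin X A"
  shows "minmax (2 * j) \<le> lam X A j"
  unfolding lam_def
proof (rule cInf_greatest)
  let ?R = "\<lambda>l. mult X A (complex_of_real l) < \<infinity>"
  obtain B where B: "finite B" "independent B" "card B = 2 * j" "B \<subseteq> supported X"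
    "\<forall>b\<in>B. \<exists>l. T b = l *\<^sub>R b \<and> ?R l"
    using j(2) unfolding num_fin_iff by (rule eigen_dim_geE)
  obtain l where l: "\<And>b. b \<in> B \<Longrightarrow> T b = l b *\<^sub>R b \<and> ?R (l b)" using B(5) by metis
  have "l b \<le> Max (l ` B)" if "b \<in> B" for b using that B(1) by simp
  then have "eigen_dim_ge (\<lambda>l'. ?R l' \<and> l' \<le> Max (l ` B)) (card B)"
    using l by (intro eigen_dim_geI B(1,2,4)) blast
  then show "{t. enat j \<le> count_fin X A t} \<noteq> {}" unfolding B(3) by (auto simp: count_fin_iff)
next
  fix t assume "t \<in> {t. enat j \<le> count_fin X A t}"
  then have "eigen_dim_ge (\<lambda>l. mult X A (complex_of_real l) < \<infinity> \<and> l \<le> t) (2 * j)"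
    by (simp add: count_fin_iff)
  then have "negative_index_ge s (2 * j)" if "t < s" for s
    by (intro negative_index_ge_if_eigen_dim_ge, elim eigen_dim_ge_mono) (use that in simp)
  then show "minmax (2 * j) \<le> t" using j by (simp add: dense_ge minmax_le)
qed

lemma lam_le_if_negative_index_ge:
  assumes index: "negative_index_ge s (2 * j)" and j: "1 \<le> j"
    and above: "\<And>z. z \<in> essential_spectrum \<Longrightarrow> s \<le> z"
  shows "lam X A j \<le> s"
proof -
  let ?R = "\<lambda>t l. mult X A (complex_of_real l) < \<infinity> \<and> l \<le> t"
  have "eigen_dim_ge (\<lambda>l. l < s) (2 * j)"
    using index above by (rule eigen_dim_ge_if_negative_index_ge)
  then obtain B where B: "finite B" "independent B" "card B = 2 * j" "B \<subseteq> supported X"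
    "\<forall>b\<in>B. \<exists>l. T b = l *\<^sub>R b \<and> l < s"
    by (rule eigen_dim_geE)
  have "\<exists>l. T b = l *\<^sub>R b \<and> ?R s l" if b: "b \<in> B" for b
  proof -
    obtain l where l: "T b = l *\<^sub>R b" "l < s" using B(5) b by blast
    have "b \<noteq> 0" using b B(2) dependent_zero by blast
    then have "l \<in> ap_spectrum" using eigenvalue_in_ap_spectrum l(1) b B(4) by blast
    then have "l \<in> discrete_spectrum" using above[of l] l(2) by (auto simp: essential_spectrum_def)
    then have "mult X A (complex_of_real l) < \<infinity>"
      unfolding discrete_spectrum_def mult_finite_iff by blast
    then show ?thesis using l by (intro exI[of _ l]) simp
  qed
  then have "eigen_dim_ge (?R s) (card B)" by (intro eigen_dim_geI B(1,2,4))
  then have "enat j \<le> count_fin X A s" by (simp only: B(3) count_fin_iff)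
  moreover have "- onorm T \<le> t" if "enat j \<le> count_fin X A t" for t
    using neg_onorm_le_if_eigen_dim_ge[of "?R t" "2 * j" t] that j by (simp add: count_fin_iff)
  ultimately show ?thesis
    unfolding lam_def by (intro cInf_lower bdd_belowI[of _ "- onorm T"]) auto
qed

lemma lam_le_minmax:
  assumes "infinite X" "1 \<le> j" "minmax (2 * j) < t" "\<And>z. z \<in> essential_spectrum \<Longrightarrow> t \<le> z"
  shows "lam X A j \<le> minmax (2 * j)"
proof (rule dense_ge_bounded[OF assms(3)])
  fix s assume s: "minmax (2 * j) < s" "s < t"
  have "negative_index_ge s (2 * j)"
    using infinite_dimensional_supported[OF assms(1)] s(1)
    by (rule negative_index_ge_if_minmax_less)
  then show "lam X A j \<le> s" using assms(2,4) s(2) by (intro lam_le_if_negative_index_ge) force+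
qed

end

section \<open>Magnetic Schroedinger operators on graphs of bounded degree\<close>

locale magnetic_graph =
  fixes X :: "'v set" and E :: "'e set" and s b :: "'e \<Rightarrow> 'v" and \<kappa> :: "'e \<Rightarrow> complex"
    and \<sigma> :: "'e \<Rightarrow> 'e" and D :: nat
  assumes s_in: "e \<in> E \<Longrightarrow> s e \<in> X"
    and bij_\<sigma>: "bij_betw \<sigma> E E"
    and s_\<sigma>: "e \<in> E \<Longrightarrow> s (\<sigma> e) = b e"
    and b_\<sigma>: "e \<in> E \<Longrightarrow> b (\<sigma> e) = s e"
    and \<kappa>_\<sigma>: "e \<in> E \<Longrightarrow> \<kappa> (\<sigma> e) = cnj (\<kappa> e)"
    and cmod_\<kappa>: "e \<in> E \<Longrightarrow> cmod (\<kappa> e) = 1"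
    and finite_out: "finite {e \<in> E. s e = v}"
    and card_out_le: "card {e \<in> E. s e = v} \<le> D"
begin

abbreviation out :: "'v \<Rightarrow> 'e set" where "out v \<equiv> {e \<in> E. s e = v}"

abbreviation pullback_source :: "'v ell2 \<Rightarrow> 'e ell2" where
  "pullback_source \<equiv> weighted_comp E (\<lambda>_. 1) s"

abbreviation pullback_target :: "'v ell2 \<Rightarrow> 'e ell2" where
  "pullback_target \<equiv> weighted_comp E \<kappa> b"

sublocale source: weighted_composition E "\<lambda>_. 1" s 1 D
  by unfold_locales (simp_all add: finite_out card_out_le)

sublocale target: weighted_composition E \<kappa> b 1 D
proof
  fix v
  have inj: "inj_on \<sigma> {e \<in> E. b e = v}" using bij_\<sigma> by (auto simp: bij_betw_def inj_on_def)
  have image: "\<sigma> ` {e \<in> E. b e = v} \<subseteq> out v" using bij_\<sigma> s_\<sigma> by (auto simp: bij_betw_def)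
  show "finite {e \<in> E. b e = v}" using inj image finite_out by (rule inj_on_finite)
  show "card {e \<in> E. b e = v} \<le> D"
    using card_inj_on_le[OF inj image finite_out] card_out_le[of v] by linarith
qed (simp_all add: cmod_\<kappa>)

lemma out_empty: "v \<notin> X \<Longrightarrow> out v = {}"
  using s_in by auto

definition divergence :: "'e ell2 \<Rightarrow> 'v ell2" where
  "divergence g = ell2_of (\<lambda>v. \<Sum>e\<in>out v. fun_of g e)"

lemma divergence_sum_le:
  assumes "finite A"
  shows "(\<Sum>v\<in>A. (cmod (\<Sum>e\<in>out v. fun_of g e))\<^sup>2) \<le> (sqrt D * norm g)\<^sup>2"
proof -
  have "(cmod (\<Sum>e\<in>out v. fun_of g e))\<^sup>2 \<le> D * (\<Sum>e\<in>out v. (cmod (fun_of g e))\<^sup>2)" for v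
  proof -
    have "(cmod (\<Sum>e\<in>out v. fun_of g e))\<^sup>2 \<le> (\<Sum>e\<in>out v. cmod (fun_of g e))\<^sup>2"
      by (intro power_mono norm_sum) auto
    also have "\<dots> \<le> (\<Sum>e\<in>out v. (cmod (fun_of g e))\<^sup>2) * card (out v)"
      by (rule sum_squared_le_sum_of_squares)
    also have "\<dots> \<le> (\<Sum>e\<in>out v. (cmod (fun_of g e))\<^sup>2) * D"
      using card_out_le by (intro mult_left_mono sum_nonneg) auto
    finally show ?thesis by (simp add: mult.commute)
  qed
  then have "(\<Sum>v\<in>A. (cmod (\<Sum>e\<in>out v. fun_of g e))\<^sup>2) \<le> (\<Sum>v\<in>A. D * (\<Sum>e\<in>out v. (cmod (fun_of g e))\<^sup>2))"
    by (rule sum_mono)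
  also have "\<dots> = D * (\<Sum>e\<in>(\<Union>v\<in>A. out v). (cmod (fun_of g e))\<^sup>2)"
    using assms finite_out by (subst sum.UNION_disjoint) (auto simp: sum_distrib_left)
  also have "\<dots> \<le> D * (norm g)\<^sup>2"
    using assms finite_out by (intro mult_left_mono finite_sum_le_norm_ell2_sq) auto
  finally show ?thesis by (simp add: power_mult_distrib)
qed

lemma fun_of_divergence: "fun_of (divergence g) v = (\<Sum>e\<in>out v. fun_of g e)"
  unfolding divergence_def by (subst fun_of_ell2_of_bounded(1)[OF divergence_sum_le]) simp_all

lemma bounded_linear_divergence: "bounded_linear divergence"
proof (rule bounded_linear_intro)
  show "norm (divergence g) \<le> norm g * sqrt D" for g
    unfolding divergence_def
    by (subst mult.commute, rule fun_of_ell2_of_bounded(2)[OF divergence_sum_le]) simp_all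
qed (rule ell2_eqI, simp add: fun_of_divergence sum.distrib sum_distrib_left)+

lemma divergence_csc: "divergence (csc c g) = csc c (divergence g)"
  by (rule ell2_eqI) (simp add: fun_of_divergence sum_distrib_left)

lemma infsum_out:
  fixes F :: "'e \<Rightarrow> real"
  assumes "F summable_on E"
  shows "(\<Sum>\<^sub>\<infinity>v. \<Sum>e\<in>out v. F e) = (\<Sum>\<^sub>\<infinity>e\<in>E. F e)"
proof -
  have bij: "bij_betw snd (Sigma UNIV out) E"
    by (rule bij_betwI[where g="\<lambda>e. (s e, e)"]) auto
  have "(\<lambda>p. F (snd p)) summable_on (Sigma UNIV out)"
    using assms summable_on_reindex_bij_betw[OF bij, of F] by simp
  then have summable: "(\<lambda>(v, e). F e) summable_on (Sigma UNIV out)" by (simp only: case_prod_beta')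
  have "(\<Sum>\<^sub>\<infinity>v. \<Sum>e\<in>out v. F e) = (\<Sum>\<^sub>\<infinity>v. \<Sum>\<^sub>\<infinity>e\<in>out v. F e)" using finite_out by simp
  also have "\<dots> = infsum (\<lambda>(v, e). F e) (Sigma UNIV out)" by (rule infsum_Sigma'_banach[OF summable])
  also have "\<dots> = infsum (\<lambda>p. F (snd p)) (Sigma UNIV out)" by (simp only: case_prod_beta')
  also have "\<dots> = (\<Sum>\<^sub>\<infinity>e\<in>E. F e)" by (rule infsum_reindex_bij_betw[OF bij])
  finally show ?thesis .
qed

lemma divergence_adjoint: "divergence g \<bullet> f = g \<bullet> pullback_source f"
proof -
  let ?F = "\<lambda>e. fun_of g e \<bullet> fun_of (pullback_source f) e"
  have "divergence g \<bullet> f = (\<Sum>\<^sub>\<infinity>v. \<Sum>e\<in>out v. ?F e)"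
    unfolding inner_ell2_def fun_of_divergence inner_sum_left
    by (intro infsum_cong sum.cong) (auto simp: source.fun_of_weighted_comp)
  also have "\<dots> = (\<Sum>\<^sub>\<infinity>e\<in>E. ?F e)"
    by (intro infsum_out summable_on_subset[OF fun_of_inner_summable]) simp
  also have "\<dots> = g \<bullet> pullback_source f"
    by (rule inner_supported[OF source.weighted_comp_supported, symmetric])
  finally show ?thesis .
qed

definition grad :: "'v ell2 \<Rightarrow> 'e ell2" where
  "grad f = pullback_source f - pullback_target f"

lemma fun_of_grad: "fun_of (grad f) e = (if e \<in> E then fun_of f (s e) - \<kappa> e * fun_of f (b e) else 0)"
  by (simp add: grad_def source.fun_of_weighted_comp target.fun_of_weighted_comp)

lemma norm_grad_le: "norm (grad f) \<le> 2 * sqrt D * norm f"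
  using norm_triangle_ineq4[of "pullback_source f" "pullback_target f"]
    source.norm_weighted_comp_le[of f] target.norm_weighted_comp_le[of f]
  by (simp add: grad_def)

lemma grad_inner_target: "grad f \<bullet> pullback_target g = - (grad f \<bullet> pullback_source g)"
proof -
  have "grad f \<bullet> pullback_source g = (\<Sum>\<^sub>\<infinity>e\<in>E. fun_of (grad f) (\<sigma> e) \<bullet> fun_of (pullback_source g) (\<sigma> e))"
    unfolding inner_supported[OF source.weighted_comp_supported]
    by (rule infsum_reindex_bij_betw[OF bij_\<sigma>, symmetric])
  also have "\<dots> = (\<Sum>\<^sub>\<infinity>e\<in>E. - (fun_of (grad f) e \<bullet> fun_of (pullback_target g) e))"
  proof (rule infsum_cong)
    fix e assume e: "e \<in> E"
    have "\<sigma> e \<in> E" using bij_\<sigma> e by (auto simp: bij_betw_def)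
    have "cnj (\<kappa> e) * \<kappa> e = 1"
      using cmod_\<kappa>[OF e] complex_norm_square[of "\<kappa> e"] by (simp add: mult.commute)
    then have "fun_of (grad f) (\<sigma> e) = - (cnj (\<kappa> e) * fun_of (grad f) e)"
      using e \<open>\<sigma> e \<in> E\<close> by (simp add: fun_of_grad s_\<sigma> b_\<sigma> \<kappa>_\<sigma> algebra_simps flip: mult.assoc)
    then show "fun_of (grad f) (\<sigma> e) \<bullet> fun_of (pullback_source g) (\<sigma> e)
        = - (fun_of (grad f) e \<bullet> fun_of (pullback_target g) e)"
      using e \<open>\<sigma> e \<in> E\<close>
      by (simp add: source.fun_of_weighted_comp target.fun_of_weighted_comp s_\<sigma> inner_complex_def algebra_simps)
  qed
  also have "\<dots> = - (grad f \<bullet> pullback_target g)"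
    by (simp add: inner_supported[OF target.weighted_comp_supported] infsum_uminus)
  finally show ?thesis by simp
qed

definition laplacian :: "'v ell2 \<Rightarrow> 'v ell2" where
  "laplacian f = divergence (grad f)"

lemma fun_of_laplacian: "fun_of (laplacian f) v = (\<Sum>e\<in>out v. fun_of f v - \<kappa> e * fun_of f (b e))"
  unfolding laplacian_def fun_of_divergence by (intro sum.cong) (auto simp: fun_of_grad)

lemma laplacian_inner: "laplacian f \<bullet> g = (grad f \<bullet> grad g) / 2"
  using grad_inner_target[of f g]
  by (simp add: laplacian_def divergence_adjoint grad_def[of g] inner_diff_right)

lemma bounded_linear_laplacian: "bounded_linear laplacian"
  unfolding laplacian_def[abs_def] grad_def
  by (intro bounded_linear_compose[OF bounded_linear_divergence] bounded_linear_sub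
      source.bounded_linear_weighted_comp target.bounded_linear_weighted_comp)

lemma laplacian_csc: "laplacian (csc c f) = csc c (laplacian f)"
  by (simp add: laplacian_def grad_def source.weighted_comp_csc target.weighted_comp_csc divergence_csc
      flip: csc.scale_right_diff_distrib)

lemma laplacian_nonneg: "0 \<le> laplacian f \<bullet> f"
  by (simp add: laplacian_inner)

lemma laplacian_le: "laplacian f \<bullet> f \<le> 2 * real D * (f \<bullet> f)"
proof -
  have "(norm (grad f))\<^sup>2 \<le> (2 * sqrt D * norm f)\<^sup>2" by (intro power_mono norm_grad_le) simp
  then show ?thesis by (simp add: laplacian_inner power_mult_distrib power2_norm_eq_inner)
qed

end

locale schroedinger = magnetic_graph X E s b \<kappa> \<sigma> D
  for X :: "'v set" and E :: "'e set" and s b \<kappa> \<sigma> D +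
  fixes U :: "'v \<Rightarrow> real" and C :: real
  assumes abs_U_le: "\<bar>U v\<bar> \<le> C" and U_outside: "v \<notin> X \<Longrightarrow> U v = 0"
begin

sublocale potential: weighted_composition UNIV "\<lambda>v. complex_of_real (U v)" "\<lambda>v. v" C 1
proof
  show "0 \<le> C" using abs_U_le[of undefined] by linarith
qed (simp_all add: abs_U_le)

definition ham :: "'v ell2 \<Rightarrow> 'v ell2" where
  "ham f = laplacian f + weighted_comp UNIV (\<lambda>v. complex_of_real (U v)) (\<lambda>v. v) f"

lemma fun_of_ham:
  "fun_of (ham f) v = (\<Sum>e\<in>out v. fun_of f v - \<kappa> e * fun_of f (b e)) + complex_of_real (U v) * fun_of f v"
  by (simp add: ham_def fun_of_laplacian potential.fun_of_weighted_comp)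

lemma ham_supported: "ham f \<in> supported X"
  by (simp add: supported_def fun_of_ham U_outside out_empty del: Collect_empty_eq)

lemma ham_csc: "ham (csc c f) = csc c (ham f)"
  by (simp add: ham_def laplacian_csc potential.weighted_comp_csc csc.scale_right_distrib)

lemma self_adjoint_ham: "self_adjoint_operator ham (supported X)"
proof (intro self_adjoint_operator.intro symmetric_operator.intro symmetric_operator_axioms.intro
    self_adjoint_operator_axioms.intro ham_supported subspace_supported closed_supported)
  show "bounded_linear ham"
    unfolding ham_def[abs_def]
    by (intro bounded_linear_add bounded_linear_laplacian potential.bounded_linear_weighted_comp)
  let ?U = "weighted_comp UNIV (\<lambda>v. complex_of_real (U v)) (\<lambda>v. v)"
  have "?U f \<bullet> g = f \<bullet> ?U g" for f g
    unfolding inner_ell2_def potential.fun_of_weighted_comp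
    by (intro infsum_cong) (simp add: scaleR_conv_of_real[symmetric])
  then show "ham f \<bullet> g = f \<bullet> ham g" for f g
    by (simp add: ham_def inner_add_left inner_add_right laplacian_inner inner_commute[of f "laplacian g"]
        inner_commute[of "grad g"])
qed

end

lemma l2_operator_ham:
  assumes "schroedinger X E s b \<kappa> \<sigma> D U C"
    and inside: "\<And>f v. v \<in> X \<Longrightarrow> A (fun_of f) v = fun_of (schroedinger.ham E s b \<kappa> U f) v"
    and outside: "\<And>f v. v \<notin> X \<Longrightarrow> A (fun_of f) v = 0"
  shows "l2_operator (schroedinger.ham E s b \<kappa> U) X A"
proof -
  interpret schroedinger X E s b \<kappa> \<sigma> D U C by fact
  show ?thesis
  proof (intro l2_operator.intro l2_operator_axioms.intro self_adjoint_ham ham_csc ext)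
    show "A (fun_of f) v = fun_of (ham f) v" for f v
      using inside outside ham_supported[of f] by (cases "v \<in> X") (auto simp: supported_def)
  qed
qed

section \<open>Lattice translations\<close>

lemma int_vector_induct [consumes 1, case_names zero plus minus]:
  fixes n :: "nat \<Rightarrow> int"
  assumes supp: "\<forall>i\<ge>m. n i = 0"
    and zero: "P (\<lambda>_. 0)"
    and plus: "\<And>n s. s < m \<Longrightarrow> P n \<Longrightarrow> P (n(s := n s + 1))"
    and minus: "\<And>n s. s < m \<Longrightarrow> P n \<Longrightarrow> P (n(s := n s - 1))"
  shows "P n"
  using supp
proof (induction "nat (\<Sum>i<m. \<bar>n i\<bar>)" arbitrary: n rule: less_induct)
  case less
  show ?case
  proof (cases "\<exists>s. n s \<noteq> 0")
    case False
    then have "n = (\<lambda>_. 0)" by auto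
    with zero show ?thesis by simp
  next
    case True
    then obtain s where s: "n s \<noteq> 0" "s < m" using less.prems by (meson not_le)
    define k where "k = n(s := n s - sgn (n s))"
    have "(\<Sum>i<m. \<bar>k i\<bar>) = \<bar>k s\<bar> + (\<Sum>i\<in>{..<m} - {s}. \<bar>k i\<bar>)" using s(2) by (simp add: sum.remove)
    also have "\<dots> < \<bar>n s\<bar> + (\<Sum>i\<in>{..<m} - {s}. \<bar>n i\<bar>)" using s(1) by (auto simp: k_def sgn_if)
    also have "\<dots> = (\<Sum>i<m. \<bar>n i\<bar>)" using s(2) by (simp add: sum.remove)
    finally have "nat (\<Sum>i<m. \<bar>k i\<bar>) < nat (\<Sum>i<m. \<bar>n i\<bar>)"
      by (subst nat_less_eq_zless) (simp_all add: sum_nonneg)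
    moreover have "\<forall>i\<ge>m. k i = 0" using less.prems s(2) by (simp add: k_def)
    ultimately have "P k" by (rule less.hyps)
    moreover have "n = k(s := k s + 1) \<or> n = k(s := k s - 1)"
      using s(1) by (auto simp: k_def sgn_if)
    ultimately show ?thesis using plus minus s(2) by metis
  qed
qed

definition shift :: "(nat \<Rightarrow> int) \<Rightarrow> pt \<Rightarrow> pt" where
  "shift n p = (\<lambda>i. p i + of_int (n i))"

lemma shift_0 [simp]: "shift (\<lambda>_. 0) p = p"
  by (simp add: shift_def)

lemma shift_plus: "shift (n(s := n s + 1)) p = unitshift s (shift n p)"
  by (auto simp: shift_def unitshift_def fun_eq_iff)

lemma unitshift_shift_minus: "unitshift s (shift (n(s := n s - 1)) p) = shift n p"
  by (auto simp: shift_def unitshift_def fun_eq_iff)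

lemma unitshift_inject: "unitshift s p = unitshift s q \<longleftrightarrow> p = q"
  by (auto simp: unitshift_def fun_eq_iff split: if_splits)

lemma shift_inject: "shift n p = shift n q \<longleftrightarrow> p = q"
  by (auto simp: shift_def fun_eq_iff)

lemma cell_outside: "d \<le> i \<Longrightarrow> cell d p i = 0"
  by (simp add: cell_def)

lemma cell_shift: "cell d (shift n p) = (\<lambda>i. cell d p i + (if i < d then n i else 0))"
  by (auto simp: cell_def shift_def fun_eq_iff)

lemma base_eq_shift: "base d p = shift (\<lambda>i. - cell d p i) p"
  by (auto simp: base_def cell_def shift_def fun_eq_iff)

lemma base_shift: "(\<And>i. d \<le> i \<Longrightarrow> n i = 0) \<Longrightarrow> base d (shift n p) = base d p"
  by (auto simp: base_def shift_def fun_eq_iff not_less)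

lemma shift_cell_base: "shift (cell d p) (base d p) = p"
  by (auto simp: base_def cell_def shift_def fun_eq_iff)

lemma cell_base: "cell d (base d p) = (\<lambda>_. 0)"
  by (auto simp: base_def cell_def fun_eq_iff)

lemma Vcyl_iff: "v \<in> Vcyl d V \<longleftrightarrow> v \<in> V \<and> cell d v = (\<lambda>_. 0)"
  by (auto simp: Vcyl_def cell_def fun_eq_iff floor_eq_iff)

lemma base_Vcyl: "v \<in> Vcyl d V \<Longrightarrow> base d v = v"
  by (simp add: Vcyl_iff base_eq_shift)

lemma ipd_add: "ipd d (\<lambda>i. m i + n i) \<theta> = ipd d m \<theta> + ipd d n \<theta>"
  by (simp add: ipd_def sum.distrib algebra_simps)

lemma ipd_uminus: "ipd d (\<lambda>i. - n i) \<theta> = - ipd d n \<theta>"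
  by (simp add: ipd_def sum_negf)

definition phase :: "nat \<Rightarrow> (nat \<Rightarrow> real) \<Rightarrow> (nat \<Rightarrow> int) \<Rightarrow> complex" where
  "phase d \<theta> n = exp (\<i> * complex_of_real (ipd d n \<theta>))"

lemma cmod_phase [simp]: "cmod (phase d \<theta> n) = 1"
  by (simp add: phase_def)

lemma phase_add: "phase d \<theta> (\<lambda>i. m i + n i) = phase d \<theta> m * phase d \<theta> n"
  by (simp add: phase_def ipd_add algebra_simps exp_add)

lemma phase_uminus: "phase d \<theta> (\<lambda>i. - n i) = cnj (phase d \<theta> n)"
  by (simp add: phase_def ipd_uminus exp_cnj)

lemma phase_0 [simp]: "phase d \<theta> (\<lambda>_. 0) = 1"
  by (simp add: phase_def ipd_def)

section \<open>Periodic graphs and their cylinders\<close>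

locale periodic_graph =
  fixes dt d :: nat and V :: "pt set" and src tgt :: "'e \<Rightarrow> pt" and rev :: "'e \<Rightarrow> 'e"
    and W :: "pt \<Rightarrow> real"
  assumes d_less: "d < dt"
    and V_infinite: "infinite V"
    and ends: "\<forall>e. src e \<in> V \<and> tgt e \<in> V"
    and revs: "\<forall>e. rev (rev e) = e \<and> rev e \<noteq> e \<and> src (rev e) = tgt e"
    and findeg: "\<forall>v. finite {e. src e = v}"
    and Vper: "\<forall>s<dt. \<forall>v. v \<in> V \<longleftrightarrow> unitshift s v \<in> V"
    and Eper: "\<forall>s<dt. \<exists>T. bij T \<and> (\<forall>e. src (T e) = unitshift s (src e)
                 \<and> tgt (T e) = unitshift s (tgt e) \<and> T (rev e) = rev (T e))"
    and finquot: "finite {v \<in> V. \<forall>i<dt. 0 \<le> v i \<and> v i < 1}"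
    and Wper: "\<forall>s<dt. \<forall>v\<in>V. W (unitshift s v) = W v"
begin

abbreviation X :: "pt set" where "X \<equiv> Vcyl d V"
abbreviation \<tau> :: "'e \<Rightarrow> nat \<Rightarrow> int" where "\<tau> \<equiv> tau d src tgt"

lemma tgt_rev: "tgt (rev e) = src e"
  using revs by metis

lemma tau_outside: "d \<le> i \<Longrightarrow> \<tau> e i = 0"
  by (simp add: tau_def cell_outside)

lemma tau_X: "src e \<in> X \<Longrightarrow> \<tau> e = cell d (tgt e)"
  by (simp add: tau_def Vcyl_iff)

subsection \<open>Translations of the graph\<close>

lemma shift_V:
  assumes "\<And>i. dt \<le> i \<Longrightarrow> n i = 0"
  shows "shift n v \<in> V \<longleftrightarrow> v \<in> V"
proof -
  have "\<forall>i\<ge>dt. n i = 0" using assms by simp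
  then show ?thesis
  proof (induction n rule: int_vector_induct)
    case (plus n s)
    then show ?case using Vper shift_plus[of n s v] by metis
  next
    case (minus n s)
    then show ?case using Vper unitshift_shift_minus[of s n v] by metis
  qed simp
qed

lemma W_shift:
  assumes "\<And>i. dt \<le> i \<Longrightarrow> n i = 0" and v: "v \<in> V"
  shows "W (shift n v) = W v"
proof -
  have "\<forall>i\<ge>dt. n i = 0" using assms(1) by simp
  then have "shift n v \<in> V \<and> W (shift n v) = W v"
  proof (induction n rule: int_vector_induct)
    case (plus n s)
    then show ?case using Vper Wper shift_plus[of n s v] by metis
  next
    case (minus n s)
    then show ?case using Vper Wper unitshift_shift_minus[of s n v] by metis
  qed (simp add: v)
  then show ?thesis by simp
qed

definition is_edge_shift :: "(nat \<Rightarrow> int) \<Rightarrow> ('e \<Rightarrow> 'e) \<Rightarrow> bool" where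
  "is_edge_shift n T \<longleftrightarrow> bij T \<and> (\<forall>e. src (T e) = shift n (src e) \<and> tgt (T e) = shift n (tgt e))"

lemma is_edge_shift_exists:
  assumes "\<And>i. dt \<le> i \<Longrightarrow> n i = 0"
  shows "\<exists>T. is_edge_shift n T"
proof -
  have "\<forall>i\<ge>dt. n i = 0" using assms by simp
  then show ?thesis
  proof (induction n rule: int_vector_induct)
    case zero
    show ?case unfolding is_edge_shift_def by (intro exI[of _ id]) simp
  next
    case (plus n s)
    then obtain T where T: "is_edge_shift n T" by blast
    obtain S where "bij S" "\<forall>e. src (S e) = unitshift s (src e) \<and> tgt (S e) = unitshift s (tgt e)"
      using Eper \<open>s < dt\<close> by blast
    with T have "is_edge_shift (n(s := n s + 1)) (S \<circ> T)"
      by (simp add: is_edge_shift_def shift_plus bij_comp)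
    then show ?case by blast
  next
    case (minus n s)
    then obtain T where T: "is_edge_shift n T" by blast
    obtain S where S: "bij S" "\<And>e. src (S e) = unitshift s (src e)" "\<And>e. tgt (S e) = unitshift s (tgt e)"
      using Eper \<open>s < dt\<close> by blast
    have S_inv: "S (inv S e) = e" for e using S(1) by (simp add: bij_is_surj surj_f_inv_f)
    have "unitshift s (src (inv S (T e))) = unitshift s (shift (n(s := n s - 1)) (src e))"
      "unitshift s (tgt (inv S (T e))) = unitshift s (shift (n(s := n s - 1)) (tgt e))" for e
      using T S(2,3)[of "inv S (T e)"]
      by (simp_all only: S_inv unitshift_shift_minus is_edge_shift_def)
    then have "is_edge_shift (n(s := n s - 1)) (inv S \<circ> T)"
      using T S(1) by (simp add: is_edge_shift_def unitshift_inject bij_comp bij_imp_bij_inv)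
    then show ?case by blast
  qed
qed

definition edge_shift :: "(nat \<Rightarrow> int) \<Rightarrow> 'e \<Rightarrow> 'e" where
  "edge_shift n = (SOME T. is_edge_shift n T)"

context
  fixes n :: "nat \<Rightarrow> int"
  assumes n_outside: "\<And>i. dt \<le> i \<Longrightarrow> n i = 0"
begin

lemma is_edge_shift_edge_shift: "is_edge_shift n (edge_shift n)"
  unfolding edge_shift_def using is_edge_shift_exists[OF n_outside] by (rule someI_ex)

lemma bij_edge_shift: "bij (edge_shift n)"
  and src_edge_shift: "src (edge_shift n e) = shift n (src e)"
  and tgt_edge_shift: "tgt (edge_shift n e) = shift n (tgt e)"
  using is_edge_shift_edge_shift by (simp_all add: is_edge_shift_def)

lemma tau_edge_shift: "\<tau> (edge_shift n e) = \<tau> e"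
  by (simp add: tau_def src_edge_shift tgt_edge_shift cell_shift)

lemma bij_betw_edge_shift_out: "bij_betw (edge_shift n) {e. src e = v} {e. src e = shift n v}"
proof (rule bij_betw_imageI)
  show "inj_on (edge_shift n) {e. src e = v}"
    using bij_edge_shift by (meson bij_is_inj inj_on_subset subset_UNIV)
  show "edge_shift n ` {e. src e = v} = {e. src e = shift n v}"
  proof safe
    fix e assume e: "src e = shift n v"
    obtain e' where e': "e = edge_shift n e'" using bij_edge_shift by (meson bij_is_surj surjD)
    then have "src e' = v" using e by (simp add: src_edge_shift shift_inject)
    with e' show "e \<in> edge_shift n ` {e. src e = v}" by blast
  qed (simp add: src_edge_shift)
qed

end

subsection \<open>Bounds from the finite quotient\<close>

definition unit_cell :: "pt set" where
  "unit_cell = {v \<in> V. \<forall>i<dt. 0 \<le> v i \<and> v i < 1}"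

definition unit_cell_edges :: "'e set" where
  "unit_cell_edges = {e. src e \<in> unit_cell}"

lemma finite_unit_cell: "finite unit_cell"
  using finquot by (simp add: unit_cell_def)

lemma finite_unit_cell_edges: "finite unit_cell_edges"
proof -
  have "unit_cell_edges = (\<Union>v\<in>unit_cell. {e. src e = v})" by (auto simp: unit_cell_edges_def)
  then show ?thesis using finite_unit_cell findeg by simp
qed

lemma base_in_unit_cell: "v \<in> V \<Longrightarrow> base dt v \<in> unit_cell"
  using shift_V[of "\<lambda>i. - cell dt v i" v]
  by (auto simp: unit_cell_def base_eq_shift cell_outside)
    (auto simp: shift_def cell_def frac_lt_1 frac_def[symmetric])

definition degree_bound :: nat where
  "degree_bound = card unit_cell_edges"

lemma card_out_le_degree_bound: "card {e. src e = v} \<le> degree_bound"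
proof (cases "v \<in> V")
  case True
  have "card {e. src e = v} = card {e. src e = base dt v}"
    unfolding base_eq_shift
    by (rule bij_betw_same_card[OF bij_betw_edge_shift_out]) (simp add: cell_outside)
  also have "\<dots> \<le> degree_bound" unfolding degree_bound_def
    using base_in_unit_cell[OF True]
    by (intro card_mono finite_unit_cell_edges) (auto simp: unit_cell_edges_def)
  finally show ?thesis .
next
  case False
  then have "{e. src e = v} = {}" using ends by auto
  then show ?thesis by simp
qed

lemma card_out_filter_le_degree_bound: "card {e. src e = v \<and> P e} \<le> degree_bound"
  by (rule order_trans[OF card_mono card_out_le_degree_bound[of v]]) (use findeg in auto)

lemma tau_bounded:
  obtains r :: nat where "\<And>e i. \<bar>\<tau> e i\<bar> \<le> int r"
proof
  fix e i
  let ?n = "\<lambda>i. - cell dt (src e) i"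
  have n: "?n i = 0" if "dt \<le> i" for i using that by (simp add: cell_outside)
  have e0: "edge_shift ?n e \<in> unit_cell_edges"
    using base_in_unit_cell[of "src e"] ends
    by (simp add: unit_cell_edges_def src_edge_shift[OF n] base_eq_shift)
  show "\<bar>\<tau> e i\<bar> \<le> int (nat (\<Sum>e\<in>unit_cell_edges. \<Sum>i<d. \<bar>\<tau> e i\<bar>))"
  proof (cases "i < d")
    case True
    have "\<bar>\<tau> (edge_shift ?n e) i\<bar> \<le> (\<Sum>i<d. \<bar>\<tau> (edge_shift ?n e) i\<bar>)"
      using True by (intro member_le_sum) auto
    also have "\<dots> \<le> (\<Sum>e\<in>unit_cell_edges. \<Sum>i<d. \<bar>\<tau> e i\<bar>)"
      using e0 finite_unit_cell_edges
      by (intro member_le_sum[where f="\<lambda>e. \<Sum>i<d. \<bar>\<tau> e i\<bar>"]) (auto intro: sum_nonneg)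
    finally have "\<bar>\<tau> e i\<bar> \<le> (\<Sum>e\<in>unit_cell_edges. \<Sum>i<d. \<bar>\<tau> e i\<bar>)"
      by (simp only: tau_edge_shift[OF n])
    then show ?thesis by linarith
  qed (simp add: tau_outside)
qed

definition W_bound :: real where
  "W_bound = (\<Sum>v\<in>unit_cell. \<bar>W v\<bar>)"

lemma W_bound_nonneg: "0 \<le> W_bound"
  by (simp add: W_bound_def sum_nonneg)

lemma abs_W_le:
  assumes "v \<in> V"
  shows "\<bar>W v\<bar> \<le> W_bound"
proof -
  have "W (base dt v) = W v"
    unfolding base_eq_shift using assms by (intro W_shift) (simp_all add: cell_outside)
  moreover have "\<bar>W (base dt v)\<bar> \<le> W_bound" unfolding W_bound_def
    using base_in_unit_cell[OF assms] finite_unit_cell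
    by (intro member_le_sum[where f="\<lambda>v. \<bar>W v\<bar>"]) auto
  ultimately show ?thesis by simp
qed

subsection \<open>The cylinder\<close>

lemma neg_cell_outside: "dt \<le> i \<Longrightarrow> - cell d p i = 0"
  using d_less by (simp add: cell_outside)

lemma base_in_X: "v \<in> V \<Longrightarrow> base d v \<in> X"
  using shift_V[OF neg_cell_outside] by (simp add: Vcyl_iff cell_base) (simp add: base_eq_shift)

lemma infinite_X: "infinite X"
proof -
  obtain v where "v \<in> V" using V_infinite by (metis ex_in_conv finite.emptyI)
  then have x: "base d v \<in> X" by (rule base_in_X)
  define g where "g k = shift ((\<lambda>_. 0)(d := int k)) (base d v)" for k :: nat
  have "g k \<in> X" for k
    using x d_less shift_V[of "(\<lambda>_. 0)(d := int k)" "base d v"]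
    by (auto simp: g_def Vcyl_iff cell_shift fun_eq_iff)
  moreover have "inj g"
  proof (rule injI)
    fix k l assume "g k = g l"
    from fun_cong[OF this, of d] show "k = l" by (simp add: g_def shift_def)
  qed
  ultimately show ?thesis by (meson infinite_iff_countable_subset image_subsetI)
qed

text \<open>The translations of different coordinate directions need not commute on edges, so this
  reversal of the cylinder's edges is a bijection but in general not an involution.\<close>

definition cyl_rev :: "'e \<Rightarrow> 'e" where
  "cyl_rev e = edge_shift (\<lambda>i. - cell d (tgt e) i) (rev e)"

lemma src_cyl_rev: "src (cyl_rev e) = base d (tgt e)"
  using revs by (simp add: cyl_rev_def src_edge_shift[OF neg_cell_outside] base_eq_shift)

lemma src_cyl_rev_in_X: "src (cyl_rev e) \<in> X"
  using ends base_in_X by (simp add: src_cyl_rev)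

lemma tgt_cyl_rev: "tgt (cyl_rev e) = shift (\<lambda>i. - cell d (tgt e) i) (src e)"
  by (simp add: cyl_rev_def tgt_edge_shift[OF neg_cell_outside] tgt_rev)

lemma base_tgt_cyl_rev: "src e \<in> X \<Longrightarrow> base d (tgt (cyl_rev e)) = src e"
  using base_shift[of d "\<lambda>i. - cell d (tgt e) i" "src e"]
  by (simp add: tgt_cyl_rev cell_outside base_Vcyl)

lemma tau_cyl_rev: "src e \<in> X \<Longrightarrow> \<tau> (cyl_rev e) = (\<lambda>i. - \<tau> e i)"
  unfolding tau_def src_cyl_rev tgt_cyl_rev cell_base cell_shift
  by (auto simp: Vcyl_iff cell_outside)

lemma inj_on_cyl_rev: "inj_on cyl_rev {e. src e \<in> X}"
proof (rule inj_onI)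
  fix e e' assume e: "e \<in> {e. src e \<in> X}" "e' \<in> {e. src e \<in> X}" "cyl_rev e = cyl_rev e'"
  then have "(\<lambda>i. - \<tau> e i) = (\<lambda>i. - \<tau> e' i)" by (metis mem_Collect_eq tau_cyl_rev)
  then have cells: "cell d (tgt e) = cell d (tgt e')" using e tau_X by (simp add: fun_eq_iff)
  have "bij (edge_shift (\<lambda>i. - cell d (tgt e') i))" by (rule bij_edge_shift[OF neg_cell_outside])
  then have "rev e = rev e'" using e(3) unfolding cyl_rev_def cells by (rule bij_is_inj[THEN injD])
  then show "e = e'" using revs by metis
qed

lemma cyl_rev_surj:
  assumes e: "src e \<in> X"
  obtains e' where "src e' \<in> X" "cyl_rev e' = e"
proof -
  let ?m = "cell d (tgt e)"
  have m: "?m i = 0" if "dt \<le> i" for i using that d_less by (simp add: cell_outside)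
  obtain u where u: "e = edge_shift ?m u" using bij_edge_shift[OF m] by (meson bij_is_surj surjD)
  have "shift ?m (tgt u) = shift ?m (base d (tgt e))"
    using tgt_edge_shift[of ?m u, OF m] u by (simp add: shift_cell_base)
  then have tgt_u: "tgt u = base d (tgt e)" by (simp only: shift_inject)
  have "cell d (src e) = (\<lambda>i. cell d (src u) i + (if i < d then ?m i else 0))"
    using src_edge_shift[of ?m u, OF m] u by (simp add: cell_shift)
  also have "\<dots> = (\<lambda>i. cell d (src u) i + ?m i)" by (auto simp: cell_outside)
  finally have "(\<lambda>i. - cell d (src u) i) = ?m"
    using e by (auto simp: Vcyl_iff fun_eq_iff add_eq_0_iff)
  then have "cyl_rev (rev u) = e" using u revs by (simp add: cyl_rev_def tgt_rev)
  moreover have "src (rev u) \<in> X" using revs tgt_u ends base_in_X by simp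
  ultimately show ?thesis using that by blast
qed

definition cyl_edges :: "((nat \<Rightarrow> int) \<Rightarrow> bool) \<Rightarrow> 'e set" where
  "cyl_edges P = {e. src e \<in> X \<and> P (\<tau> e)}"

lemma out_cyl_edges: "x \<in> X \<Longrightarrow> {e \<in> cyl_edges P. src e = x} = {e. src e = x \<and> P (\<tau> e)}"
  by (auto simp: cyl_edges_def)

lemma bij_betw_cyl_rev:
  assumes P: "\<And>t. P (\<lambda>i. - t i) \<longleftrightarrow> P t"
  shows "bij_betw cyl_rev (cyl_edges P) (cyl_edges P)"
proof (rule bij_betw_imageI)
  show "inj_on cyl_rev (cyl_edges P)"
    using inj_on_cyl_rev by (rule inj_on_subset) (auto simp: cyl_edges_def)
  show "cyl_rev ` cyl_edges P = cyl_edges P"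
  proof safe
    fix e assume "e \<in> cyl_edges P"
    then show "cyl_rev e \<in> cyl_edges P"
      using P by (simp add: cyl_edges_def src_cyl_rev_in_X tau_cyl_rev)
  next
    fix e assume e: "e \<in> cyl_edges P"
    then obtain e' where e': "src e' \<in> X" "cyl_rev e' = e"
      using cyl_rev_surj by (auto simp: cyl_edges_def)
    then have "e' \<in> cyl_edges P" using e P tau_cyl_rev[OF e'(1)] by (simp add: cyl_edges_def)
    then show "e \<in> cyl_rev ` cyl_edges P" using e'(2) by blast
  qed
qed

lemma magnetic_graph_cylinder:
  assumes P: "\<And>t. P (\<lambda>i. - t i) \<longleftrightarrow> P t"
    and card_le: "\<And>v. v \<in> X \<Longrightarrow> card {e. src e = v \<and> P (\<tau> e)} \<le> D"
  shows "magnetic_graph X (cyl_edges P) src (\<lambda>e. base d (tgt e)) (\<lambda>e. phase d \<theta> (\<tau> e)) cyl_rev D"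
proof
  show "bij_betw cyl_rev (cyl_edges P) (cyl_edges P)" using P by (rule bij_betw_cyl_rev)
  fix v
  show "finite {e \<in> cyl_edges P. src e = v}"
    by (rule finite_subset[OF _ findeg[rule_format, of v]]) auto
  show "card {e \<in> cyl_edges P. src e = v} \<le> D"
  proof (cases "v \<in> X")
    case False
    then have "{e \<in> cyl_edges P. src e = v} = {}" by (auto simp: cyl_edges_def)
    then show ?thesis by (simp only: card.empty)
  qed (simp add: out_cyl_edges card_le)
qed (auto simp: cyl_edges_def src_cyl_rev base_tgt_cyl_rev tau_cyl_rev phase_uminus)

end

section \<open>Fiber operators as averages over truncated Bloch waves\<close>

definition box :: "nat \<Rightarrow> int \<Rightarrow> int \<Rightarrow> (nat \<Rightarrow> int) set" where
  "box d lo hi = {n. (\<forall>i<d. lo \<le> n i \<and> n i < hi) \<and> (\<forall>i\<ge>d. n i = 0)}"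

lemma box_outside: "n \<in> box d lo hi \<Longrightarrow> d \<le> i \<Longrightarrow> n i = 0"
  by (simp add: box_def)

lemma finite_box: "finite (box d lo hi)" and card_box: "card (box d lo hi) = nat (hi - lo) ^ d"
proof -
  let ?P = "{..<d} \<rightarrow>\<^sub>E {lo..<hi}"
  have "bij_betw (\<lambda>f i. if i < d then f i else 0) ?P (box d lo hi)"
  proof (rule bij_betwI[where g="\<lambda>f. restrict f {..<d}"])
    show "(\<lambda>f i. if i < d then f i else 0) \<in> ?P \<rightarrow> box d lo hi" by (auto simp: box_def PiE_iff)
    show "(\<lambda>f. restrict f {..<d}) \<in> box d lo hi \<rightarrow> ?P" by (auto simp: box_def)
    show "restrict (\<lambda>i. if i < d then f i else 0) {..<d} = f" if "f \<in> ?P" for f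
      using that by (auto simp: fun_eq_iff PiE_iff extensional_def)
    show "(\<lambda>i. if i < d then restrict f {..<d} i else 0) = f" if "f \<in> box d lo hi" for f
      using that by (auto simp: fun_eq_iff box_def)
  qed
  then show "finite (box d lo hi)" "card (box d lo hi) = nat (hi - lo) ^ d"
    using bij_betw_finite bij_betw_same_card by (force simp: finite_PiE, force simp: card_funcsetE)
qed

lemma nonneg_of_box_estimate:
  fixes h c :: real
  assumes "\<And>N. N > 2 * r \<Longrightarrow> 0 \<le> real N ^ d * h + (real N ^ d - real (N - 2 * r) ^ d) * c"
  shows "0 \<le> h"
proof -
  define q where "q N = 1 - 2 * real r * inverse (real N)" for N
  have "(\<lambda>N. h + (1 - q N ^ d) * c) \<longlonglongrightarrow> h + (1 - (1 - 2 * real r * 0) ^ d) * c"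
    unfolding q_def by (intro tendsto_intros lim_inverse_n)
  then have "(\<lambda>N. h + (1 - q N ^ d) * c) \<longlonglongrightarrow> h" by simp
  moreover have "\<forall>\<^sub>F N in sequentially. 0 \<le> h + (1 - q N ^ d) * c"
  proof (rule eventually_sequentiallyI[of "Suc (2 * r)"])
    fix N assume N: "Suc (2 * r) \<le> N"
    have shrink: "real (N - 2 * r) = real N * q N"
      using N by (simp add: q_def of_nat_diff field_simps)
    have "0 \<le> real N ^ d * h + (real N ^ d - real (N - 2 * r) ^ d) * c"
      using N by (intro assms) simp
    also have "\<dots> = real N ^ d * (h + (1 - q N ^ d) * c)"
      unfolding shrink power_mult_distrib by (simp add: algebra_simps)
    finally have "0 \<le> real N ^ d * (h + (1 - q N ^ d) * c)" .
    moreover have "0 < real N ^ d" using N by simp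
    ultimately show "0 \<le> h + (1 - q N ^ d) * c" by (simp only: zero_le_mult_iff) linarith
  qed
  ultimately show ?thesis by (rule tendsto_lowerbound) simp
qed

lemma unit_mult_inner: "cmod c = 1 \<Longrightarrow> (c * z) \<bullet> (c * w) = z \<bullet> (w :: complex)"
proof -
  assume "cmod c = 1"
  then have "(Re c)\<^sup>2 + (Im c)\<^sup>2 = 1" by (simp add: cmod_def)
  moreover have "(c * z) \<bullet> (c * w) = ((Re c)\<^sup>2 + (Im c)\<^sup>2) * (z \<bullet> w)"
    by (simp add: inner_complex_def power2_eq_square algebra_simps)
  ultimately show ?thesis by simp
qed

context periodic_graph
begin

lemma bij_betw_shift_cell:
  assumes "\<And>i. d \<le> i \<Longrightarrow> n i = 0"
  shows "bij_betw (shift n) X {v \<in> V. cell d v = n}"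
proof (rule bij_betwI[where g="base d"])
  show "shift n \<in> X \<rightarrow> {v \<in> V. cell d v = n}"
    using shift_V[of n] d_less assms by (auto simp: Vcyl_iff cell_shift fun_eq_iff not_less)
  show "base d \<in> {v \<in> V. cell d v = n} \<rightarrow> X" using base_in_X by auto
  show "base d (shift n x) = x" if "x \<in> X" for x
    using that by (simp add: base_shift assms base_Vcyl)
  show "shift n (base d v) = v" if "v \<in> {v \<in> V. cell d v = n}" for v
    using that shift_cell_base[of d v] by simp
qed

sublocale H0: schroedinger V UNIV src tgt "\<lambda>_. 1" rev degree_bound "\<lambda>v. if v \<in> V then W v else 0" W_bound
proof
  show "bij_betw rev UNIV UNIV" using revs by (intro bij_betwI[where g=rev]) auto
qed (use ends revs tgt_rev findeg card_out_le_degree_bound abs_W_le W_bound_nonneg in auto)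

lemma l2_operator_H0: "l2_operator H0.ham V (opH0 V src tgt W)"
  by (rule l2_operator_ham[OF H0.schroedinger_axioms]) (simp_all add: opH0_def H0.fun_of_ham)

end

locale fiber = periodic_graph dt d V src tgt rev W
  for dt d V and src tgt :: "'e \<Rightarrow> pt" and rev W +
  fixes \<theta> :: "nat \<Rightarrow> real"
begin

abbreviation cyl_tgt :: "'e \<Rightarrow> pt" where "cyl_tgt \<equiv> \<lambda>e. base d (tgt e)"
abbreviation ph :: "(nat \<Rightarrow> int) \<Rightarrow> complex" where "ph \<equiv> phase d \<theta>"
abbreviation \<kappa> :: "'e \<Rightarrow> complex" where "\<kappa> \<equiv> \<lambda>e. ph (\<tau> e)"

sublocale H0_fib: schroedinger X "cyl_edges (\<lambda>_. True)" src cyl_tgt \<kappa> cyl_rev degree_bound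
    "\<lambda>v. if v \<in> X then W v else 0" W_bound
proof (intro schroedinger.intro magnetic_graph_cylinder schroedinger_axioms.intro)
  show "\<bar>if v \<in> X then W v else 0\<bar> \<le> W_bound" for v
    using abs_W_le[of v] W_bound_nonneg by (simp add: Vcyl_def)
qed (auto simp: card_out_le_degree_bound)

definition bloch_wave :: "(nat \<Rightarrow> int) set \<Rightarrow> pt ell2 \<Rightarrow> pt ell2" where
  "bloch_wave B = weighted_comp {v \<in> V. cell d v \<in> B} (\<lambda>v. ph (cell d v)) (base d)"

lemma weighted_composition_bloch_wave:
  assumes "finite B"
  shows "weighted_composition {v \<in> V. cell d v \<in> B} (\<lambda>v. ph (cell d v)) (base d) 1 (card B)"
proof
  fix x
  let ?fiber = "{v \<in> {v \<in> V. cell d v \<in> B}. base d v = x}"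
  have "inj_on (cell d) ?fiber"
    by (rule inj_on_inverseI[where g = "\<lambda>n. shift n x"]) (use shift_cell_base in auto)
  moreover have "cell d ` ?fiber \<subseteq> B" by auto
  ultimately show "finite ?fiber" "card ?fiber \<le> card B"
    using assms by (blast intro: inj_on_finite card_inj_on_le)+
qed simp_all

lemma fun_of_bloch_wave:
  assumes "finite B"
  shows "fun_of (bloch_wave B f) v =
    (if v \<in> V \<and> cell d v \<in> B then ph (cell d v) * fun_of f (base d v) else 0)"
  unfolding bloch_wave_def weighted_composition.fun_of_weighted_comp[OF weighted_composition_bloch_wave[OF assms]]
  by simp

lemma bloch_wave_eq_sum:
  assumes "finite B"
  shows "bloch_wave B f = (\<Sum>n\<in>B. bloch_wave {n} f)"
proof (rule ell2_eqI)
  fix v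
  have "fun_of (\<Sum>n\<in>B. bloch_wave {n} f) v =
      (\<Sum>n\<in>B. if cell d v = n then (if v \<in> V then ph n * fun_of f (base d v) else 0) else 0)"
    unfolding fun_of_sum by (intro sum.cong) (auto simp: fun_of_bloch_wave)
  then show "fun_of (bloch_wave B f) v = fun_of (\<Sum>n\<in>B. bloch_wave {n} f) v"
    using assms by (simp add: fun_of_bloch_wave)
qed

lemma inner_bloch_wave_singleton:
  assumes n: "\<And>i. d \<le> i \<Longrightarrow> n i = 0"
    and f: "f \<in> supported X" and g: "\<And>x. x \<in> X \<Longrightarrow> fun_of G (shift n x) = ph n * fun_of g x"
  shows "G \<bullet> bloch_wave {n} f = g \<bullet> f"
proof -
  have "G \<bullet> bloch_wave {n} f =
      (\<Sum>\<^sub>\<infinity>v\<in>{v \<in> V. cell d v = n}. fun_of G v \<bullet> (ph n * fun_of f (base d v)))"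
    unfolding inner_ell2_def by (intro infsum_cong_neutral) (auto simp: fun_of_bloch_wave)
  also have "\<dots> = (\<Sum>\<^sub>\<infinity>x\<in>X. fun_of G (shift n x) \<bullet> (ph n * fun_of f (base d (shift n x))))"
    by (rule infsum_reindex_bij_betw[OF bij_betw_shift_cell[OF n], symmetric])
  also have "\<dots> = (\<Sum>\<^sub>\<infinity>x\<in>X. fun_of g x \<bullet> fun_of f x)"
    by (intro infsum_cong) (simp add: g base_shift n base_Vcyl unit_mult_inner)
  finally show ?thesis by (simp add: inner_supported[OF f])
qed

definition exit_edges :: "(nat \<Rightarrow> int) set \<Rightarrow> (nat \<Rightarrow> int) \<Rightarrow> 'e set" where
  "exit_edges B n = {e \<in> cyl_edges (\<lambda>_. True). (\<lambda>i. n i + \<tau> e i) \<notin> B}"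

definition exit_term :: "(nat \<Rightarrow> int) set \<Rightarrow> (nat \<Rightarrow> int) \<Rightarrow> pt ell2 \<Rightarrow> 'e ell2" where
  "exit_term B n = weighted_comp (exit_edges B n) \<kappa> cyl_tgt"

lemma weighted_composition_exit_term: "weighted_composition (exit_edges B n) \<kappa> cyl_tgt 1 degree_bound"
  by (rule H0_fib.target.weighted_composition_subset) (auto simp: exit_edges_def)

lemma fun_of_exit_term: "fun_of (exit_term B n f) e = (if e \<in> exit_edges B n then \<kappa> e * fun_of f (cyl_tgt e) else 0)"
  unfolding exit_term_def
  by (rule weighted_composition.fun_of_weighted_comp[OF weighted_composition_exit_term])

text \<open>In the cell \<open>n\<close> only the edges leaving \<open>B\<close> notice that the wave was cut off.\<close>

lemma ham_bloch_wave:
  assumes B: "finite B" "\<And>n i. n \<in> B \<Longrightarrow> d \<le> i \<Longrightarrow> n i = 0" and n: "n \<in> B" and x: "x \<in> X"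
  shows "fun_of (H0.ham (bloch_wave B f)) (shift n x) =
    ph n * fun_of (H0_fib.ham f + H0_fib.divergence (exit_term B n f)) x"
proof -
  let ?F = "fun_of (bloch_wave B f)"
  let ?r = "\<lambda>e. fun_of (exit_term B n f) e"
  have nd: "n i = 0" if "d \<le> i" for i using B(2)[OF n that] .
  then have nt: "n i = 0" if "dt \<le> i" for i using that d_less by simp
  have xV: "x \<in> V" "cell d x = (\<lambda>_. 0)" using x by (auto simp: Vcyl_iff)
  have sx: "shift n x \<in> V" "W (shift n x) = W x" using shift_V[OF nt] W_shift[OF nt] xV by auto
  have cell_n: "cell d (shift n p) = (\<lambda>i. n i + cell d p i)" for p
    using nd by (auto simp: cell_shift fun_eq_iff not_less)
  have base_n: "base d (shift n p) = base d p" for p by (rule base_shift[OF nd])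
  have F_x: "?F (shift n x) = ph n * fun_of f x"
    using n sx x by (simp add: fun_of_bloch_wave[OF B(1)] cell_n xV base_n base_Vcyl)
  have F_e: "?F (shift n (tgt e)) = ph n * (\<kappa> e * fun_of f (cyl_tgt e) - ?r e)" if "src e = x" for e
  proof -
    have "shift n (tgt e) \<in> V" using shift_V[OF nt] ends by simp
    then show ?thesis
      using that x
      by (simp add: fun_of_bloch_wave[OF B(1)] cell_n base_n tau_X phase_add fun_of_exit_term exit_edges_def cyl_edges_def)
  qed
  have "(\<Sum>e\<in>{e. src e = shift n x}. ?F (shift n x) - ?F (tgt e)) =
      (\<Sum>e\<in>{e. src e = x}. ?F (shift n x) - ?F (tgt (edge_shift n e)))"
    by (rule sum.reindex_bij_betw[OF bij_betw_edge_shift_out[OF nt], symmetric])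
  also have "\<dots> = (\<Sum>e\<in>{e. src e = x}. ph n * ((fun_of f x - \<kappa> e * fun_of f (cyl_tgt e)) + ?r e))"
    by (intro sum.cong) (simp_all add: tgt_edge_shift[OF nt] F_x F_e algebra_simps)
  also have "\<dots> = ph n * ((\<Sum>e\<in>{e. src e = x}. fun_of f x - \<kappa> e * fun_of f (cyl_tgt e)) + (\<Sum>e\<in>{e. src e = x}. ?r e))"
    by (simp only: sum_distrib_left[symmetric] sum.distrib)
  finally show ?thesis
    using sx x out_cyl_edges[OF x, of "\<lambda>_. True"]
    by (simp add: H0.fun_of_ham H0_fib.fun_of_ham H0_fib.fun_of_divergence F_x algebra_simps)
qed

lemma ham_bloch_wave_inner:
  assumes "finite B" "\<And>n i. n \<in> B \<Longrightarrow> d \<le> i \<Longrightarrow> n i = 0" "n \<in> B" "f \<in> supported X"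
  shows "H0.ham (bloch_wave B f) \<bullet> bloch_wave {n} f = H0_fib.ham f \<bullet> f + exit_term B n f \<bullet> H0_fib.pullback_source f"
proof -
  have "H0.ham (bloch_wave B f) \<bullet> bloch_wave {n} f = (H0_fib.ham f + H0_fib.divergence (exit_term B n f)) \<bullet> f"
    using assms by (intro inner_bloch_wave_singleton ham_bloch_wave) auto
  then show ?thesis by (simp add: inner_add_left H0_fib.divergence_adjoint)
qed

lemma exit_term_inner_le: "exit_term B n f \<bullet> H0_fib.pullback_source f \<le> degree_bound * (f \<bullet> f)"
proof -
  have "exit_term B n f \<bullet> H0_fib.pullback_source f \<le> norm (exit_term B n f) * norm (H0_fib.pullback_source f)"
    by (rule norm_cauchy_schwarz)
  also have "\<dots> \<le> (sqrt degree_bound * norm f) * (sqrt degree_bound * norm f)"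
    using weighted_composition.norm_weighted_comp_le[OF weighted_composition_exit_term, of B n f]
      H0_fib.source.norm_weighted_comp_le[of f]
    by (intro mult_mono) (simp_all add: exit_term_def)
  also have "\<dots> = (sqrt degree_bound * norm f)\<^sup>2" by (simp only: power2_eq_square)
  finally show ?thesis by (simp add: power_mult_distrib power2_norm_eq_inner)
qed

lemma exit_term_0:
  assumes "\<And>e. (\<lambda>i. n i + \<tau> e i) \<in> B"
  shows "exit_term B n f = 0"
  by (rule ell2_eqI) (simp add: fun_of_exit_term exit_edges_def assms)

lemma box_plus_tau:
  assumes r: "\<And>e i. \<bar>\<tau> e i\<bar> \<le> int r" and n: "n \<in> box d (int r) (int N - int r)"
  shows "(\<lambda>i. n i + \<tau> e i) \<in> box d 0 (int N)"
proof -
  have "0 \<le> n i + \<tau> e i \<and> n i + \<tau> e i < int N" if "i < d" for i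
    using n that r[of e i] unfolding box_def abs_le_iff by force
  moreover have "n i + \<tau> e i = 0" if "d \<le> i" for i
    using n that by (simp add: box_outside tau_outside)
  ultimately show ?thesis by (simp add: box_def)
qed

lemma ham_bloch_wave_box_le:
  assumes r: "\<And>e i. \<bar>\<tau> e i\<bar> \<le> int r" and N: "2 * r < N" and f: "f \<in> supported X"
  shows "H0.ham (bloch_wave (box d 0 (int N)) f) \<bullet> bloch_wave (box d 0 (int N)) f \<le>
    real N ^ d * (H0_fib.ham f \<bullet> f) + (real N ^ d - real (N - 2 * r) ^ d) * (degree_bound * (f \<bullet> f))"
proof -
  define B where "B = box d 0 (int N)"
  define I where "I = box d (int r) (int N - int r)"
  let ?h = "H0_fib.ham f \<bullet> f" and ?c = "degree_bound * (f \<bullet> f)"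
  have B: "finite B" "\<And>n i. n \<in> B \<Longrightarrow> d \<le> i \<Longrightarrow> n i = 0" by (auto simp: B_def finite_box box_outside)
  have IB: "I \<subseteq> B" using N by (force simp: I_def B_def box_def)
  have card_B: "real (card B) = real N ^ d" by (simp add: B_def card_box)
  have "nat (int N - int r - int r) = N - 2 * r" by simp
  then have card_I: "real (card I) = real (N - 2 * r) ^ d" by (simp add: I_def card_box)
  have card_diff: "real (card (B - I)) = real (card B) - real (card I)"
    using card_mono[OF B(1) IB] IB B(1) by (simp add: card_Diff_subset finite_subset of_nat_diff)
  let ?t = "\<lambda>n. exit_term B n f \<bullet> H0_fib.pullback_source f"
  have "H0.ham (bloch_wave B f) \<bullet> bloch_wave B f = (\<Sum>n\<in>B. H0.ham (bloch_wave B f) \<bullet> bloch_wave {n} f)"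
    by (subst (2) bloch_wave_eq_sum[OF B(1)]) (rule inner_sum_right)
  also have "\<dots> = (\<Sum>n\<in>B. ?h + ?t n)"
    using f by (intro sum.cong ham_bloch_wave_inner B) auto
  also have "\<dots> = card B * ?h + (\<Sum>n\<in>B. ?t n)" by (simp add: sum.distrib)
  also have "(\<Sum>n\<in>B. ?t n) = (\<Sum>n\<in>B - I. ?t n)"
    using B(1) box_plus_tau[OF r]
    by (intro sum.mono_neutral_right) (auto simp: exit_term_0 I_def B_def)
  also have "\<dots> \<le> (\<Sum>n\<in>B - I. ?c)" by (intro sum_mono exit_term_inner_le)
  also have "\<dots> = (real (card B) - real (card I)) * ?c" by (simp add: card_diff)
  finally show ?thesis by (simp add: card_B card_I flip: B_def)
qed

text \<open>Bloch waves cut off to a box of side \<open>N\<close> are test functions for the whole graph; the cut-off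
  only affects the boundary layer of the box, whose share of the volume vanishes as \<open>N\<close> grows.\<close>

lemma fiber_ham_nonneg:
  assumes nonneg: "\<And>F. F \<in> supported V \<Longrightarrow> 0 \<le> H0.ham F \<bullet> F" and f: "f \<in> supported X"
  shows "0 \<le> H0_fib.ham f \<bullet> f"
proof -
  obtain r where r: "\<And>e i. \<bar>\<tau> e i\<bar> \<le> int r" using tau_bounded by blast
  show ?thesis
  proof (rule nonneg_of_box_estimate)
    fix N assume N: "2 * r < N"
    have "bloch_wave (box d 0 (int N)) f \<in> supported V"
      by (simp add: supported_def fun_of_bloch_wave finite_box)
    from order_trans[OF nonneg[OF this] ham_bloch_wave_box_le[OF r N f]]
    show "0 \<le> real N ^ d * (H0_fib.ham f \<bullet> f) + (real N ^ d - real (N - 2 * r) ^ d) * (degree_bound * (f \<bullet> f))" .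
  qed
qed

end

section \<open>Guided bands\<close>

locale guided = fiber dt d V src tgt rev W \<theta>
  for dt d V and src tgt :: "'e \<Rightarrow> pt" and rev W \<theta> +
  fixes Q :: "pt \<Rightarrow> real"
  assumes Qfin: "finite {v \<in> Vcyl d V. Q v \<noteq> 0}"
begin

abbreviation bridge_bound :: nat ("\<beta>\<^sub>+") where "\<beta>\<^sub>+ \<equiv> beta_plus d V src tgt"

definition potential :: "pt \<Rightarrow> real" where
  "potential v = (if v \<in> X then W v - Q v else 0)"

definition potential_bound :: real where
  "potential_bound = W_bound + (\<Sum>v\<in>{v \<in> X. Q v \<noteq> 0}. \<bar>Q v\<bar>)"

lemma potential_outside: "v \<notin> X \<Longrightarrow> potential v = 0"
  by (simp add: potential_def)

lemma abs_potential_le: "\<bar>potential v\<bar> \<le> potential_bound"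
proof (cases "v \<in> X")
  case True
  have "\<bar>Q v\<bar> \<le> (\<Sum>v\<in>{v \<in> X. Q v \<noteq> 0}. \<bar>Q v\<bar>)"
  proof (cases "Q v = 0")
    case False
    then show ?thesis using True Qfin by (intro member_le_sum[where f="\<lambda>v. \<bar>Q v\<bar>"]) auto
  qed (simp add: sum_nonneg)
  moreover have "\<bar>W v\<bar> \<le> W_bound" using True by (intro abs_W_le) (simp add: Vcyl_def)
  ultimately show ?thesis using True by (simp add: potential_def potential_bound_def)
qed (simp add: potential_def potential_bound_def W_bound_nonneg sum_nonneg)

lemma card_bridges_le: "v \<in> X \<Longrightarrow> card {e. src e = v \<and> \<tau> e \<noteq> (\<lambda>_. 0)} \<le> \<beta>\<^sub>+"
proof -
  assume v: "v \<in> X"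
  have "beta d src tgt ` X \<subseteq> {..degree_bound}"
    using card_out_filter_le_degree_bound by (auto simp: beta_def)
  then have "finite (beta d src tgt ` X)" using finite_subset by blast
  then show ?thesis using v unfolding beta_plus_def beta_def[symmetric] by (intro Max_ge) auto
qed

sublocale H_fib: schroedinger X "cyl_edges (\<lambda>_. True)" src cyl_tgt \<kappa> cyl_rev degree_bound potential potential_bound
  by (intro schroedinger.intro magnetic_graph_cylinder schroedinger_axioms.intro abs_potential_le
      potential_outside) (auto simp: card_out_le_degree_bound)

sublocale h: schroedinger X "cyl_edges (\<lambda>t. t = (\<lambda>_. 0))" src cyl_tgt \<kappa> cyl_rev degree_bound potential potential_bound
  by (intro schroedinger.intro magnetic_graph_cylinder schroedinger_axioms.intro abs_potential_le
      potential_outside card_out_filter_le_degree_bound) (auto simp: fun_eq_iff)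

sublocale bridges: magnetic_graph X "cyl_edges (\<lambda>t. t \<noteq> (\<lambda>_. 0))" src cyl_tgt \<kappa> cyl_rev "\<beta>\<^sub>+"
  by (intro magnetic_graph_cylinder card_bridges_le) (auto simp: fun_eq_iff)

lemma l2_operator_H_fib: "l2_operator H_fib.ham X (opHfib d V src tgt W Q \<theta>)"
  by (rule l2_operator_ham[OF H_fib.schroedinger_axioms])
    (simp_all add: opHfib_def H_fib.fun_of_ham out_cyl_edges potential_def flip: phase_def)

lemma l2_operator_h: "l2_operator h.ham X (oph d V src tgt W Q)"
proof (rule l2_operator_ham[OF h.schroedinger_axioms])
  fix f v assume v: "v \<in> X"
  have "\<kappa> e * fun_of f (cyl_tgt e) = fun_of f (tgt e)" if "src e = v" "\<tau> e = (\<lambda>_. 0)" for e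
    using that v tau_X[of e] by (simp add: base_eq_shift)
  then show "oph d V src tgt W Q (fun_of f) v = fun_of (h.ham f) v"
    using v by (simp add: oph_def h.fun_of_ham out_cyl_edges potential_def)
qed (simp add: oph_def)

sublocale H_fib_op: l2_operator H_fib.ham X "opHfib d V src tgt W Q \<theta>"
  by (rule l2_operator_H_fib)

sublocale h_op: l2_operator h.ham X "oph d V src tgt W Q"
  by (rule l2_operator_h)

lemma H_fib_ham_eq: "H_fib.ham f = h.ham f + bridges.laplacian f"
proof (rule ell2_eqI)
  fix v
  let ?t = "\<lambda>e. fun_of f v - \<kappa> e * fun_of f (cyl_tgt e)"
  have union: "{e \<in> cyl_edges (\<lambda>_. True). src e = v} =
      {e \<in> cyl_edges (\<lambda>t. t = (\<lambda>_. 0)). src e = v} \<union> {e \<in> cyl_edges (\<lambda>t. t \<noteq> (\<lambda>_. 0)). src e = v}"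
    by (auto simp: cyl_edges_def)
  have "sum ?t {e \<in> cyl_edges (\<lambda>_. True). src e = v} =
      sum ?t {e \<in> cyl_edges (\<lambda>t. t = (\<lambda>_. 0)). src e = v} +
      sum ?t {e \<in> cyl_edges (\<lambda>t. t \<noteq> (\<lambda>_. 0)). src e = v}"
    unfolding union
    by (rule sum.union_disjoint[OF h.finite_out bridges.finite_out]) (auto simp: cyl_edges_def)
  then show "fun_of (H_fib.ham f) v = fun_of (h.ham f + bridges.laplacian f) v"
    by (simp only: plus_ell2.rep_eq H_fib.fun_of_ham h.fun_of_ham bridges.fun_of_laplacian ac_simps)
qed

lemma h_form_le_H_fib_form: "h.ham f \<bullet> f \<le> H_fib.ham f \<bullet> f"
  using bridges.laplacian_nonneg[of f] by (simp add: H_fib_ham_eq inner_add_left)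

lemma H_fib_form_le: "H_fib.ham f \<bullet> f \<le> h.ham f \<bullet> f + 2 * real \<beta>\<^sub>+ * (f \<bullet> f)"
  using bridges.laplacian_le[of f] by (simp add: H_fib_ham_eq inner_add_left)

lemma H_fib_ham_eq_H0_fib_ham:
  assumes "\<And>v. v \<in> X \<Longrightarrow> Q v \<noteq> 0 \<Longrightarrow> fun_of f v = 0"
  shows "H_fib.ham f = H0_fib.ham f"
proof (rule ell2_eqI)
  fix v
  have "complex_of_real (potential v) * fun_of f v = complex_of_real (if v \<in> X then W v else 0) * fun_of f v"
    using assms[of v] by (auto simp: potential_def)
  then show "fun_of (H_fib.ham f) v = fun_of (H0_fib.ham f) v"
    by (simp only: H_fib.fun_of_ham H0_fib.fun_of_ham)
qed

lemma H_fib_essential_spectrum_nonneg: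
  assumes nonneg: "\<And>f. f \<in> supported X \<Longrightarrow> 0 \<le> H0_fib.ham f \<bullet> f" and z: "z \<in> H_fib_op.essential_spectrum"
  shows "0 \<le> z"
proof (rule ccontr)
  assume "\<not> 0 \<le> z"
  define F where "F = (\<lambda>(c, v). csc c (delta v)) ` ({1, \<i>} \<times> {v \<in> X. Q v \<noteq> 0})"
  have F: "finite F" using Qfin by (simp add: F_def)
  have "H_fib_op.negative_index_ge 0 (Suc (card F))"
    using H_fib_op.negative_index_ge_if_essential[OF z] \<open>\<not> 0 \<le> z\<close> by simp
  then obtain B where B: "finite B" "independent B" "card B = Suc (card F)" "B \<subseteq> supported X"
    "span B \<subseteq> supported X" "\<forall>f\<in>span B. f \<noteq> 0 \<longrightarrow> H_fib.ham f \<bullet> f < 0 * (f \<bullet> f)"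
    by (rule H_fib_op.negative_index_geE)
  obtain f where f: "f \<in> span B" "f \<noteq> 0" "f \<in> F\<^sup>\<bottom>"
    by (rule exists_nonzero_in_span_orthogonal[OF B(2,1) F]) (use B(3) in simp)
  have "fun_of f v = 0" if "v \<in> X" "Q v \<noteq> 0" for v
  proof -
    have orthogonal: "f \<bullet> csc c (delta v) = 0" if "c \<in> {1, \<i>}" for c
      using f(3) that \<open>v \<in> X\<close> \<open>Q v \<noteq> 0\<close>
      by (force simp: F_def orthogonal_comp_def orthogonal_def inner_commute)
    show ?thesis
      using orthogonal[of 1] orthogonal[of \<i>]
      by (simp only: inner_delta insert_iff) (simp add: complex_eq_iff inner_complex_def)
  qed
  then have "H_fib.ham f = H0_fib.ham f" by (rule H_fib_ham_eq_H0_fib_ham)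
  moreover have "H_fib.ham f \<bullet> f < 0" using B(6) f(1,2) by simp
  moreover have "0 \<le> H0_fib.ham f \<bullet> f" using f(1) B(5) by (intro nonneg) auto
  ultimately show False by simp
qed

lemma minmax_H_fib_bounds:
  assumes j: "1 \<le> j"
  shows "h_op.minmax j \<le> H_fib_op.minmax j" "H_fib_op.minmax j \<le> h_op.minmax j + 2 * real \<beta>\<^sub>+"
proof -
  have dim: "infinite_dimensional (supported X)"
    using infinite_X by (rule infinite_dimensional_supported)
  show "h_op.minmax j \<le> H_fib_op.minmax j"
    using minmax_perturb_le[OF H_fib.self_adjoint_ham h.self_adjoint_ham _ dim j, of 0] h_form_le_H_fib_form by simp
  show "H_fib_op.minmax j \<le> h_op.minmax j + 2 * real \<beta>\<^sub>+"
    by (rule minmax_perturb_le[OF h.self_adjoint_ham H_fib.self_adjoint_ham H_fib_form_le dim j])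
qed

lemma lam_H_fib_in_mu_interval:
  assumes nonneg: "\<And>f. f \<in> supported X \<Longrightarrow> 0 \<le> H0_fib.ham f \<bullet> f" and j: "1 \<le> j"
    and num_fin: "enat j \<le> num_fin X (opHfib d V src tgt W Q \<theta>)"
    and lam: "lam X (opHfib d V src tgt W Q \<theta>) j \<le> 0"
  shows "lam X (opHfib d V src tgt W Q \<theta>) j \<in>
    {mu X (oph d V src tgt W Q) j .. mu X (oph d V src tgt W Q) j + 2 * real \<beta>\<^sub>+}"
proof -
  let ?lam = "lam X (opHfib d V src tgt W Q \<theta>) j" and ?mu = "mu X (oph d V src tgt W Q) j"
  have mu: "?mu = h_op.minmax (2 * j)" by (rule h_op.mu_eq_minmax[OF infinite_X j])
  have "?lam \<le> H_fib_op.minmax (2 * j)"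
  proof (cases "H_fib_op.minmax (2 * j) < 0")
    case True
    then show ?thesis
      using H_fib_essential_spectrum_nonneg[OF nonneg]
      by (intro H_fib_op.lam_le_minmax[OF infinite_X j])
  qed (use lam in simp)
  moreover have "H_fib_op.minmax (2 * j) \<le> ?lam" by (rule H_fib_op.minmax_le_lam[OF j num_fin])
  ultimately show ?thesis using minmax_H_fib_bounds[of "2 * j"] j by (simp add: mu)
qed

end

theorem theorem2p2:
  fixes dt d :: nat and V :: "pt set" and src tgt :: "'e \<Rightarrow> pt" and rev :: "'e \<Rightarrow> 'e"
    and W Q :: "pt \<Rightarrow> real"
  assumes dims: "2 \<le> dt" "1 \<le> d" "d < dt"
    and pts: "\<forall>v\<in>V. \<forall>i\<ge>dt. v i = 0"
    and infV: "infinite V"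
    and ends: "\<forall>e. src e \<in> V \<and> tgt e \<in> V"
    and revs: "\<forall>e. rev (rev e) = e \<and> rev e \<noteq> e \<and> src (rev e) = tgt e"
    and findeg: "\<forall>v. finite {e. src e = v}"
    and conn: "\<forall>u\<in>V. \<forall>v\<in>V. (u, v) \<in> (range (\<lambda>e. (src e, tgt e)))\<^sup>*"
    and Vper: "\<forall>s<dt. \<forall>v. v \<in> V \<longleftrightarrow> unitshift s v \<in> V"
    and Eper: "\<forall>s<dt. \<exists>T. bij T \<and> (\<forall>e. src (T e) = unitshift s (src e)
                 \<and> tgt (T e) = unitshift s (tgt e) \<and> T (rev e) = rev (T e))"
    and finquot: "finite {v \<in> V. \<forall>i<dt. 0 \<le> v i \<and> v i < 1}"
    and Wper: "\<forall>s<dt. \<forall>v\<in>V. W (unitshift s v) = W v"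
    and norm: "inf_spec V (opH0 V src tgt W) = 0"
    and Qpos: "\<forall>v\<in>V. 0 \<le> Q v"
    and Qper: "\<forall>s<d. \<forall>v\<in>V. Q (unitshift s v) = Q v"
    and Qfin: "finite {v \<in> Vcyl d V. Q v \<noteq> 0}"
  shows "\<forall>j \<in> {1..N_g d V src tgt W Q}.
           guided_band_o d V src tgt W Q j \<subseteq>
             {mu (Vcyl d V) (oph d V src tgt W Q) j ..
              mu (Vcyl d V) (oph d V src tgt W Q) j + 2 * real (beta_plus d V src tgt)}"
proof (intro ballI subsetI)
  fix j x
  assume j: "j \<in> {1..N_g d V src tgt W Q}" and "x \<in> guided_band_o d V src tgt W Q j"
  then obtain \<theta> where x: "x = lam (Vcyl d V) (opHfib d V src tgt W Q \<theta>) j" "x \<le> 0"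
    and num_fin: "enat j \<le> num_fin (Vcyl d V) (opHfib d V src tgt W Q \<theta>)"
    unfolding guided_band_o_def guided_band_def by blast
  interpret guided dt d V src tgt rev W \<theta> Q
    by unfold_locales (fact dims infV ends revs findeg Vper Eper finquot Wper Qfin)+
  interpret H0_op: l2_operator H0.ham V "opH0 V src tgt W" by (rule l2_operator_H0)
  have "0 \<le> H0.ham F \<bullet> F" if "F \<in> supported V" for F
    using H0_op.inf_spec_le_form[OF that] norm by simp
  then have "0 \<le> H0_fib.ham f \<bullet> f" if "f \<in> supported X" for f using that by (rule fiber_ham_nonneg)
  then show "x \<in> {mu (Vcyl d V) (oph d V src tgt W Q) j ..
              mu (Vcyl d V) (oph d V src tgt W Q) j + 2 * real (beta_plus d V src tgt)}"
    using lam_H_fib_in_mu_interval[of j] j x num_fin by simp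
qed

end
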